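(* Let $k$ be an infinite field, $k_1/k$ a separable quadratic extension, $G=R_{k_1/k}(\mathrm{GL}_2)\times\mathrm{GL}_2$ acting on the space $V$ of pairs of binary Hermitian forms as described in the context, and $V^{\mathrm{ss}}=\{x\in V:\Delta(x)\neq 0\}$. Then the map $\alpha_V:G_k\backslash V_k^{\mathrm{ss}}\to\mathfrak{Ex}_2$, $G_kx\mapsto k(x)$, is bijective.
   Context: $k$ is an infinite field of arbitrary characteristic with separable closure $k^{\mathrm{sep}}$; $k_1\subset k^{\mathrm{sep}}$ is a separable quadratic extension of $k$ and $\sigma$ the nontrivial element of $\mathrm{Gal}(k_1/k)$. $G=R_{k_1/k}(\mathrm{GL}_2)\times \mathrm{GL}_2$ is regarded as an algebraic group over $k$, so $G_k=\mathrm{GL}_2(k_1)\times\mathrm{GL}_2(k)$. Let $W$ be the $k$-space of binary Hermitian forms, i.e. $2\times 2$ matrices $A$ with entries in $k_1$ with ${}^tA^\sigma=A$, and $V=W\otimes k^2$; an element is written $x=M_x(v)=v_1x_1+v_2x_2$ with $x_1,x_2\in W$, viewed as a Hermitian matrix whose entries are linear forms in $v=(v_1,v_2)$. The action is $(g_1,g_2)\cdot M(v)=g_1M(vg_2)\,{}^tg_1^\sigma$ (extended to points over $k$-algebras in the obvious way). For $x\in V$, $F_x(v)=\det M_x(v)$ is a binary quadratic form with coefficients in $k$, $\Delta(x)$ is its discriminant, and $V^{\mathrm{ss}}=\{\Delta\neq0\}$. For $x\in V$, $G_x$ is its stabilizer and $G_x^0$ the identity component. Let $w=v_1\,\mathrm{diag}(1,0)+v_2\,\mathrm{diag}(0,1)$;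 then $G_w/G_w^0$ is the constant group $\mathfrak S_2$ (generated by the image of $\tau=\bigl(\begin{pmatrix}0&1\\1&0\end{pmatrix},\begin{pmatrix}0&1\\1&0\end{pmatrix}\bigr)$). For $x\in V_k^{\mathrm{ss}}$ choose $g\in G(k^{\mathrm{sep}})$ with $x=g\cdot w$ (such $g$ exists); for $\eta\in\mathrm{Gal}(k^{\mathrm{sep}}/k)$, $g^{-1}g^\eta\in G_w(k^{\mathrm{sep}})$, and let $\rho_x(\eta)$ be its image in $\mathfrak S_2$. The kernel of $\rho_x$ is an open subgroup; its fixed field $k(x)$ is a Galois extension of $k$ whose isomorphism class depends only on the orbit $G_kx$. $\mathfrak{Ex}_2$ denotes the set of isomorphism classes of Galois extensions of $k$ which are splitting fields of degree-2 polynomials without multiple roots (i.e. $k$ itself and the separable quadratic extensions), and $\alpha_V(G_kx)=k(x)$. *)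

theory Defs
  imports "HOL-Analysis.Analysis" "HOL-Computational_Algebra.Polynomial" "HOL-Algebra.Group_Action"
begin

section \<open>Subfields of a separable closure\<close>

text \<open>The type \<^typ>\<open>'a\<close> plays the role of the separable closure; all other fields are subsets of it.\<close>

definition is_subfield :: "'a::field set \<Rightarrow> bool" where
  "is_subfield K \<longleftrightarrow> 0 \<in> K \<and> 1 \<in> K \<and>
     (\<forall>x\<in>K. \<forall>y\<in>K. x - y \<in> K \<and> x * y \<in> K) \<and> (\<forall>x\<in>K. inverse x \<in> K)"

definition poly_over :: "'a::field set \<Rightarrow> 'a poly \<Rightarrow> bool" where
  "poly_over K p \<longleftrightarrow> (\<forall>i. coeff p i \<in> K)"

definition separable_poly :: "'a::field poly \<Rightarrow> bool" where
  "separable_poly p \<longleftrightarrow> coprime p (pderiv p)"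

definition algebraic_ext :: "'a::field set \<Rightarrow> 'a set \<Rightarrow> bool" where
  "algebraic_ext K L \<longleftrightarrow> is_subfield L \<and> K \<subseteq> L \<and>
     (\<forall>x\<in>L. \<exists>p. p \<noteq> 0 \<and> poly_over K p \<and> poly p x = 0)"

definition separable_ext :: "'a::field set \<Rightarrow> 'a set \<Rightarrow> bool" where
  "separable_ext K L \<longleftrightarrow> is_subfield L \<and> K \<subseteq> L \<and>
     (\<forall>x\<in>L. \<exists>p. separable_poly p \<and> poly_over K p \<and> poly p x = 0)"

definition UNIV_is_separable_closure :: "'a::field set \<Rightarrow> bool" where
  "UNIV_is_separable_closure K \<longleftrightarrow> separable_ext K UNIV \<and>
     (\<forall>p :: 'a poly. separable_poly p \<and> degree p > 0 \<longrightarrow> (\<exists>a. poly p a = 0))"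

definition separable_quadratic_ext :: "'a::field set \<Rightarrow> 'a set \<Rightarrow> bool" where
  "separable_quadratic_ext K L \<longleftrightarrow> separable_ext K L \<and>
     (\<exists>e\<^sub>1\<in>L. \<exists>e\<^sub>2\<in>L. \<forall>x\<in>L. \<exists>!c. c \<in> K \<times> K \<and> x = fst c * e\<^sub>1 + snd c * e\<^sub>2)"

text \<open>Only the values on \<open>L\<close> of a function in \<open>ext_isos K L L'\<close> are constrained.\<close>

definition ext_isos :: "'a::field set \<Rightarrow> 'a set \<Rightarrow> 'a set \<Rightarrow> ('a \<Rightarrow> 'a) set" where
  "ext_isos K L L' = {f. bij_betw f L L' \<and>
     (\<forall>x\<in>L. \<forall>y\<in>L. f (x + y) = f x + f y \<and> f (x * y) = f x * f y) \<and> (\<forall>x\<in>K. f x = x)}"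

abbreviation Gal :: "'a::field set \<Rightarrow> 'a set \<Rightarrow> ('a \<Rightarrow> 'a) set" where
  "Gal K L \<equiv> ext_isos K L L"

definition galois_ext :: "'a::field set \<Rightarrow> 'a set \<Rightarrow> bool" where
  "galois_ext K L \<longleftrightarrow> algebraic_ext K L \<and> {x\<in>L. \<forall>f\<in>Gal K L. f x = x} = K"

definition is_splitting_field :: "'a::field set \<Rightarrow> 'a poly \<Rightarrow> 'a set \<Rightarrow> bool" where
  "is_splitting_field K p L \<longleftrightarrow>
     (\<exists>as. p = smult (lead_coeff p) (\<Prod>a\<leftarrow>as. [:-a, 1:]) \<and> L = is_subfield hull (K \<union> set as))"

text \<open>Every algebraic separable extension of \<open>K\<close> embeds in the separable closure, so isomorphism
  classes of such extensions are represented by classes of subfields of \<^typ>\<open>'a\<close>.\<close>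

definition ext_class :: "'a::field set \<Rightarrow> 'a set \<Rightarrow> 'a set set" where
  "ext_class K L = {L'. is_subfield L' \<and> K \<subseteq> L' \<and> ext_isos K L L' \<noteq> {}}"

definition Ex2 :: "'a::field set \<Rightarrow> 'a set set set" where
  "Ex2 K = ext_class K ` {L. galois_ext K L \<and>
     (\<exists>p. poly_over K p \<and> degree p = 2 \<and> rsquarefree p \<and> is_splitting_field K p L)}"


section \<open>The group and the representation over the base field\<close>

type_synonym 'a mat2 = "'a ^ 2 ^ 2"

definition smat :: "'a::field \<Rightarrow> 'a mat2 \<Rightarrow> 'a mat2" where
  "smat c A = map_matrix ((*) c) A"

definition mats_over :: "'a::field set \<Rightarrow> 'a mat2 set" where
  "mats_over K = {A. \<forall>i j. A $ i $ j \<in> K}"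

definition GL2 :: "'a::field set \<Rightarrow> 'a mat2 monoid" where
  "GL2 K = \<lparr>carrier = {A \<in> mats_over K. det A \<noteq> 0}, mult = (**), one = mat 1\<rparr>"

definition G_k :: "'a::field set \<Rightarrow> 'a set \<Rightarrow> ('a mat2 \<times> 'a mat2) monoid" where
  "G_k k k\<^sub>1 = GL2 k\<^sub>1 \<times>\<times> GL2 k"

definition herm_forms :: "'a::field set \<Rightarrow> ('a \<Rightarrow> 'a) \<Rightarrow> 'a mat2 set" where
  "herm_forms k\<^sub>1 \<sigma> = {A \<in> mats_over k\<^sub>1. transpose (map_matrix \<sigma> A) = A}"

text \<open>The pair \<open>(x\<^sub>1, x\<^sub>2)\<close> stands for \<open>v\<^sub>1 x\<^sub>1 + v\<^sub>2 x\<^sub>2\<close>.\<close>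

definition V_k :: "'a::field set \<Rightarrow> ('a \<Rightarrow> 'a) \<Rightarrow> ('a mat2 \<times> 'a mat2) set" where
  "V_k k\<^sub>1 \<sigma> = herm_forms k\<^sub>1 \<sigma> \<times> herm_forms k\<^sub>1 \<sigma>"

definition M_form :: "'a::field mat2 \<times> 'a mat2 \<Rightarrow> 'a ^ 2 \<Rightarrow> 'a mat2" where
  "M_form x v = smat (v $ 1) (fst x) + smat (v $ 2) (snd x)"

text \<open>A matrix of linear forms \<open>N(v)\<close> is recovered from the pair of its values at the two
  standard basis vectors.\<close>

definition act_k :: "('a::field \<Rightarrow> 'a) \<Rightarrow> 'a mat2 \<times> 'a mat2 \<Rightarrow>
    'a mat2 \<times> 'a mat2 \<Rightarrow> 'a mat2 \<times> 'a mat2" where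
  "act_k \<sigma> g x =
     (let N = (\<lambda>v. fst g ** M_form x (v v* snd g) ** transpose (map_matrix \<sigma> (fst g)))
      in (N (axis 1 1), N (axis 2 1)))"

definition F_form :: "'a::field mat2 \<times> 'a mat2 \<Rightarrow> 'a ^ 2 \<Rightarrow> 'a" where
  "F_form x v = det (M_form x v)"

text \<open>For \<open>F(v) = a v\<^sub>1\<^sup>2 + b v\<^sub>1 v\<^sub>2 + c v\<^sub>2\<^sup>2\<close> one has \<open>a = F(1,0)\<close>, \<open>c = F(0,1)\<close> and
  \<open>b = F(1,1) - F(1,0) - F(0,1)\<close>.\<close>

definition bqf_disc :: "('a::field ^ 2 \<Rightarrow> 'a) \<Rightarrow> 'a" where
  "bqf_disc F =
     (let a = F (axis 1 1); c = F (axis 2 1); b = F (axis 1 1 + axis 2 1) - a - c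
      in b\<^sup>2 - 4 * a * c)"

definition V_k_ss :: "'a::field set \<Rightarrow> ('a \<Rightarrow> 'a) \<Rightarrow> ('a mat2 \<times> 'a mat2) set" where
  "V_k_ss k\<^sub>1 \<sigma> = {x \<in> V_k k\<^sub>1 \<sigma>. bqf_disc (F_form x) \<noteq> 0}"

definition w_elem :: "'a::field mat2 \<times> 'a mat2" where
  "w_elem = (\<chi> i j. if i = 1 \<and> j = 1 then 1 else 0, \<chi> i j. if i = 2 \<and> j = 2 then 1 else 0)"


section \<open>Points over the separable closure\<close>

text \<open>Write \<open>k\<^sub>s\<close> for the separable closure and let \<open>\<theta>\<close> be an element of \<open>k\<^sub>1\<close> outside \<open>k\<close>, so that
  \<open>1, \<theta>\<close> is a \<open>k\<close>-basis of \<open>k\<^sub>1\<close>. The algebra of \<open>2 \<times> 2\<close> matrices over \<open>k\<^sub>1 \<otimes>\<^sub>k k\<^sub>s\<close> is free with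
  basis \<open>1, \<theta>\<close> over the matrices over \<open>k\<^sub>s\<close>; the pair \<open>(A, B)\<close> stands for \<open>A + \<theta> B\<close>.
  Multiplication uses \<open>\<theta>\<^sup>2 = (\<theta> + \<sigma> \<theta>) \<theta> - \<theta> \<sigma>(\<theta>)\<close>. Note that \<open>\<theta>\<close> here is \<open>\<theta> \<otimes> 1\<close>, which is not to be
  confused with the scalar \<open>1 \<otimes> \<theta>\<close>.\<close>

type_synonym 'a tmat = "'a mat2 \<times> 'a mat2"

fun tmult :: "('a::field \<Rightarrow> 'a) \<Rightarrow> 'a \<Rightarrow> 'a tmat \<Rightarrow> 'a tmat \<Rightarrow> 'a tmat" where
  "tmult \<sigma> \<theta> (A, B) (C, D) =
     (A ** C - smat (\<theta> * \<sigma> \<theta>) (B ** D), A ** D + B ** C + smat (\<theta> + \<sigma> \<theta>) (B ** D))"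

text \<open>Transpose of the image under \<open>\<sigma> \<otimes> 1\<close>, where \<open>\<sigma> \<theta> = (\<theta> + \<sigma> \<theta>) - \<theta>\<close>.\<close>

fun tadj :: "('a::field \<Rightarrow> 'a) \<Rightarrow> 'a \<Rightarrow> 'a tmat \<Rightarrow> 'a tmat" where
  "tadj \<sigma> \<theta> (A, B) = (transpose A + smat (\<theta> + \<sigma> \<theta>) (transpose B), - transpose B)"

definition GL2_tensor :: "('a::field \<Rightarrow> 'a) \<Rightarrow> 'a \<Rightarrow> 'a tmat monoid" where
  "GL2_tensor \<sigma> \<theta> = units_of \<lparr>carrier = UNIV, mult = tmult \<sigma> \<theta>, one = (mat 1, 0)\<rparr>"

definition G_sep :: "('a::field \<Rightarrow> 'a) \<Rightarrow> 'a \<Rightarrow> ('a tmat \<times> 'a mat2) monoid" where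
  "G_sep \<sigma> \<theta> = GL2_tensor \<sigma> \<theta> \<times>\<times> GL2 UNIV"

definition M_form_sep :: "'a::field tmat \<times> 'a tmat \<Rightarrow> 'a ^ 2 \<Rightarrow> 'a tmat" where
  "M_form_sep x v = (M_form (fst (fst x), fst (snd x)) v, M_form (snd (fst x), snd (snd x)) v)"

definition act_sep :: "('a::field \<Rightarrow> 'a) \<Rightarrow> 'a \<Rightarrow> 'a tmat \<times> 'a mat2 \<Rightarrow>
    'a tmat \<times> 'a tmat \<Rightarrow> 'a tmat \<times> 'a tmat" where
  "act_sep \<sigma> \<theta> g x =
     (let N = (\<lambda>v. tmult \<sigma> \<theta> (tmult \<sigma> \<theta> (fst g) (M_form_sep x (v v* snd g))) (tadj \<sigma> \<theta> (fst g)))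
      in (N (axis 1 1), N (axis 2 1)))"

text \<open>The coordinates over \<open>k\<close> of an element of \<open>k\<^sub>1\<close>, and the resulting maps from matrices over
  \<open>k\<^sub>1\<close> to matrices over \<open>k\<^sub>1 \<otimes>\<^sub>k k\<^sub>s\<close> (induced by \<open>a \<mapsto> a \<otimes> 1\<close>) and from \<open>V\<^sub>k\<close> to \<open>V(k\<^sub>s)\<close>.\<close>

definition coords :: "'a::field set \<Rightarrow> 'a \<Rightarrow> 'a \<Rightarrow> 'a \<times> 'a" where
  "coords k \<theta> a = (THE c. c \<in> k \<times> k \<and> a = fst c + \<theta> * snd c)"

definition mat_to_sep :: "'a::field set \<Rightarrow> 'a \<Rightarrow> 'a mat2 \<Rightarrow> 'a tmat" where
  "mat_to_sep k \<theta> A =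
     (map_matrix (\<lambda>a. fst (coords k \<theta> a)) A, map_matrix (\<lambda>a. snd (coords k \<theta> a)) A)"

definition V_to_sep :: "'a::field set \<Rightarrow> 'a \<Rightarrow> 'a mat2 \<times> 'a mat2 \<Rightarrow> 'a tmat \<times> 'a tmat" where
  "V_to_sep k \<theta> x = (mat_to_sep k \<theta> (fst x), mat_to_sep k \<theta> (snd x))"

text \<open>The Galois group of the separable closure acts on \<open>k\<^sub>1 \<otimes>\<^sub>k k\<^sub>s\<close> through the second factor,
  hence coordinatewise.\<close>

fun galois_on_G :: "('a::field \<Rightarrow> 'a) \<Rightarrow> 'a tmat \<times> 'a mat2 \<Rightarrow> 'a tmat \<times> 'a mat2" where
  "galois_on_G \<eta> ((A, B), C) = ((map_matrix \<eta> A, map_matrix \<eta> B), map_matrix \<eta> C)"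


section \<open>Identity components and the field attached to a point\<close>

inductive_set poly_funs :: "('a::field tmat \<times> 'a mat2 \<Rightarrow> 'a) set" where
  const: "(\<lambda>_. c) \<in> poly_funs"
| coord1: "(\<lambda>g. fst (fst g) $ i $ j) \<in> poly_funs"
| coord2: "(\<lambda>g. snd (fst g) $ i $ j) \<in> poly_funs"
| coord3: "(\<lambda>g. snd g $ i $ j) \<in> poly_funs"
| add: "f \<in> poly_funs \<Longrightarrow> h \<in> poly_funs \<Longrightarrow> (\<lambda>g. f g + h g) \<in> poly_funs"
| mult: "f \<in> poly_funs \<Longrightarrow> h \<in> poly_funs \<Longrightarrow> (\<lambda>g. f g * h g) \<in> poly_funs"

definition zariski :: "('a::field tmat \<times> 'a mat2) topology" where
  "zariski = topology_generated_by {{g. f g \<noteq> 0} | f. f \<in> poly_funs}"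

definition stab_sep :: "('a::field \<Rightarrow> 'a) \<Rightarrow> 'a \<Rightarrow> 'a tmat \<times> 'a tmat \<Rightarrow> ('a tmat \<times> 'a mat2) set" where
  "stab_sep \<sigma> \<theta> x = stabilizer (G_sep \<sigma> \<theta>) (act_sep \<sigma> \<theta>) x"

text \<open>The \<open>k\<^sub>s\<close>-points of the identity component. The stabilizers of semistable points are smooth, so
  their \<open>k\<^sub>s\<close>-points are dense and the component can be computed in the Zariski topology on them.\<close>

definition stab0_sep :: "('a::field \<Rightarrow> 'a) \<Rightarrow> 'a \<Rightarrow> 'a tmat \<times> 'a tmat \<Rightarrow> ('a tmat \<times> 'a mat2) set" where
  "stab0_sep \<sigma> \<theta> x =
     connected_component_of_set (subtopology zariski (stab_sep \<sigma> \<theta> x)) \<one>\<^bsub>G_sep \<sigma> \<theta>\<^esub>"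

definition comp_group :: "('a::field \<Rightarrow> 'a) \<Rightarrow> 'a \<Rightarrow> 'a tmat \<times> 'a tmat \<Rightarrow>
    ('a tmat \<times> 'a mat2) set monoid" where
  "comp_group \<sigma> \<theta> x =
     (G_sep \<sigma> \<theta>)\<lparr>carrier := stab_sep \<sigma> \<theta> x\<rparr> Mod stab0_sep \<sigma> \<theta> x"

definition trivializer :: "'a::field set \<Rightarrow> ('a \<Rightarrow> 'a) \<Rightarrow> 'a \<Rightarrow> 'a mat2 \<times> 'a mat2 \<Rightarrow>
    'a tmat \<times> 'a mat2" where
  "trivializer k \<sigma> \<theta> x =
     (SOME g. g \<in> carrier (G_sep \<sigma> \<theta>) \<and> V_to_sep k \<theta> x = act_sep \<sigma> \<theta> g (V_to_sep k \<theta> w_elem))"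

definition rho :: "'a::field set \<Rightarrow> ('a \<Rightarrow> 'a) \<Rightarrow> 'a \<Rightarrow> 'a mat2 \<times> 'a mat2 \<Rightarrow> ('a \<Rightarrow> 'a) \<Rightarrow>
    ('a tmat \<times> 'a mat2) set" where
  "rho k \<sigma> \<theta> x \<eta> =
     (let g = trivializer k \<sigma> \<theta> x
      in stab0_sep \<sigma> \<theta> (V_to_sep k \<theta> w_elem) #>\<^bsub>G_sep \<sigma> \<theta>\<^esub>
           (inv\<^bsub>G_sep \<sigma> \<theta>\<^esub> g \<otimes>\<^bsub>G_sep \<sigma> \<theta>\<^esub> galois_on_G \<eta> g))"

definition rho_kernel :: "'a::field set \<Rightarrow> ('a \<Rightarrow> 'a) \<Rightarrow> 'a \<Rightarrow> 'a mat2 \<times> 'a mat2 \<Rightarrow> ('a \<Rightarrow> 'a) set" where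
  "rho_kernel k \<sigma> \<theta> x =
     {\<eta> \<in> Gal k UNIV. rho k \<sigma> \<theta> x \<eta> = \<one>\<^bsub>comp_group \<sigma> \<theta> (V_to_sep k \<theta> w_elem)\<^esub>}"

definition field_of :: "'a::field set \<Rightarrow> ('a \<Rightarrow> 'a) \<Rightarrow> 'a \<Rightarrow> 'a mat2 \<times> 'a mat2 \<Rightarrow> 'a set" where
  "field_of k \<sigma> \<theta> x = {a. \<forall>\<eta>\<in>rho_kernel k \<sigma> \<theta> x. \<eta> a = a}"

text \<open>The common value of \<open>x \<mapsto> ext_class k (k(x))\<close> on an orbit.\<close>

definition alpha_V :: "'a::field set \<Rightarrow> ('a \<Rightarrow> 'a) \<Rightarrow> 'a \<Rightarrow> ('a mat2 \<times> 'a mat2) set \<Rightarrow> 'a set set" where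
  "alpha_V k \<sigma> \<theta> X = the_elem ((\<lambda>x. ext_class k (field_of k \<sigma> \<theta> x)) ` X)"

end

theory Submission
  imports Defs
begin

text \<open>
  Over the separable closure \<open>k\<^sub>s\<close> the algebra \<open>k\<^sub>1 \<otimes>\<^sub>k k\<^sub>s\<close> splits as \<open>k\<^sub>s \<times> k\<^sub>s\<close>, and a group element
  becomes a triple \<open>(P, Q, C)\<close> of invertible matrices acting by \<open>M(v) \<mapsto> P M(v C) Q\<^sup>t\<close>. The stabilizer of
  \<open>w\<close> consists of the triples of diagonal matrices, which form a torus, and of a second coset in which
  \<open>C\<close> is antidiagonal. Hence \<open>\<rho>\<^sub>x(\<eta>)\<close> is trivial iff \<open>\<eta>\<close> fixes the two zeros of \<open>F\<^sub>x\<close> on the projective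
  line, and \<open>k(x)\<close> is the splitting field of \<open>F\<^sub>x\<close>.

  On the other hand every semistable pair is equivalent over \<open>k\<close> to a pair \<open>x\<^sub>1 = diag(1, d)\<close>,
  \<open>x\<^sub>2 = ((0, 1), (1, c))\<close>, for which \<open>F\<^sub>x(v) = d v\<^sub>1\<^sup>2 + c v\<^sub>1 v\<^sub>2 - v\<^sub>2\<^sup>2\<close>: one chooses a first basis vector on
  which the two Hermitian forms take the values \<open>(1, 0)\<close> and clears the remaining entries. An affine
  substitution \<open>\<alpha> \<mapsto> p + q \<alpha>\<close> of the roots of \<open>X\<^sup>2 - c X - d\<close> is realized by \<open>G\<^sub>k\<close>, so the orbit depends
  only on the field generated by the roots.
\<close>

text \<open>The separable closure is the whole type, so the Galois theory takes place inside one
  field: an automorphism fixing a given subfield must be built from a prescribed value at one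
  element. Separability of minimal polynomials supplies the roots that every extension step needs.

  The characteristic is arbitrary. Hence the normal form keeps the coefficient \<open>c\<close>, and
  the polynomial X^2 - c X - d with discriminant c^2 + 4 d takes the place of a square root. Nonzero
  values of a Hermitian form come from nondegeneracy of the trace form, that is, from
  \<open>\<theta> \<noteq> \<sigma> \<theta>\<close>.

  The Galois group acts on \<open>k\<^sub>1 \<otimes> k\<^sub>s\<close> through the second factor,
  so it does not commute with the two projections to \<open>k\<^sub>s\<close>: an automorphism may
  exchange \<open>\<theta>\<close> and \<open>\<sigma> \<theta>\<close>. The cocycle is therefore
  read off from the component \<open>C\<close>, on which the Galois action is plain.

  The identity component is topological; infinitude of the field makes a line with finitely many
  points removed connected in the Zariski topology.\<close>

lemma is_subfieldD:
  assumes "is_subfield K"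
  shows "0 \<in> K" "1 \<in> K"
    and "\<And>x y. x \<in> K \<Longrightarrow> y \<in> K \<Longrightarrow> x - y \<in> K"
    and "\<And>x y. x \<in> K \<Longrightarrow> y \<in> K \<Longrightarrow> x * y \<in> K"
    and "\<And>x. x \<in> K \<Longrightarrow> inverse x \<in> K"
    and "\<And>x. x \<in> K \<Longrightarrow> - x \<in> K"
    and "\<And>x y. x \<in> K \<Longrightarrow> y \<in> K \<Longrightarrow> x + y \<in> K"
    and "\<And>x y. x \<in> K \<Longrightarrow> y \<in> K \<Longrightarrow> x / y \<in> K"
    and "\<And>x n. x \<in> K \<Longrightarrow> x ^ n \<in> K"
proof -
  show 0: "0 \<in> K" and 1: "1 \<in> K"
    and d: "\<And>x y. x \<in> K \<Longrightarrow> y \<in> K \<Longrightarrow> x - y \<in> K"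
    and m: "\<And>x y. x \<in> K \<Longrightarrow> y \<in> K \<Longrightarrow> x * y \<in> K"
    and i: "\<And>x. x \<in> K \<Longrightarrow> inverse x \<in> K"
    using assms by (auto simp: is_subfield_def)
  show u: "- x \<in> K" if "x \<in> K" for x
    using d[OF 0 that] by simp
  show "x + y \<in> K" if "x \<in> K" "y \<in> K" for x y
    using d[OF that(1) u[OF that(2)]] by simp
  show "x / y \<in> K" if "x \<in> K" "y \<in> K" for x y
    using m[OF that(1) i[OF that(2)]] by (simp add: divide_inverse)
  show "x ^ n \<in> K" if "x \<in> K" for x n
    by (induction n) (auto intro: 1 m that)
qed

lemma separable_poly_nonzero: "separable_poly p \<Longrightarrow> p \<noteq> 0"
  by (auto simp: separable_poly_def)

lemma separable_poly_dvd:
  assumes "separable_poly p" "q dvd p"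
  shows "separable_poly q"
  unfolding separable_poly_def
proof (rule coprimeI)
  fix d assume d: "d dvd q" "d dvd pderiv q"
  obtain r where "p = q * r"
    using assms(2) by (elim dvdE)
  then have "d dvd pderiv p" "d dvd p"
    using d by (auto simp: pderiv_mult)
  then show "is_unit d"
    using assms(1) by (auto simp: separable_poly_def coprime_def)
qed

section \<open>Extending automorphisms to the separable closure\<close>

text \<open>The graph of an \<open>L\<close>-algebra homomorphism from a subalgebra of \<^typ>\<open>'a\<close> to \<^typ>\<open>'a\<close>.\<close>

definition partial_hom :: "'a::field set \<Rightarrow> ('a \<times> 'a) set \<Rightarrow> bool" where
  "partial_hom L R \<longleftrightarrow> (\<forall>x\<in>L. (x, x) \<in> R) \<and>
     (\<forall>x y x' y'. (x, y) \<in> R \<longrightarrow> (x', y') \<in> R \<longrightarrow> (x - x', y - y') \<in> R \<and> (x * x', y * y') \<in> R) \<and>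
     (\<forall>y. (0, y) \<in> R \<longrightarrow> y = 0)"

text \<open>A homomorphism applied to the coefficients, in graph form: the image polynomial is
  carried as a second argument, and single-valuedness comes from \<open>rel_unique\<close>.\<close>

definition poly_rel :: "('a::field \<times> 'a) set \<Rightarrow> 'a poly \<Rightarrow> 'a poly \<Rightarrow> bool" where
  "poly_rel R p q \<longleftrightarrow> (\<forall>i. (coeff p i, coeff q i) \<in> R)"

locale partial_field_hom =
  fixes L :: "'a::field set" and R :: "('a \<times> 'a) set"
  assumes subfield: "is_subfield L"
    and separable: "\<And>x. \<exists>p. separable_poly p \<and> poly_over L p \<and> poly p x = 0"
    and hom: "partial_hom L R"
begin

lemma rel_refl: "x \<in> L \<Longrightarrow> (x, x) \<in> R"
  using hom by (auto simp: partial_hom_def)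

lemma rel_zero: "(0, 0) \<in> R"
  by (rule rel_refl) (rule is_subfieldD[OF subfield])

lemma rel_diff: "(x, y) \<in> R \<Longrightarrow> (x', y') \<in> R \<Longrightarrow> (x - x', y - y') \<in> R"
  using hom by (auto simp: partial_hom_def)

lemma rel_mult: "(x, y) \<in> R \<Longrightarrow> (x', y') \<in> R \<Longrightarrow> (x * x', y * y') \<in> R"
  using hom by (auto simp: partial_hom_def)

lemma rel_zeroD: "(0, y) \<in> R \<Longrightarrow> y = 0"
  using hom by (auto simp: partial_hom_def)

lemma rel_add: "(x, y) \<in> R \<Longrightarrow> (x', y') \<in> R \<Longrightarrow> (x + x', y + y') \<in> R"
  using rel_diff[OF _ rel_diff[OF rel_zero], of x y x' y'] by simp

lemma rel_sum: "(\<And>i. i \<in> I \<Longrightarrow> (f i, g i) \<in> R) \<Longrightarrow> (sum f I, sum g I) \<in> R"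
  by (induction I rule: infinite_finite_induct) (auto intro: rel_zero rel_add)

lemma rel_unique: "(x, y) \<in> R \<Longrightarrow> (x, y') \<in> R \<Longrightarrow> y = y'"
  using rel_zeroD[of "y - y'"] rel_diff[of x y x y'] by simp

lemma poly_rel_eval:
  assumes "poly_rel R p q" "(x, y) \<in> R"
  shows "(poly p x, poly q y) \<in> R"
proof -
  have "(poly p' x, poly q' y) \<in> R" if "\<forall>i. (coeff p' i, coeff q' i) \<in> R" for p' q'
    using that
  proof (induction p' q' rule: poly_induct2)
    case 0
    then show ?case by (simp add: rel_zero)
  next
    case (pCons a p b q)
    have "(a, b) \<in> R" using pCons.prems[rule_format, of 0] by simp
    moreover have "\<forall>i. (coeff p i, coeff q i) \<in> R"
      using pCons.prems[rule_format, of "Suc _"] by simp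
    ultimately show ?case
      using pCons.IH assms(2) by (auto intro!: rel_add rel_mult)
  qed
  then show ?thesis
    using assms(1) by (simp add: poly_rel_def)
qed

lemma poly_rel_refl: "poly_over L p \<Longrightarrow> poly_rel R p p"
  by (simp add: poly_rel_def poly_over_def rel_refl)

lemma poly_rel_diff: "poly_rel R p q \<Longrightarrow> poly_rel R p' q' \<Longrightarrow> poly_rel R (p - p') (q - q')"
  by (simp add: poly_rel_def rel_diff)

lemma poly_rel_add: "poly_rel R p q \<Longrightarrow> poly_rel R p' q' \<Longrightarrow> poly_rel R (p + p') (q + q')"
  by (simp add: poly_rel_def rel_add)

lemma poly_rel_mult: "poly_rel R p q \<Longrightarrow> poly_rel R p' q' \<Longrightarrow> poly_rel R (p * p') (q * q')"
  by (auto simp: poly_rel_def coeff_mult intro!: rel_sum rel_mult)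

lemma poly_rel_monom: "(c, d) \<in> R \<Longrightarrow> poly_rel R (monom c n) (monom d n)"
  by (simp add: poly_rel_def rel_zero)

lemma poly_rel_zeroD: "poly_rel R 0 q \<Longrightarrow> q = 0"
  using rel_zeroD by (auto simp: poly_rel_def poly_eq_iff)

text \<open>Factors X are stripped from \<open>p\<close> until its constant term \<open>c\<close> is
  nonzero; then x * p(x) = -c exhibits the inverse of \<open>x\<close> as a polynomial in
  \<open>x\<close> over \<open>L\<close>.\<close>

lemma inverse_as_poly:
  assumes "p \<noteq> 0" "poly_over L p" "poly p x = 0" "x \<noteq> 0"
  shows "\<exists>s. poly_over L s \<and> inverse x = poly s x"
  using assms
proof (induction p)
  case (pCons c p)
  have p: "poly_over L p" and c: "c \<in> L"
    using pCons.prems(2) unfolding poly_over_def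
    by (auto dest: spec[of _ "Suc _"] spec[of _ 0])
  show ?case
  proof (cases "c = 0")
    case True
    then show ?thesis
      using pCons p by (cases "p = 0") auto
  next
    case False
    define s where "s = smult (- inverse c) p"
    have "poly_over L s"
      using p c is_subfieldD[OF subfield] by (simp add: s_def poly_over_def)
    moreover have "inverse x = poly s x"
    proof (rule inverse_unique)
      have "x * poly p x = - c"
        using pCons.prems(3) by (simp add: add_eq_0_iff)
      moreover have "x * poly s x = - inverse c * (x * poly p x)"
        by (simp add: s_def mult.left_commute)
      ultimately show "x * poly s x = 1"
        using False by simp
    qed
    ultimately show ?thesis by blast
  qed
qed simp

text \<open>The domain of \<open>R\<close> is only given as a subring. It is a field because all its
  elements are algebraic over \<open>L\<close>, so inverses are polynomial expressions, which
  \<open>R\<close> carries along.\<close>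

lemma rel_inverse:
  assumes "(x, y) \<in> R"
  shows "(inverse x, inverse y) \<in> R"
proof (cases "x = 0")
  case True
  then have "y = 0" using assms rel_zeroD by simp
  then show ?thesis using True rel_zero by simp
next
  case False
  obtain p where "separable_poly p" "poly_over L p" "poly p x = 0"
    using separable by blast
  then obtain s where s: "poly_over L s" "inverse x = poly s x"
    using inverse_as_poly[of p x] separable_poly_nonzero False by auto
  have *: "(inverse x, poly s y) \<in> R"
    unfolding s(2) by (intro poly_rel_eval poly_rel_refl s assms)
  have "(1, y * poly s y) \<in> R"
    using rel_mult[OF assms *] False by simp
  moreover have "(1, 1) \<in> R"
    by (rule rel_refl) (rule is_subfieldD[OF subfield])
  ultimately have "y * poly s y = 1"
    by (rule rel_unique)
  then show ?thesis
    using * inverse_unique by metis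
qed

end

text \<open>\<open>m\<close> is a minimal polynomial of \<open>a\<close> over the domain of
  \<open>R\<close>, and \<open>m'\<close> is its image. It is not normalized to be monic, so
  division by \<open>m\<close> also inverts its leading coefficient.\<close>

locale partial_field_hom_minpoly = partial_field_hom +
  fixes a m m'
  assumes m_nonzero: "m \<noteq> 0" and m_rel: "poly_rel R m m'" and m_root: "poly m a = 0"
    and m_minimal: "\<And>q r. q \<noteq> 0 \<Longrightarrow> poly_rel R q r \<Longrightarrow> poly q a = 0 \<Longrightarrow> degree m \<le> degree q"
begin

text \<open>If the leading coefficient had image 0, multiplying by its inverse would relate 1 to
  0.\<close>

lemma coeff_degree_nonzero: "coeff m' (degree m) \<noteq> 0"
proof
  assume "coeff m' (degree m) = 0"
  then have "(lead_coeff m, 0) \<in> R"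
    using m_rel unfolding poly_rel_def by metis
  from rel_mult[OF this rel_inverse[OF this]] have "(1, 0) \<in> R"
    using m_nonzero by simp
  moreover have "(1, 1) \<in> R"
    by (rule rel_refl) (rule is_subfieldD[OF subfield])
  ultimately show False
    using rel_unique by fastforce
qed

text \<open>Long division by \<open>m\<close>, performed at the same time on the images. The
  factorization of \<open>r\<close> is the point: it makes evaluation at a root of \<open>m'\<close>
  well defined.\<close>

lemma minpoly_dvd:
  assumes "poly_rel R q r" "poly q a = 0"
  shows "\<exists>s s'. poly_rel R s s' \<and> q = m * s \<and> r = m' * s'"
  using assms
\<comment> \<open>The number of coefficients, unlike the degree, also drops when a nonzero constant
  is reduced to 0.\<close>
proof (induction "length (coeffs q)" arbitrary: q r rule: less_induct)
  case less
  show ?case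
  proof (cases "q = 0")
    case True
    then have "r = 0" using less.prems poly_rel_zeroD by simp
    then show ?thesis
      using True poly_rel_refl[of 0] is_subfieldD(1)[OF subfield]
      by (intro exI[of _ 0]) (auto simp: poly_over_def)
  next
    case False
    define c where "c = lead_coeff q * inverse (lead_coeff m)"
    define c' where "c' = coeff r (degree q) * inverse (coeff m' (degree m))"
    define n where "n = degree q - degree m"
    have cc: "(c, c') \<in> R"
      unfolding c_def c'_def using less.prems(1) m_rel
      by (intro rel_mult rel_inverse) (auto simp: poly_rel_def)
    have le: "degree m \<le> degree q"
      by (rule m_minimal[OF False less.prems])
    define q1 where "q1 = q - m * monom c n"
    define r1 where "r1 = r - m' * monom c' n"
    have rel1: "poly_rel R q1 r1"
      unfolding q1_def r1_def by (intro poly_rel_diff poly_rel_mult poly_rel_monom less.prems m_rel cc)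
    have root1: "poly q1 a = 0"
      using less.prems(2) m_root by (simp add: q1_def)
    have "degree (m * monom c n) \<le> degree m + n"
      by (rule order.trans[OF degree_mult_le]) (simp add: degree_monom_le)
    then have "degree q1 \<le> degree q"
      unfolding q1_def using le by (intro degree_diff_le) (auto simp: n_def)
    moreover have "coeff q1 (degree q) = 0"
    proof -
      have "coeff (m * monom c n) (degree m + n) = lead_coeff m * c"
        by (subst mult.commute, subst coeff_monom_mult) (simp add: mult.commute)
      then show ?thesis
        using le m_nonzero by (simp add: q1_def n_def c_def)
    qed
    ultimately have "q1 = 0 \<or> degree q1 < degree q"
      by (rule eq_zero_or_degree_less)
    then have "length (coeffs q1) < length (coeffs q)"
      using False by (cases "q1 = 0") (auto simp: length_coeffs_degree)
    from less.hyps[OF this rel1 root1] obtain s s'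
      where s: "poly_rel R s s'" "q1 = m * s" "r1 = m' * s'" by blast
    have "q = m * (s + monom c n)" "r = m' * (s' + monom c' n)"
      using s by (simp_all add: q1_def r1_def distrib_left diff_eq_eq)
    moreover have "poly_rel R (s + monom c n) (s' + monom c' n)"
      by (intro poly_rel_add poly_rel_monom s cc)
    ultimately show ?thesis by blast
  qed
qed

text \<open>A separable polynomial over \<open>L\<close> that kills \<open>a\<close> is its own
  image, so \<open>m'\<close> divides it.\<close>

lemma minpoly_image_separable:
  "separable_poly m'"
proof -
  obtain p where p: "separable_poly p" "poly_over L p" "poly p a = 0"
    using separable by blast
  then obtain s' where "p = m' * s'"
    using minpoly_dvd[OF poly_rel_refl] by blast
  then show ?thesis
    using p(1) separable_poly_dvd dvd_triv_left by metis
qed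

lemma minpoly_degree_pos: "degree m > 0"
proof (rule ccontr)
  assume "\<not> degree m > 0"
  then obtain c where "m = [:c:]" by (auto elim: degree_eq_zeroE)
  then show False using m_nonzero m_root by simp
qed

lemma minpoly_image_degree_pos: "degree m' > 0"
  using minpoly_degree_pos coeff_degree_nonzero le_degree by fastforce

text \<open>The extension sends q(a) to r(b), where \<open>r\<close> is the image of
  \<open>q\<close>. If q(a) = 0, then \<open>m'\<close> divides \<open>r\<close> and r(b) = 0, which
  is the well-definedness required by the last clause of \<open>partial_hom\<close>.\<close>

lemma adjoin_root:
  assumes "poly m' b = 0"
  shows "\<exists>R'. partial_hom L R' \<and> R \<subseteq> R' \<and> (a, b) \<in> R'"
proof (intro exI conjI)
  let ?R = "{(poly q a, poly r b) | q r. poly_rel R q r}"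
  have const: "poly_rel R [:x:] [:y:]" if "(x, y) \<in> R" for x y
    using poly_rel_monom[OF that, of 0] by (simp add: monom_0)
  show sub: "R \<subseteq> ?R"
  proof
    fix z assume "z \<in> R"
    then show "z \<in> ?R"
      using const[of "fst z" "snd z"]
      by (intro CollectI exI[of _ "[:fst z:]"] exI[of _ "[:snd z:]"]) auto
  qed
  have "poly_rel R [:0, 1:] [:0, 1:]"
    using is_subfieldD(1,2)[OF subfield]
    by (intro poly_rel_refl) (auto simp: poly_over_def coeff_pCons split: nat.split)
  then show "(a, b) \<in> ?R"
    by (intro CollectI exI[of _ "[:0, 1:]"]) auto
  show "partial_hom L ?R"
    unfolding partial_hom_def
  proof (intro conjI allI impI ballI)
    fix x y x' y' assume "(x, y) \<in> ?R" "(x', y') \<in> ?R"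
    then obtain q r q' r' where *: "poly_rel R q r" "poly_rel R q' r'"
      "x = poly q a" "y = poly r b" "x' = poly q' a" "y' = poly r' b" by blast
    have "(x - x', y - y') = (poly (q - q') a, poly (r - r') b)"
      "(x * x', y * y') = (poly (q * q') a, poly (r * r') b)"
      using * by simp_all
    with poly_rel_diff[OF *(1,2)] poly_rel_mult[OF *(1,2)]
    show "(x - x', y - y') \<in> ?R" "(x * x', y * y') \<in> ?R"
      by - (intro CollectI exI conjI; assumption)+
  next
    fix y assume "(0, y) \<in> ?R"
    then obtain q r where qr: "poly_rel R q r" "poly q a = 0" "y = poly r b" by force
    then show "y = 0"
      using minpoly_dvd[OF qr(1,2)] assms by auto
  qed (use sub rel_refl in blast)
qed

end

lemma (in partial_field_hom) ex_minpoly: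
  "\<exists>m m'. partial_field_hom_minpoly L R a m m'"
proof -
  let ?P = "\<lambda>q. q \<noteq> 0 \<and> (\<exists>r. poly_rel R q r) \<and> poly q a = 0"
  obtain p where "separable_poly p" "poly_over L p" "poly p a = 0"
    using separable by blast
  then have "?P p"
    using separable_poly_nonzero poly_rel_refl by blast
  from ex_has_least_nat[of ?P, OF this, of degree]
  obtain m where m: "?P m" "\<And>q. ?P q \<Longrightarrow> degree m \<le> degree q" by blast
  then obtain m' where "poly_rel R m m'" by blast
  with m have "partial_field_hom_minpoly L R a m m'"
    by unfold_locales blast+
  then show ?thesis by blast
qed

section \<open>Extension of partial homomorphisms to automorphisms of the separable closure\<close>

lemma partial_hom_Union:
  assumes "\<C> \<noteq> {}" "\<And>R. R \<in> \<C> \<Longrightarrow> partial_hom L R" "\<And>R S. R \<in> \<C> \<Longrightarrow> S \<in> \<C> \<Longrightarrow> R \<subseteq> S \<or> S \<subseteq> R"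
  shows "partial_hom L (\<Union>\<C>)"
  unfolding partial_hom_def
proof (intro conjI allI impI ballI)
  fix x y x' y' assume "(x, y) \<in> \<Union>\<C>" "(x', y') \<in> \<Union>\<C>"
  then obtain S where "S \<in> \<C>" "(x, y) \<in> S" "(x', y') \<in> S"
    using assms(3) by blast
  moreover from this have "(x - x', y - y') \<in> S \<and> (x * x', y * y') \<in> S"
    using assms(2)[of S] by (simp add: partial_hom_def)
  ultimately show "(x - x', y - y') \<in> \<Union>\<C>" "(x * x', y * y') \<in> \<Union>\<C>"
    by (auto intro: UnionI)
qed (use assms(1,2) in \<open>auto simp: partial_hom_def\<close>)

lemma ex_maximal_partial_hom:
  assumes "partial_hom L R"
  shows "\<exists>M. partial_hom L M \<and> R \<subseteq> M \<and> (\<forall>S. partial_hom L S \<longrightarrow> M \<subseteq> S \<longrightarrow> S = M)"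
proof -
  let ?A = "{S. partial_hom L S \<and> R \<subseteq> S}"
  have "\<exists>M\<in>?A. \<forall>X\<in>?A. M \<subseteq> X \<longrightarrow> X = M"
  proof (rule subset_Zorn_nonempty)
    show "?A \<noteq> {}" using assms by blast
    fix \<C> assume *: "\<C> \<noteq> {}" "subset.chain ?A \<C>"
    have sub: "\<C> \<subseteq> ?A" and total: "\<And>X Y. X \<in> \<C> \<Longrightarrow> Y \<in> \<C> \<Longrightarrow> X \<subseteq> Y \<or> Y \<subseteq> X"
      using *(2) by (simp_all add: subset_chain_def)
    have "partial_hom L (\<Union>\<C>)"
      by (rule partial_hom_Union[OF *(1) _ total]) (use sub in auto)
    moreover have "R \<subseteq> \<Union>\<C>"
      using *(1) sub by auto
    ultimately show "\<Union>\<C> \<in> ?A"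
      by simp
  qed
  then obtain M where "partial_hom L M" "R \<subseteq> M" "\<And>X. X \<in> ?A \<Longrightarrow> M \<subseteq> X \<Longrightarrow> X = M"
    by auto
  then show ?thesis
    by (metis (no_types, lifting) mem_Collect_eq order.trans)
qed

text \<open>A maximal extension is total, because the image of any minimal polynomial is separable
  and has a root in the closure. It is surjective because it permutes the finitely many roots of
  each separable polynomial over \<open>L\<close>.\<close>

lemma ex_automorphism_extending:
  fixes L :: "'a::field set"
  assumes "is_subfield L" "UNIV_is_separable_closure L" "partial_hom L R"
  shows "\<exists>\<eta>\<in>Gal L UNIV. \<forall>(x, y)\<in>R. \<eta> x = y"
proof -
  have sep: "\<exists>p. separable_poly p \<and> poly_over L p \<and> poly p x = 0" for x
    using assms(2) by (auto simp: UNIV_is_separable_closure_def separable_ext_def)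
  obtain M where M: "partial_hom L M" "R \<subseteq> M" "\<And>S. partial_hom L S \<Longrightarrow> M \<subseteq> S \<Longrightarrow> S = M"
    using ex_maximal_partial_hom[OF assms(3)] by blast
  interpret partial_field_hom L M
    by unfold_locales (use assms sep M in auto)
  have "\<exists>y. (x, y) \<in> M" for x
  proof -
    obtain m m' where "partial_field_hom_minpoly L M x m m'"
      using ex_minpoly by blast
    then interpret partial_field_hom_minpoly L M x m m' .
    obtain b where "poly m' b = 0"
      using assms(2) minpoly_image_separable minpoly_image_degree_pos
      by (auto simp: UNIV_is_separable_closure_def)
    from adjoin_root[OF this] obtain R' where "partial_hom L R'" "M \<subseteq> R'" "(x, b) \<in> R'"
      by auto
    then show ?thesis
      using M(3) by auto
  qed
  then obtain \<eta> where \<eta>: "\<And>x. (x, \<eta> x) \<in> M" by metis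
  have eq: "\<eta> x = y" if "(x, y) \<in> M" for x y
    using that \<eta> rel_unique by blast
  have add: "\<eta> (x + y) = \<eta> x + \<eta> y" and mult: "\<eta> (x * y) = \<eta> x * \<eta> y"
    and diff: "\<eta> (x - y) = \<eta> x - \<eta> y" for x y
    using \<eta> by (auto intro!: eq rel_add rel_mult rel_diff)
  have fix_L: "\<eta> x = x" if "x \<in> L" for x
    using that by (intro eq rel_refl)
  have "\<eta> x = 0 \<longleftrightarrow> x = 0" for x
    using rel_inverse[OF \<eta>[of x]] \<eta> mult[of x "inverse x"] fix_L is_subfieldD(1,2)[OF assms(1)]
    by (cases "x = 0") auto
  then have "inj \<eta>"
    using diff by (intro injI) (metis right_minus_eq)
  moreover have "surj \<eta>"
    unfolding surj_def
  proof
    fix y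
    obtain p where p: "separable_poly p" "poly_over L p" "poly p y = 0"
      using sep by blast
    let ?Z = "{x. poly p x = 0}"
    have "\<eta> ` ?Z \<subseteq> ?Z"
    proof clarsimp
      fix x assume "poly p x = 0"
      then show "poly p (\<eta> x) = 0"
        using poly_rel_eval[OF poly_rel_refl[OF p(2)] \<eta>[of x]] rel_zeroD by simp
    qed
    moreover have "finite ?Z"
      using p(1) separable_poly_nonzero poly_roots_finite by blast
    ultimately have "\<eta> ` ?Z = ?Z"
      using \<open>inj \<eta>\<close> by (meson endo_inj_surj inj_on_subset subset_UNIV)
    then show "\<exists>x. y = \<eta> x"
      using p(3) by blast
  qed
  ultimately have "\<eta> \<in> Gal L UNIV"
    using add mult fix_L by (simp add: ext_isos_def bij_def)
  then show ?thesis
    using M(2) eq by blast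
qed

section \<open>Fixed fields\<close>

lemma UNIV_is_separable_closure_mono:
  assumes "UNIV_is_separable_closure k" "k \<subseteq> L"
  shows "UNIV_is_separable_closure L"
proof -
  have "poly_over L p" if "poly_over k p" for p
    using that assms(2) by (auto simp: poly_over_def)
  then show ?thesis
    using assms(1) unfolding UNIV_is_separable_closure_def separable_ext_def by blast
qed

text \<open>A minimal polynomial of \<open>a\<close> has degree above 1, since \<open>a\<close> is
  not in \<open>L\<close>. By separability it has a root \<open>b\<close> different from
  \<open>a\<close>, and the homomorphism sending \<open>a\<close> to \<open>b\<close> extends to the
  closure.\<close>

lemma ex_automorphism_moving:
  fixes L :: "'a::field set"
  assumes L: "is_subfield L" and sc: "UNIV_is_separable_closure L" and "a \<notin> L"
  shows "\<exists>\<eta>\<in>Gal L UNIV. \<eta> a \<noteq> a"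
proof -
  have sep: "\<exists>p. separable_poly p \<and> poly_over L p \<and> poly p x = 0" for x
    using sc by (auto simp: UNIV_is_separable_closure_def separable_ext_def)
  \<comment> \<open>The identity of \<open>L\<close>; for this relation a polynomial over
    \<open>L\<close> is its own image, so \<open>m' = m\<close>.\<close>
  have "partial_hom L (Id_on L)"
    using is_subfieldD[OF L] by (auto simp: partial_hom_def)
  then interpret partial_field_hom L "Id_on L"
    by unfold_locales (use L sep in auto)
  obtain m m' where "partial_field_hom_minpoly L (Id_on L) a m m'"
    using ex_minpoly by blast
  then interpret partial_field_hom_minpoly L "Id_on L" a m m' .
  have m'[simp]: "m' = m" and m_L: "poly_over L m"
    using m_rel by (auto simp: poly_rel_def poly_eq_iff poly_over_def Id_on_iff) metis
  obtain r where r: "m = [:-a, 1:] * r"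
    using m_root by (auto simp: poly_eq_0_iff_dvd elim: dvdE)
  have "r \<noteq> 0" using r m_nonzero by auto
  have "degree r > 0"
  proof (rule ccontr)
    assume "\<not> degree r > 0"
    then obtain c where c: "r = [:c:]" by (auto elim: degree_eq_zeroE)
    have "c \<noteq> 0" using c \<open>r \<noteq> 0\<close> by simp
    have "m = [:- (a * c), c:]" using r c by simp
    then have "coeff m 0 = - (a * c)" "coeff m 1 = c" by simp_all
    then have "- (a * c) \<in> L" "c \<in> L"
      using m_L unfolding poly_over_def by metis+
    then have "- (- (a * c) / c) \<in> L"
      using is_subfieldD(6,8)[OF L] by blast
    moreover have "- (- (a * c) / c) = a"
      using \<open>c \<noteq> 0\<close> by simp
    ultimately show False
      using \<open>a \<notin> L\<close> by metis
  qed
  moreover have "separable_poly r"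
    using minpoly_image_separable r m' by (metis separable_poly_dvd dvd_triv_right)
  ultimately obtain b where b: "poly r b = 0"
    using sc by (auto simp: UNIV_is_separable_closure_def)
  have "b \<noteq> a"
  proof
    assume "b = a"
    then have "[:-a, 1:] dvd r" using b by (simp add: poly_eq_0_iff_dvd)
    then have "[:-a, 1:] dvd pderiv m" "[:-a, 1:] dvd m"
      unfolding r pderiv_mult by (simp_all only: dvd_add dvd_mult dvd_mult2 dvd_refl)
    then have "is_unit [:-a, 1:]"
      using minpoly_image_separable by (auto simp: separable_poly_def coprime_def)
    then show False by (simp add: is_unit_pCons_iff)
  qed
  moreover have "poly m' b = 0" using b r by simp
  then obtain R' where R': "partial_hom L R'" "(a, b) \<in> R'"
    using adjoin_root by blast
  ultimately show ?thesis
    using ex_automorphism_extending[OF L sc R'(1)] by fastforce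
qed

section \<open>Two by two matrices\<close>

definition m2 :: "'a \<Rightarrow> 'a \<Rightarrow> 'a \<Rightarrow> 'a \<Rightarrow> 'a ^ 2 ^ 2" where
  "m2 a b c d = (\<chi> i j. if i = 1 then (if j = 1 then a else b) else (if j = 1 then c else d))"

lemma m2_nth [simp]:
  "m2 a b c d $ 1 $ 1 = a" "m2 a b c d $ 1 $ 2 = b"
  "m2 a b c d $ 2 $ 1 = c" "m2 a b c d $ 2 $ 2 = d"
  by (simp_all add: m2_def)

lemma mat2_eq_iff:
  fixes A B :: "'a ^ 2 ^ 2"
  shows "A = B \<longleftrightarrow> A $ 1 $ 1 = B $ 1 $ 1 \<and> A $ 1 $ 2 = B $ 1 $ 2 \<and>
    A $ 2 $ 1 = B $ 2 $ 1 \<and> A $ 2 $ 2 = B $ 2 $ 2"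
  by (auto simp: vec_eq_iff forall_2)

lemma m2_cases: obtains a b c d where "A = m2 a b c d"
  using that[of "A $ 1 $ 1" "A $ 1 $ 2" "A $ 2 $ 1" "A $ 2 $ 2"] by (simp add: mat2_eq_iff)

lemma m2_eq_iff [simp]: "m2 a b c d = m2 a' b' c' d' \<longleftrightarrow> a = a' \<and> b = b' \<and> c = c' \<and> d = d'"
  by (simp add: mat2_eq_iff)

lemma m2_mult [simp]:
  fixes a :: "'a::semiring_1"
  shows "m2 a b c d ** m2 a' b' c' d' =
    m2 (a * a' + b * c') (a * b' + b * d') (c * a' + d * c') (c * b' + d * d')"
  by (simp add: mat2_eq_iff matrix_matrix_mult_def sum_2)

lemma m2_simps [simp]:
  "transpose (m2 a b c d) = m2 a c b d"
  "map_matrix f (m2 a b c d) = m2 (f a) (f b) (f c) (f d)"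
  by (simp_all add: mat2_eq_iff transpose_def)

lemma m2_ring_simps [simp]:
  fixes a :: "'a::field"
  shows "smat x (m2 a b c d) = m2 (x * a) (x * b) (x * c) (x * d)"
    "m2 a b c d + m2 a' b' c' d' = m2 (a + a') (b + b') (c + c') (d + d')"
    "m2 a b c d - m2 a' b' c' d' = m2 (a - a') (b - b') (c - c') (d - d')"
    "- m2 a b c d = m2 (- a) (- b) (- c) (- d)"
    "det (m2 a b c d) = a * d - b * c"
    "m2 a b c d \<in> mats_over K \<longleftrightarrow> a \<in> K \<and> b \<in> K \<and> c \<in> K \<and> d \<in> K"
  by (simp_all add: mat2_eq_iff smat_def det_2 mats_over_def forall_2)

lemma mat_1_m2: "mat 1 = (m2 1 0 0 1 :: 'a::field ^ 2 ^ 2)"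
  and zero_m2: "0 = (m2 0 0 0 0 :: 'a::field ^ 2 ^ 2)"
  by (simp_all add: mat2_eq_iff mat_def)

lemma w_elem_m2: "w_elem = (m2 1 0 0 0, m2 0 0 0 1)"
  by (simp add: w_elem_def mat2_eq_iff)

lemma vector_matrix_mult_2:
  fixes C :: "'a::field ^ 2 ^ 2"
  shows "(v v* C) $ j = v $ 1 * C $ 1 $ j + v $ 2 * C $ 2 $ j"
  by (simp add: vector_matrix_mult_def sum_2 mult.commute)

lemma axis_2 [simp]:
  "axis 1 a $ (1::2) = a" "axis 1 a $ (2::2) = 0" "axis 2 a $ (1::2) = 0" "axis 2 a $ (2::2) = a"
  by (simp_all add: axis_def)

section \<open>The action of a triple of matrices on pairs of matrices\<close>

text \<open>One formula for both settings: over \<open>k\<close> the matrix \<open>Q\<close> is the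
  conjugate of \<open>P\<close>, over the separable closure \<open>P\<close> and \<open>Q\<close>
  are independent.\<close>

definition act2 :: "'a::field mat2 \<Rightarrow> 'a mat2 \<Rightarrow> 'a mat2 \<Rightarrow> 'a mat2 \<times> 'a mat2 \<Rightarrow> 'a mat2 \<times> 'a mat2" where
  "act2 P Q C x = (P ** M_form x (axis 1 1 v* C) ** transpose Q, P ** M_form x (axis 2 1 v* C) ** transpose Q)"

lemma act2_m2 [simp]:
  "act2 P Q (m2 a b c d) (x, y) =
    (P ** (smat a x + smat b y) ** transpose Q, P ** (smat c x + smat d y) ** transpose Q)"
  by (simp add: act2_def M_form_def vector_matrix_mult_2)

lemma act_k_eq_act2: "act_k \<sigma> g x = act2 (fst g) (map_matrix \<sigma> (fst g)) (snd g) x"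
  by (simp add: act_k_def act2_def)

lemma smat_distribs:
  "smat c (A + B) = smat c A + smat c B" "smat (c + d) A = smat c A + smat d A"
  "smat c (smat d A) = smat (c * d) A"
  "A ** smat c B = smat c (A ** B)" "smat c A ** B = smat c (A ** B)"
  "A ** (B + C) = A ** B + A ** C" "(A + B) ** C = A ** C + B ** C"
  by (simp_all add: mat2_eq_iff smat_def matrix_matrix_mult_def sum_2 algebra_simps)

lemma M_form_act2: "M_form (act2 P Q C x) v = P ** M_form x (v v* C) ** transpose Q"
  by (simp add: M_form_def act2_def vector_matrix_mult_2 smat_distribs add_ac)

lemma act2_mult: "act2 (P ** P') (Q ** Q') (C ** C') x = act2 P Q C (act2 P' Q' C' x)"
  by (simp add: act2_def[of P Q C] act2_def[of "P ** P'"] M_form_act2 matrix_transpose_mul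
      matrix_mul_assoc vector_matrix_mul_assoc)

lemma act2_one [simp]: "act2 (mat 1) (mat 1) (mat 1) x = x"
  by (cases x, rename_tac x1 x2, case_tac x1 rule: m2_cases, case_tac x2 rule: m2_cases)
    (simp add: mat_1_m2)

text \<open>Exchanging \<open>P\<close> and \<open>Q\<close> amounts to transposing. For symmetric
  or Hermitian data this derives the component at \<open>\<sigma> \<theta>\<close> from the
  component at \<open>\<theta>\<close>.\<close>

lemma act2_transpose:
  "act2 Q P C (transpose x, transpose y) = (transpose (fst (act2 P Q C (x, y))), transpose (snd (act2 P Q C (x, y))))"
  by (cases x rule: m2_cases; cases y rule: m2_cases; cases P rule: m2_cases;
        cases Q rule: m2_cases; cases C rule: m2_cases) (simp add: algebra_simps)

lemma F_form_act2: "F_form (act2 P Q C x) v = det P * det Q * F_form x (v v* C)"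
  by (simp add: F_form_def M_form_act2 det_mul det_transpose)

lemma bqf_disc_comp:
  assumes "\<And>v. F' v = r * F (v v* C)"
    and "\<And>v. F v = a * (v $ 1)\<^sup>2 + b * (v $ 1) * (v $ 2) + c * (v $ 2)\<^sup>2"
  shows "bqf_disc F' = (r * det C)\<^sup>2 * bqf_disc F"
  unfolding bqf_disc_def Let_def assms
  by (cases C rule: m2_cases) (simp add: vector_matrix_mult_2, simp add: algebra_simps power2_eq_square)

lemma F_form_quadratic:
  "F_form (m2 a b c d, m2 a' b' c' d') v = (a * d - b * c) * (v $ 1)\<^sup>2 +
     (a * d' + a' * d - b * c' - b' * c) * (v $ 1) * (v $ 2) + (a' * d' - b' * c') * (v $ 2)\<^sup>2"
  by (simp add: F_form_def M_form_def, simp add: algebra_simps power2_eq_square)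

lemma bqf_disc_F_form_act2:
  "bqf_disc (F_form (act2 P Q C x)) = (det P * det Q * det C)\<^sup>2 * bqf_disc (F_form x)"
  by (cases x, rename_tac x1 x2, case_tac x1 rule: m2_cases, case_tac x2 rule: m2_cases)
    (simp only:, rule bqf_disc_comp[OF F_form_act2 F_form_quadratic])

section \<open>The algebra of matrices over the tensor product\<close>

text \<open>For \<open>s\<close> one of \<open>\<theta>\<close>, \<open>\<sigma> \<theta>\<close>, the map \<open>tev s\<close> is induced by the algebra homomorphism from
  \<open>k\<^sub>1 \<otimes>\<^sub>k k\<^sub>s\<close> to \<open>k\<^sub>s\<close> that sends \<open>\<theta> \<otimes> 1\<close> to \<open>s\<close>.\<close>

definition tev :: "'a::field \<Rightarrow> 'a tmat \<Rightarrow> 'a mat2" where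
  "tev s X = fst X + smat s (snd X)"

lemma tmat_cases: obtains a b c d a' b' c' d' where "X = (m2 a b c d, m2 a' b' c' d')"
proof -
  obtain a b c d where "fst X = m2 a b c d" by (rule m2_cases)
  moreover obtain a' b' c' d' where "snd X = m2 a' b' c' d'" by (rule m2_cases)
  ultimately show ?thesis using that by (metis surjective_pairing)
qed

lemma tev_mult:
  assumes "s = \<theta> \<or> s = \<sigma> \<theta>"
  shows "tev s (tmult \<sigma> \<theta> X Y) = tev s X ** tev s Y"
  using assms by (cases X rule: tmat_cases; cases Y rule: tmat_cases)
    (auto simp: tev_def algebra_simps)

lemma tev_adj:
  "tev \<theta> (tadj \<sigma> \<theta> X) = transpose (tev (\<sigma> \<theta>) X)"
  "tev (\<sigma> \<theta>) (tadj \<sigma> \<theta> X) = transpose (tev \<theta> X)"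
  by (cases X rule: tmat_cases; simp add: tev_def algebra_simps)+

lemma tev_one [simp]: "tev s (mat 1, 0) = mat 1"
  by (simp add: tev_def mat_1_m2 zero_m2)

text \<open>A linear polynomial a + s b is determined by its values at two points. Together with
  \<open>tev_surj\<close> this is the splitting of the tensor product into two copies of the
  closure.\<close>

lemma tev_inject:
  assumes "s \<noteq> s'" "tev s X = tev s Y" "tev s' X = tev s' Y"
  shows "X = Y"
proof -
  have *: "b = b' \<and> a = a'" if "a + s * b = a' + s * b'" "a + s' * b = a' + s' * b'" for a a' b b' :: 'a
  proof -
    have "(s - s') * (b - b') = (a + s * b) - (a + s' * b) - ((a' + s * b') - (a' + s' * b'))"
      by (simp add: algebra_simps)
    also have "\<dots> = 0"
      using that by simp
    finally show ?thesis
      using assms(1) that by auto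
  qed
  show ?thesis
    using assms(2,3)
    by (cases X rule: tmat_cases; cases Y rule: tmat_cases) (simp add: tev_def, metis *)
qed

lemma tev_surj:
  assumes "s \<noteq> s'"
  obtains X where "tev s X = P" "tev s' X = Q"
proof -
  \<comment> \<open>Interpolation: the coefficient of \<open>\<theta>\<close> is the divided
    difference of the two prescribed values.\<close>
  define u where "u a b = (a - b) / (s - s')" for a b
  have u: "a - s * u a b + s' * u a b = b" for a b
  proof -
    have "(s - s') * u a b = a - b"
      using assms by (simp add: u_def)
    then show ?thesis
      by (simp add: algebra_simps)
  qed
  obtain a b c d where P: "P = m2 a b c d" by (rule m2_cases)
  obtain a' b' c' d' where Q: "Q = m2 a' b' c' d'" by (rule m2_cases)
  let ?B = "m2 (u a a') (u b b') (u c c') (u d d')"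
  have "tev s (P - smat s ?B, ?B) = P" "tev s' (P - smat s ?B, ?B) = Q"
    by (simp_all add: tev_def P Q u)
  then show ?thesis by (rule that)
qed

definition tevV :: "'a::field \<Rightarrow> 'a tmat \<times> 'a tmat \<Rightarrow> 'a mat2 \<times> 'a mat2" where
  "tevV s x = (tev s (fst x), tev s (snd x))"

lemma tev_M_form_sep: "tev s (M_form_sep x v) = M_form (tevV s x) v"
  by (simp add: tev_def tevV_def M_form_sep_def M_form_def smat_distribs mult.commute add_ac)

lemma tevV_act_sep:
  "tevV \<theta> (act_sep \<sigma> \<theta> g x) = act2 (tev \<theta> (fst g)) (tev (\<sigma> \<theta>) (fst g)) (snd g) (tevV \<theta> x)"
  "tevV (\<sigma> \<theta>) (act_sep \<sigma> \<theta> g x) = act2 (tev (\<sigma> \<theta>) (fst g)) (tev \<theta> (fst g)) (snd g) (tevV (\<sigma> \<theta>) x)"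
  unfolding act_sep_def act2_def Let_def tevV_def[of _ "(_, _)"]
  by (simp_all add: tev_mult tev_adj tev_M_form_sep)

lemma tevV_inject:
  "s \<noteq> s' \<Longrightarrow> tevV s x = tevV s y \<Longrightarrow> tevV s' x = tevV s' y \<Longrightarrow> x = y"
  using tev_inject[of s s' "fst x" "fst y"] tev_inject[of s s' "snd x" "snd y"]
  by (simp add: tevV_def prod_eqI)

section \<open>Invertible matrices and the group over the separable closure\<close>

lemma right_inverse_det_nonzero:
  fixes A :: "'a::field ^ 'n ^ 'n"
  assumes "A ** B = mat 1"
  shows "det A \<noteq> 0"
proof -
  have "det A * det B = 1"
    using arg_cong[OF assms, of det] by (simp only: det_mul det_I)
  then show ?thesis by auto
qed

lemma det_nonzero_inverse:
  fixes A :: "'a::field ^ 'n ^ 'n"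
  assumes "det A \<noteq> 0"
  obtains B where "A ** B = mat 1" "B ** A = mat 1" "det B \<noteq> 0"
  using assms that invertible_det_nz unfolding invertible_def by metis

lemma m2_inverse:
  fixes a :: "'a::field"
  assumes "a * d - b * c \<noteq> 0"
  defines "D \<equiv> a * d - b * c"
  shows "m2 (d / D) (- b / D) (- c / D) (a / D) ** m2 a b c d = mat 1"
  using assms by (simp add: mat_1_m2 divide_simps mult.commute)

lemma GL2_group:
  assumes "is_subfield K"
  shows "group (GL2 K)"
proof (rule groupI)
  fix A B assume AB: "A \<in> carrier (GL2 K)" "B \<in> carrier (GL2 K)"
  then have "A ** B \<in> mats_over K"
    using is_subfieldD[OF assms]
    by (cases A rule: m2_cases; cases B rule: m2_cases) (auto simp: GL2_def)
  then show "A \<otimes>\<^bsub>GL2 K\<^esub> B \<in> carrier (GL2 K)"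
    using AB by (simp add: GL2_def det_mul)
next
  fix A assume A: "A \<in> carrier (GL2 K)"
  obtain a b c d where [simp]: "A = m2 a b c d" by (rule m2_cases)
  define D where "D = a * d - b * c"
  \<comment> \<open>The adjugate formula shows that the entries of the inverse stay in
    \<open>K\<close>.\<close>
  define B where "B = m2 (d / D) (- b / D) (- c / D) (a / D)"
  have D: "D \<noteq> 0" using A by (simp add: GL2_def D_def)
  have eq: "B ** A = mat 1"
    using m2_inverse[of a d b c] D by (simp add: B_def D_def)
  have "det B * det A = 1"
    using arg_cong[OF eq, of det] by (simp only: det_mul det_I)
  then have "det B \<noteq> 0" by auto
  moreover have "B \<in> mats_over K"
  proof -
    have "D \<in> K" "a \<in> K" "b \<in> K" "c \<in> K" "d \<in> K"
      using A is_subfieldD[OF assms] by (auto simp: GL2_def D_def)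
    then show ?thesis
      using is_subfieldD(6,8)[OF assms] by (simp add: B_def)
  qed
  ultimately have "B \<in> carrier (GL2 K)" by (simp add: GL2_def)
  then show "\<exists>B\<in>carrier (GL2 K). B \<otimes>\<^bsub>GL2 K\<^esub> A = \<one>\<^bsub>GL2 K\<^esub>"
    using eq by (auto simp: GL2_def)
next
  show "\<one>\<^bsub>GL2 K\<^esub> \<in> carrier (GL2 K)"
    using is_subfieldD(1,2)[OF assms] by (simp add: GL2_def mat_1_m2)
qed (simp_all add: GL2_def matrix_mul_assoc)

lemma subfield_UNIV: "is_subfield UNIV"
  by (simp add: is_subfield_def)

locale split_tensor =
  fixes \<sigma> :: "'a::field \<Rightarrow> 'a" and \<theta> :: 'a
  assumes \<theta>_moved: "\<theta> \<noteq> \<sigma> \<theta>"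
begin

lemma tensor_monoid:
  "monoid \<lparr>carrier = UNIV, mult = tmult \<sigma> \<theta>, one = (mat 1, 0)\<rparr>"
  by (rule monoidI)
    (auto intro!: tev_inject[OF \<theta>_moved] simp: tev_mult matrix_mul_assoc simp del: tmult.simps)

text \<open>The inverse of \<open>X\<close> is interpolated from the inverses of its two
  evaluations.\<close>

lemma carrier_GL2_tensor:
  "carrier (GL2_tensor \<sigma> \<theta>) = {X. det (tev \<theta> X) \<noteq> 0 \<and> det (tev (\<sigma> \<theta>) X) \<noteq> 0}"
proof (intro subset_antisym subsetI)
  fix X assume "X \<in> carrier (GL2_tensor \<sigma> \<theta>)"
  then obtain Y where Y: "tmult \<sigma> \<theta> X Y = (mat 1, 0)"
    by (auto simp: GL2_tensor_def units_of_carrier Units_def)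
  have "det (tev s X) \<noteq> 0" if "s = \<theta> \<or> s = \<sigma> \<theta>" for s
    using arg_cong[OF Y, of "\<lambda>Z. det (tev s Z)"] that by (auto simp: tev_mult det_mul)
  then show "X \<in> {X. det (tev \<theta> X) \<noteq> 0 \<and> det (tev (\<sigma> \<theta>) X) \<noteq> 0}" by simp
next
  fix X assume "X \<in> {X. det (tev \<theta> X) \<noteq> 0 \<and> det (tev (\<sigma> \<theta>) X) \<noteq> 0}"
  then have X: "det (tev \<theta> X) \<noteq> 0" "det (tev (\<sigma> \<theta>) X) \<noteq> 0" by auto
  obtain P where P: "tev \<theta> X ** P = mat 1" "P ** tev \<theta> X = mat 1"
    using X(1) by (rule det_nonzero_inverse)
  obtain Q where Q: "tev (\<sigma> \<theta>) X ** Q = mat 1" "Q ** tev (\<sigma> \<theta>) X = mat 1"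
    using X(2) by (rule det_nonzero_inverse)
  obtain Y where "tev \<theta> Y = P" "tev (\<sigma> \<theta>) Y = Q"
    using \<theta>_moved by (rule tev_surj)
  then have "tmult \<sigma> \<theta> X Y = (mat 1, 0)" "tmult \<sigma> \<theta> Y X = (mat 1, 0)"
    using P Q by (auto intro!: tev_inject[OF \<theta>_moved] simp: tev_mult simp del: tmult.simps)
  then show "X \<in> carrier (GL2_tensor \<sigma> \<theta>)"
    unfolding GL2_tensor_def units_of_carrier Units_def by (simp del: split_paired_Ex) blast
qed

lemma GL2_tensor_simps:
  "mult (GL2_tensor \<sigma> \<theta>) = tmult \<sigma> \<theta>" "\<one>\<^bsub>GL2_tensor \<sigma> \<theta>\<^esub> = (mat 1, 0)"
  by (simp_all add: GL2_tensor_def units_of_mult units_of_one)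

lemma G_sep_group:
  "group (G_sep \<sigma> \<theta>)"
  unfolding G_sep_def GL2_tensor_def
  by (intro DirProd_group GL2_group subfield_UNIV monoid.units_group tensor_monoid)

lemma carrier_G_sep:
  "g \<in> carrier (G_sep \<sigma> \<theta>) \<longleftrightarrow>
    det (tev \<theta> (fst g)) \<noteq> 0 \<and> det (tev (\<sigma> \<theta>) (fst g)) \<noteq> 0 \<and> det (snd g) \<noteq> 0"
  by (cases g) (auto simp: G_sep_def carrier_GL2_tensor GL2_def mats_over_def)

lemma mult_G_sep: "g \<otimes>\<^bsub>G_sep \<sigma> \<theta>\<^esub> h = (tmult \<sigma> \<theta> (fst g) (fst h), snd g ** snd h)"
  by (simp add: G_sep_def mult_DirProd' GL2_tensor_simps GL2_def)

lemma one_G_sep: "\<one>\<^bsub>G_sep \<sigma> \<theta>\<^esub> = ((mat 1, 0), mat 1)"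
  by (simp add: G_sep_def GL2_tensor_simps GL2_def)

lemma act_sep_mult:
  "act_sep \<sigma> \<theta> (g \<otimes>\<^bsub>G_sep \<sigma> \<theta>\<^esub> h) x = act_sep \<sigma> \<theta> g (act_sep \<sigma> \<theta> h x)"
  by (rule tevV_inject[OF \<theta>_moved]) (simp_all add: tevV_act_sep mult_G_sep tev_mult act2_mult)

lemma act_sep_one:
  "act_sep \<sigma> \<theta> \<one>\<^bsub>G_sep \<sigma> \<theta>\<^esub> x = x"
  by (rule tevV_inject[OF \<theta>_moved]) (simp_all add: tevV_act_sep one_G_sep)

lemma stab_sep_subgroup:
  "subgroup (stab_sep \<sigma> \<theta> x) (G_sep \<sigma> \<theta>)"
proof -
  interpret group "G_sep \<sigma> \<theta>" by (rule G_sep_group)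
  show ?thesis
  proof (rule subgroupI)
    show "stab_sep \<sigma> \<theta> x \<noteq> {}"
      using act_sep_one[of x] one_closed unfolding stab_sep_def stabilizer_def by blast
  next
    fix g assume "g \<in> stab_sep \<sigma> \<theta> x"
    then have g: "g \<in> carrier (G_sep \<sigma> \<theta>)" "act_sep \<sigma> \<theta> g x = x"
      by (auto simp: stab_sep_def stabilizer_def)
    have "act_sep \<sigma> \<theta> (inv\<^bsub>G_sep \<sigma> \<theta>\<^esub> g) x = x"
      using act_sep_mult[ of "inv\<^bsub>G_sep \<sigma> \<theta>\<^esub> g" g x] g
      by (simp add: act_sep_one)
    then show "inv\<^bsub>G_sep \<sigma> \<theta>\<^esub> g \<in> stab_sep \<sigma> \<theta> x"
      using g by (simp add: stab_sep_def stabilizer_def)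
  qed (auto simp: stab_sep_def stabilizer_def act_sep_mult)
qed

end

section \<open>The identity component of the stabilizer\<close>

text \<open>The nonvanishing sets form a basis and not merely a subbasis, since the intersection of
  two of them is the nonvanishing set of the product.\<close>

lemma openin_zariski_basis:
  assumes "openin zariski U" "x \<in> U"
  shows "\<exists>f\<in>poly_funs. f x \<noteq> 0 \<and> {g. f g \<noteq> 0} \<subseteq> U"
proof -
  have "generate_topology_on {{g. f g \<noteq> 0} | f. f \<in> poly_funs} U"
    using assms(1) by (simp add: zariski_def openin_topology_generated_by_iff)
  then show ?thesis
    using assms(2)
  proof (induction rule: generate_topology_on.induct)
    case (Int a b)
    obtain f where "f \<in> poly_funs" "f x \<noteq> 0" "{g. f g \<noteq> 0} \<subseteq> a"
      using Int.IH(1)[OF IntD1[OF Int.prems]] by (elim bexE conjE)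
    moreover obtain h where "h \<in> poly_funs" "h x \<noteq> 0" "{g. h g \<noteq> 0} \<subseteq> b"
      using Int.IH(2)[OF IntD2[OF Int.prems]] by (elim bexE conjE)
    ultimately show ?case
      by (intro bexI[of _ "\<lambda>g. f g * h g"]) (auto intro: poly_funs.mult)
  next
    case (UN K)
    from UN.prems obtain u where u: "u \<in> K" "x \<in> u" by (rule UnionE)
    from UN.IH[OF this] obtain f where "f \<in> poly_funs" "f x \<noteq> 0" "{g. f g \<noteq> 0} \<subseteq> u"
      by (elim bexE conjE)
    moreover have "u \<subseteq> \<Union>K" using u(1) by (rule Union_upper)
    ultimately show ?case by (meson subset_trans)
  qed auto
qed

lemma topspace_zariski: "topspace zariski = UNIV"
proof -
  have "UNIV \<in> {{g. f g \<noteq> 0} | f. f \<in> poly_funs}"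
    by (intro CollectI exI[of _ "\<lambda>_. 1"]) (simp add: poly_funs.const)
  then show ?thesis
    unfolding zariski_def topology_generated_by_topspace by (rule Union_upper[THEN top.extremum_uniqueI])
qed

lemma openin_zariski_nonzero: "f \<in> poly_funs \<Longrightarrow> openin zariski {g. f g \<noteq> 0}"
  unfolding zariski_def by (rule topology_generated_by_Basis) blast

text \<open>The entries of the curve \<open>c\<close> are rational functions with common denominator
  \<open>D\<close>, so a polynomial function pulls back to a fraction with a power of
  \<open>D\<close> below.\<close>

lemma poly_funs_along_curve:
  assumes "f \<in> poly_funs"
    and "\<And>i j. \<exists>p. \<forall>t. poly D t \<noteq> 0 \<longrightarrow> fst (fst (c t)) $ i $ j * poly D t = poly p t"
    and "\<And>i j. \<exists>p. \<forall>t. poly D t \<noteq> 0 \<longrightarrow> snd (fst (c t)) $ i $ j * poly D t = poly p t"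
    and "\<And>i j. \<exists>p. \<forall>t. poly D t \<noteq> 0 \<longrightarrow> snd (c t) $ i $ j * poly D t = poly p t"
  shows "\<exists>p n. \<forall>t. poly D t \<noteq> 0 \<longrightarrow> f (c t) * poly D t ^ n = poly p t"
  using assms(1)
proof induction
  case (const a)
  show ?case by (rule exI[of _ "[:a:]"], rule exI[of _ 0]) simp
next
  case (coord1 i j)
  show ?case using assms(2)[of i j] by (subst ex_comm) (rule exI[of _ 1], simp)
next
  case (coord2 i j)
  show ?case using assms(3)[of i j] by (subst ex_comm) (rule exI[of _ 1], simp)
next
  case (coord3 i j)
  show ?case using assms(4)[of i j] by (subst ex_comm) (rule exI[of _ 1], simp)
next
  case (add f h)
  then obtain p n q m where p: "\<And>t. poly D t \<noteq> 0 \<Longrightarrow> f (c t) * poly D t ^ n = poly p t"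
    and q: "\<And>t. poly D t \<noteq> 0 \<Longrightarrow> h (c t) * poly D t ^ m = poly q t" by auto
  have "(f (c t) + h (c t)) * poly D t ^ (n + m) = poly (p * D ^ m + q * D ^ n) t"
    if "poly D t \<noteq> 0" for t
    by (simp add: p[OF that, symmetric] q[OF that, symmetric] power_add algebra_simps)
  then show ?case by blast
next
  case (mult f h)
  then obtain p n q m where p: "\<And>t. poly D t \<noteq> 0 \<Longrightarrow> f (c t) * poly D t ^ n = poly p t"
    and q: "\<And>t. poly D t \<noteq> 0 \<Longrightarrow> h (c t) * poly D t ^ m = poly q t" by auto
  have "f (c t) * h (c t) * poly D t ^ (n + m) = poly (p * q) t" if "poly D t \<noteq> 0" for t
    by (simp add: p[OF that, symmetric] q[OF that, symmetric] power_add)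
  then show ?case by blast
qed

text \<open>Every open set that meets the curve pulls back to a set missing only finitely many
  parameters. In an infinite field two such sets intersect, so the curve cannot be
  separated.\<close>

lemma connectedin_zariski_curve:
  fixes D :: "'a::field poly"
  assumes "infinite (UNIV :: 'a set)" "D \<noteq> 0"
    and "\<And>i j. \<exists>p. \<forall>t. poly D t \<noteq> 0 \<longrightarrow> fst (fst (c t)) $ i $ j * poly D t = poly p t"
    and "\<And>i j. \<exists>p. \<forall>t. poly D t \<noteq> 0 \<longrightarrow> snd (fst (c t)) $ i $ j * poly D t = poly p t"
    and "\<And>i j. \<exists>p. \<forall>t. poly D t \<noteq> 0 \<longrightarrow> snd (c t) $ i $ j * poly D t = poly p t"
  shows "connectedin zariski (c ` {t. poly D t \<noteq> 0})"
proof -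
  let ?S = "c ` {t. poly D t \<noteq> 0}"
  have nonzero: "\<exists>p. p \<noteq> 0 \<and> (\<forall>t. poly D t \<noteq> 0 \<longrightarrow> poly p t \<noteq> 0 \<longrightarrow> c t \<in> U)"
    if U: "openin zariski U" "U \<inter> ?S \<noteq> {}" for U
  proof -
    obtain t where t: "c t \<in> U" "poly D t \<noteq> 0" using U(2) by auto
    then obtain f where f: "f \<in> poly_funs" "f (c t) \<noteq> 0" "{g. f g \<noteq> 0} \<subseteq> U"
      using openin_zariski_basis[OF U(1)] by metis
    obtain p n where p: "\<And>t. poly D t \<noteq> 0 \<Longrightarrow> f (c t) * poly D t ^ n = poly p t"
      using poly_funs_along_curve[OF f(1) assms(3-5)] by auto
    have "p \<noteq> 0" using p[OF t(2)] t(2) f(2) by auto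
    moreover have "\<forall>t. poly D t \<noteq> 0 \<longrightarrow> poly p t \<noteq> 0 \<longrightarrow> c t \<in> U"
      using p f(3) by force
    ultimately show ?thesis by blast
  qed
  have False if U: "openin zariski U" "openin zariski V" "U \<inter> V \<inter> ?S = {}" "U \<inter> ?S \<noteq> {}" "V \<inter> ?S \<noteq> {}"
    for U V
  proof -
    obtain p where p: "p \<noteq> 0" "\<And>t. poly D t \<noteq> 0 \<Longrightarrow> poly p t \<noteq> 0 \<Longrightarrow> c t \<in> U"
      using nonzero[OF U(1,4)] by auto
    obtain q where q: "q \<noteq> 0" "\<And>t. poly D t \<noteq> 0 \<Longrightarrow> poly q t \<noteq> 0 \<Longrightarrow> c t \<in> V"
      using nonzero[OF U(2,5)] by auto
    have "p * q * D \<noteq> 0" using p q assms(2) by simp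
    then have "finite {t. poly (p * q * D) t = 0}" by (rule poly_roots_finite)
    then obtain t where "poly (p * q * D) t \<noteq> 0"
      using assms(1) by (metis (mono_tags, lifting) ex_new_if_finite mem_Collect_eq)
    then have "c t \<in> U \<inter> V \<inter> ?S" using p q by auto
    then show False using U by blast
  qed
  then show ?thesis
    unfolding connectedin topspace_zariski by blast
qed

section \<open>The stabilizer of w\<close>

context split_tensor
begin

text \<open>The image of \<open>w_elem\<close> over the closure, written without reference to a base
  field; \<open>V_to_sep_w_elem\<close> identifies the two.\<close>

abbreviation w_sep :: "'a tmat \<times> 'a tmat" where
  "w_sep \<equiv> ((m2 1 0 0 0, 0), (m2 0 0 0 1, 0))"

lemma tevV_w_sep [simp]: "tevV s w_sep = w_elem"
  by (simp add: tevV_def tev_def w_elem_m2 zero_m2)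

text \<open>Both matrices of \<open>w\<close> are symmetric, so the equation at
  \<open>\<sigma> \<theta>\<close> is the transpose of the equation at \<open>\<theta>\<close> and
  one of them suffices.\<close>

lemma stab_w_sep_iff:
  "g \<in> stab_sep \<sigma> \<theta> w_sep \<longleftrightarrow> g \<in> carrier (G_sep \<sigma> \<theta>) \<and>
     act2 (tev \<theta> (fst g)) (tev (\<sigma> \<theta>) (fst g)) (snd g) w_elem = w_elem"
  (is "_ \<longleftrightarrow> _ \<and> act2 ?P ?Q ?C _ = _")
proof -
  have "act_sep \<sigma> \<theta> g w_sep = w_sep \<longleftrightarrow> act2 ?P ?Q ?C w_elem = w_elem"
  proof
    assume "act_sep \<sigma> \<theta> g w_sep = w_sep"
    from arg_cong[OF this, of "tevV \<theta>"] show "act2 ?P ?Q ?C w_elem = w_elem"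
      by (simp only: tevV_act_sep tevV_w_sep)
  next
    assume *: "act2 ?P ?Q ?C w_elem = w_elem"
    have "act2 ?Q ?P ?C w_elem = w_elem"
      using act2_transpose[of ?Q ?P ?C "m2 1 0 0 0" "m2 0 0 0 1"] * by (simp add: w_elem_m2)
    then show "act_sep \<sigma> \<theta> g w_sep = w_sep"
      using * by (intro tevV_inject[OF \<theta>_moved]) (simp_all only: tevV_act_sep tevV_w_sep)
  qed
  then show ?thesis
    by (auto simp: stab_sep_def stabilizer_def)
qed

text \<open>A stabilizing element preserves v1 v2 up to a nonzero factor, so it sends the zeros (1,
  0) and (0, 1) to zeros: each row of \<open>C\<close> has a vanishing entry.\<close>

lemma stab_w_sep_cases:
  assumes "g \<in> stab_sep \<sigma> \<theta> w_sep"
  shows "(snd g $ 1 $ 2 = 0 \<and> snd g $ 2 $ 1 = 0 \<and> snd g $ 1 $ 1 \<noteq> 0 \<and> snd g $ 2 $ 2 \<noteq> 0) \<or>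
    (snd g $ 1 $ 1 = 0 \<and> snd g $ 2 $ 2 = 0 \<and> snd g $ 1 $ 2 \<noteq> 0 \<and> snd g $ 2 $ 1 \<noteq> 0)"
proof -
  let ?P = "tev \<theta> (fst g)" and ?Q = "tev (\<sigma> \<theta>) (fst g)"
  obtain a b c d where C: "snd g = m2 a b c d" by (rule m2_cases)
  have fix_w: "act2 ?P ?Q (snd g) w_elem = w_elem" and nz: "det ?P \<noteq> 0" "det ?Q \<noteq> 0" "a * d - b * c \<noteq> 0"
    using assms by (auto simp: stab_w_sep_iff carrier_G_sep C)
  have F: "det ?P * det ?Q * F_form w_elem (v v* snd g) = F_form w_elem v" for v
    using F_form_act2[of ?P ?Q "snd g" w_elem v] fix_w by simp
  have Fw: "F_form w_elem v = v $ 1 * v $ 2" for v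
    by (simp add: w_elem_m2 F_form_quadratic)
  have "a * b = 0" "c * d = 0"
    using F[of "axis 1 1"] F[of "axis 2 1"] nz by (auto simp: Fw vector_matrix_mult_2 C)
  then show ?thesis
    using nz(3) by (auto simp: C)
qed

text \<open>A torus with four free parameters: if \<open>C\<close> is diagonal, the two rank-one
  matrices of \<open>w\<close> are each preserved up to a scalar, which forces \<open>P\<close> and
  \<open>Q\<close> to be diagonal and then determines \<open>C\<close>.\<close>

lemma stab_w_sep_diagonal_iff:
  "g \<in> stab_sep \<sigma> \<theta> w_sep \<and> snd g $ 1 $ 2 = 0 \<longleftrightarrow>
    (\<exists>p p' q q'. p \<noteq> 0 \<and> p' \<noteq> 0 \<and> q \<noteq> 0 \<and> q' \<noteq> 0 \<and> tev \<theta> (fst g) = m2 p 0 0 p' \<and>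
      tev (\<sigma> \<theta>) (fst g) = m2 q 0 0 q' \<and> snd g = m2 (1 / (p * q)) 0 0 (1 / (p' * q')))"
  (is "?L \<longleftrightarrow> ?R")
proof
  assume L: ?L
  obtain p u u' p' where P: "tev \<theta> (fst g) = m2 p u u' p'" by (rule m2_cases)
  obtain q v v' q' where Q: "tev (\<sigma> \<theta>) (fst g) = m2 q v v' q'" by (rule m2_cases)
  obtain a b c d where C: "snd g = m2 a b c d" by (rule m2_cases)
  have "b = 0" "c = 0" "a \<noteq> 0" "d \<noteq> 0"
    using L stab_w_sep_cases[of g] by (auto simp: C)
  moreover have "act2 (tev \<theta> (fst g)) (tev (\<sigma> \<theta>) (fst g)) (snd g) w_elem = w_elem"
    using L by (simp add: stab_w_sep_iff)
  ultimately have *: "p * a * q = 1" "u' * a * q = 0" "p * a * v' = 0"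
    "p' * d * q' = 1" "u * d * q' = 0" "p' * d * v = 0"
    by (auto simp: P Q C w_elem_m2)
  then have nz: "p \<noteq> 0" "q \<noteq> 0" "p' \<noteq> 0" "q' \<noteq> 0" by auto
  with *(1,4) have "a = 1 / (p * q)" "d = 1 / (p' * q')"
    by (simp_all add: eq_divide_eq mult_ac)
  with * nz \<open>a \<noteq> 0\<close> \<open>d \<noteq> 0\<close> \<open>b = 0\<close> \<open>c = 0\<close> show ?R
    by (auto simp: P Q C)
next
  assume ?R
  then show ?L
    by (auto simp: stab_w_sep_iff carrier_G_sep w_elem_m2)
qed

text \<open>The first component is joined to 1 by a straight segment, which stays diagonal after
  both evaluations; the component \<open>C\<close> is then prescribed by the torus equations as a
  rational function of the parameter.\<close>

lemma diagonal_curve: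
  fixes g :: "'a tmat \<times> 'a mat2"
  assumes inf: "infinite (UNIV :: 'a set)" and g: "g \<in> stab_sep \<sigma> \<theta> w_sep" "snd g $ 1 $ 2 = 0"
  shows "\<exists>S. connectedin zariski S \<and> S \<subseteq> stab_sep \<sigma> \<theta> w_sep \<and> \<one>\<^bsub>G_sep \<sigma> \<theta>\<^esub> \<in> S \<and> g \<in> S"
proof -
  obtain p p' q q' where nz: "p \<noteq> 0" "p' \<noteq> 0" "q \<noteq> 0" "q' \<noteq> 0"
    and P: "tev \<theta> (fst g) = m2 p 0 0 p'" and Q: "tev (\<sigma> \<theta>) (fst g) = m2 q 0 0 q'"
    and C: "snd g = m2 (1 / (p * q)) 0 0 (1 / (p' * q'))"
    using g stab_w_sep_diagonal_iff[of g] by blast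
  \<comment> \<open>\<open>l x\<close> is the segment from 1 at t = 0 to \<open>x\<close> at t = 1.
    The product \<open>D\<close> below vanishes exactly where one of the four torus parameters
    becomes 0.\<close>
  define l where "l x = [:1, x - 1:]" for x :: 'a
  define D where "D = l p * l p' * l q * l q'"
  define c where "c t = ((mat 1 + smat t (fst (fst g) - mat 1), smat t (snd (fst g))),
    m2 (1 / (poly (l p) t * poly (l q) t)) 0 0 (1 / (poly (l p') t * poly (l q') t)))" for t
  have tev_c: "tev s (fst (c t)) = mat 1 + smat t (tev s (fst g) - mat 1)" for s t
    by (cases "fst g" rule: tmat_cases) (simp add: c_def tev_def mat_1_m2 algebra_simps)
  have stab: "c t \<in> stab_sep \<sigma> \<theta> w_sep" if "poly D t \<noteq> 0" for t
  proof -
    have "tev \<theta> (fst (c t)) = m2 (poly (l p) t) 0 0 (poly (l p') t)"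
      "tev (\<sigma> \<theta>) (fst (c t)) = m2 (poly (l q) t) 0 0 (poly (l q') t)"
      by (simp_all add: tev_c P Q mat_1_m2 l_def algebra_simps)
    then show ?thesis
      using that stab_w_sep_diagonal_iff[of "c t"] by (auto simp: D_def c_def)
  qed
  have l: "poly (l x) 0 = 1" "poly (l x) 1 = x" "l x \<noteq> 0" for x
    by (simp_all add: l_def)
  have "D \<noteq> 0" by (simp add: D_def l)
  have lin: "\<exists>p. \<forall>t. poly D t \<noteq> 0 \<longrightarrow> (a + t * b) * poly D t = poly p t" for a b
    by (rule exI[of _ "[:a, b:] * D"]) (simp add: algebra_simps)
  have "connectedin zariski (c ` {t. poly D t \<noteq> 0})"
  proof (rule connectedin_zariski_curve[OF inf \<open>D \<noteq> 0\<close>])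
    fix i j
    show "\<exists>p. \<forall>t. poly D t \<noteq> 0 \<longrightarrow> fst (fst (c t)) $ i $ j * poly D t = poly p t"
      using lin[of "mat 1 $ i $ j" "fst (fst g) $ i $ j - mat 1 $ i $ j"] by (simp add: c_def smat_def)
    show "\<exists>p. \<forall>t. poly D t \<noteq> 0 \<longrightarrow> snd (fst (c t)) $ i $ j * poly D t = poly p t"
      using lin[of 0 "snd (fst g) $ i $ j"] by (simp add: c_def smat_def)
    have "\<forall>i j. \<exists>p. \<forall>t. poly D t \<noteq> 0 \<longrightarrow> snd (c t) $ i $ j * poly D t = poly p t"
      unfolding forall_2
    proof (intro conjI)
      show "\<exists>r. \<forall>t. poly D t \<noteq> 0 \<longrightarrow> snd (c t) $ 1 $ 1 * poly D t = poly r t"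
        by (rule exI[of _ "l p' * l q'"]) (auto simp: c_def D_def)
      show "\<exists>r. \<forall>t. poly D t \<noteq> 0 \<longrightarrow> snd (c t) $ 2 $ 2 * poly D t = poly r t"
        by (rule exI[of _ "l p * l q"]) (auto simp: c_def D_def)
    qed (auto simp: c_def intro!: exI[of _ 0])
    then show "\<exists>p. \<forall>t. poly D t \<noteq> 0 \<longrightarrow> snd (c t) $ i $ j * poly D t = poly p t" by blast
  qed
  moreover have "c 0 = \<one>\<^bsub>G_sep \<sigma> \<theta>\<^esub>"
    by (cases "fst g" rule: tmat_cases) (simp add: c_def one_G_sep mat_1_m2 zero_m2 l)
  moreover have "c 1 = g"
    by (cases "fst g" rule: tmat_cases) (simp add: c_def C mat_1_m2 l prod_eq_iff)
  moreover have "poly D 0 \<noteq> 0" "poly D 1 \<noteq> 0"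
    using nz by (simp_all add: D_def l)
  ultimately show ?thesis
    using stab by (intro exI[of _ "c ` {t. poly D t \<noteq> 0}"]) (auto intro: rev_image_eqI)
qed

text \<open>Within the stabilizer, the diagonal part is open as the locus where the corner entry of
  \<open>C\<close> is nonzero, and closed because its complement is the locus where the entry at (1,
  2) is nonzero. So it contains the component of 1, and the curves give the converse.\<close>

lemma stab0_w_sep:
  assumes inf: "infinite (UNIV :: 'a set)"
  shows "stab0_sep \<sigma> \<theta> w_sep = {g \<in> stab_sep \<sigma> \<theta> w_sep. snd g $ 1 $ 2 = 0}"
proof (intro subset_antisym subsetI)
  let ?S = "stab_sep \<sigma> \<theta> w_sep"
  let ?X = "subtopology zariski ?S"
  fix g assume "g \<in> stab0_sep \<sigma> \<theta> w_sep"
  then obtain T where T: "connectedin ?X T" "\<one>\<^bsub>G_sep \<sigma> \<theta>\<^esub> \<in> T" "g \<in> T"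
    by (auto simp: stab0_sep_def connected_component_of_def)
  define H where "H = {g \<in> ?S. snd g $ 1 $ 2 = 0}"
  have "openin ?X (?S \<inter> {g. snd g $ 1 $ 1 \<noteq> 0})" "openin ?X (?S \<inter> {g. snd g $ 1 $ 2 \<noteq> 0})"
    by (auto intro!: openin_subtopology_Int2 openin_zariski_nonzero poly_funs.coord3)
  moreover have "?S \<inter> {g. snd g $ 1 $ 1 \<noteq> 0} = H"
    using stab_w_sep_cases unfolding H_def by blast
  moreover have "?S \<inter> {g. snd g $ 1 $ 2 \<noteq> 0} = ?S - H"
    by (auto simp: H_def)
  ultimately have "openin ?X H" "closedin ?X H"
    by (auto simp: closedin_def topspace_zariski H_def)
  moreover have "\<one>\<^bsub>G_sep \<sigma> \<theta>\<^esub> \<in> H"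
    using subgroup.one_closed[OF stab_sep_subgroup] by (auto simp: H_def one_G_sep mat_1_m2)
  ultimately have "T \<subseteq> H"
    using connectedin_clopen_cases[OF T(1), of H] T(2) unfolding disjnt_def by blast
  then show "g \<in> {g \<in> ?S. snd g $ 1 $ 2 = 0}"
    using T(3) by (auto simp: H_def)
next
  fix g assume "g \<in> {g \<in> stab_sep \<sigma> \<theta> w_sep. snd g $ 1 $ 2 = 0}"
  then show "g \<in> stab0_sep \<sigma> \<theta> w_sep"
    using diagonal_curve[OF inf, of g]
    by (auto simp: stab0_sep_def connected_component_of_def connectedin_subtopology)
qed

lemma stab0_w_sep_subgroup:
  assumes inf: "infinite (UNIV :: 'a set)"
  shows "subgroup (stab0_sep \<sigma> \<theta> w_sep) (G_sep \<sigma> \<theta>)"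
proof -
  interpret group "G_sep \<sigma> \<theta>" by (rule G_sep_group)
  interpret stab: subgroup "stab_sep \<sigma> \<theta> w_sep" "G_sep \<sigma> \<theta>" by (rule stab_sep_subgroup)
  show ?thesis
    unfolding stab0_w_sep[OF inf]
  proof (rule subgroupI)
    show "{g \<in> stab_sep \<sigma> \<theta> w_sep. snd g $ 1 $ 2 = 0} \<noteq> {}"
    proof -
      have "snd \<one>\<^bsub>G_sep \<sigma> \<theta>\<^esub> $ 1 $ 2 = 0" by (simp add: one_G_sep mat_1_m2)
      then show ?thesis using stab.one_closed by blast
    qed
  next
    fix g assume g: "g \<in> {g \<in> stab_sep \<sigma> \<theta> w_sep. snd g $ 1 $ 2 = 0}"
    then have "g \<otimes>\<^bsub>G_sep \<sigma> \<theta>\<^esub> inv\<^bsub>G_sep \<sigma> \<theta>\<^esub> g = \<one>\<^bsub>G_sep \<sigma> \<theta>\<^esub>" by auto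
    then have "snd g ** snd (inv\<^bsub>G_sep \<sigma> \<theta>\<^esub> g) = mat 1"
      by (simp add: mult_G_sep one_G_sep)
    then have "snd g $ 1 $ 1 * snd (inv\<^bsub>G_sep \<sigma> \<theta>\<^esub> g) $ 1 $ 2 = 0"
      using g by (cases "snd g" rule: m2_cases; cases "snd (inv\<^bsub>G_sep \<sigma> \<theta>\<^esub> g)" rule: m2_cases)
        (auto simp: mat_1_m2)
    then show "inv\<^bsub>G_sep \<sigma> \<theta>\<^esub> g \<in> {g \<in> stab_sep \<sigma> \<theta> w_sep. snd g $ 1 $ 2 = 0}"
      using g stab_w_sep_cases[of g] by auto
  next
    fix g h assume gh: "g \<in> {g \<in> stab_sep \<sigma> \<theta> w_sep. snd g $ 1 $ 2 = 0}"
      "h \<in> {g \<in> stab_sep \<sigma> \<theta> w_sep. snd g $ 1 $ 2 = 0}"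
    then have "(snd g ** snd h) $ 1 $ 2 = 0"
      by (cases "snd g" rule: m2_cases; cases "snd h" rule: m2_cases) auto
    then show "g \<otimes>\<^bsub>G_sep \<sigma> \<theta>\<^esub> h \<in> {g \<in> stab_sep \<sigma> \<theta> w_sep. snd g $ 1 $ 2 = 0}"
      using gh by (auto simp: mult_G_sep[symmetric]) (simp add: mult_G_sep)
  qed auto
qed

end

section \<open>The quadratic extension and its involution\<close>

locale hermitian_pairs =
  fixes k k\<^sub>1 :: "'a::field set" and \<sigma> :: "'a \<Rightarrow> 'a" and \<theta> :: 'a
  assumes k: "is_subfield k" and k_infinite: "infinite k"
    and k_sep: "UNIV_is_separable_closure k"
    and k1_quad: "separable_quadratic_ext k k\<^sub>1"
    and \<sigma>_Gal: "\<sigma> \<in> Gal k k\<^sub>1" and \<sigma>_nontriv: "\<exists>a\<in>k\<^sub>1. \<sigma> a \<noteq> a"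
    and \<theta>: "\<theta> \<in> k\<^sub>1 - k"
begin

lemma k1: "is_subfield k\<^sub>1" and k_sub_k1: "k \<subseteq> k\<^sub>1"
  using k1_quad by (auto simp: separable_quadratic_ext_def separable_ext_def)

lemmas k_closed = is_subfieldD[OF k]
lemmas k1_closed = is_subfieldD[OF k1]

lemma k_in_k1: "x \<in> k \<Longrightarrow> x \<in> k\<^sub>1"
  using k_sub_k1 by blast

lemma \<sigma>_k: "x \<in> k \<Longrightarrow> \<sigma> x = x"
  using \<sigma>_Gal by (simp add: ext_isos_def)

lemma \<sigma>_k1: "x \<in> k\<^sub>1 \<Longrightarrow> \<sigma> x \<in> k\<^sub>1"
  using \<sigma>_Gal by (auto simp: ext_isos_def dest: bij_betwE)

lemma \<sigma>_add: "x \<in> k\<^sub>1 \<Longrightarrow> y \<in> k\<^sub>1 \<Longrightarrow> \<sigma> (x + y) = \<sigma> x + \<sigma> y"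
  and \<sigma>_mult: "x \<in> k\<^sub>1 \<Longrightarrow> y \<in> k\<^sub>1 \<Longrightarrow> \<sigma> (x * y) = \<sigma> x * \<sigma> y"
  using \<sigma>_Gal by (auto simp: ext_isos_def)

lemma \<sigma>_0 [simp]: "\<sigma> 0 = 0" and \<sigma>_1 [simp]: "\<sigma> 1 = 1"
  using \<sigma>_k k_closed by auto

lemma \<sigma>_minus: "x \<in> k\<^sub>1 \<Longrightarrow> \<sigma> (- x) = - \<sigma> x"
  using \<sigma>_add[of x "- x"] k1_closed by (simp add: eq_neg_iff_add_eq_0 add.commute)

lemma \<sigma>_diff: "x \<in> k\<^sub>1 \<Longrightarrow> y \<in> k\<^sub>1 \<Longrightarrow> \<sigma> (x - y) = \<sigma> x - \<sigma> y"
  using \<sigma>_add[of x "- y"] \<sigma>_minus[of y] k1_closed by simp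

lemma \<sigma>_eq_0_iff: "x \<in> k\<^sub>1 \<Longrightarrow> \<sigma> x = 0 \<longleftrightarrow> x = 0"
  using \<sigma>_mult[of x "inverse x"] k1_closed by (cases "x = 0") auto

text \<open>Cramer's rule for the coordinates of 1 and \<open>\<theta>\<close> in the given basis.
  If their determinant \<open>D\<close> were 0, then \<open>b * \<theta> = d\<close> and
  \<open>a * \<theta> = c\<close> would force a = b = 0, hence 1 = 0.\<close>

lemma k1_basis:
  assumes "x \<in> k\<^sub>1"
  obtains p q where "p \<in> k" "q \<in> k" "x = p + \<theta> * q"
proof -
  obtain e1 e2 where e: "e1 \<in> k\<^sub>1" "e2 \<in> k\<^sub>1"
    and span: "\<And>x. x \<in> k\<^sub>1 \<Longrightarrow> \<exists>!c. c \<in> k \<times> k \<and> x = fst c * e1 + snd c * e2"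
    using k1_quad unfolding separable_quadratic_ext_def by (elim conjE bexE) simp
  have span': "\<exists>a\<in>k. \<exists>b\<in>k. x = a * e1 + b * e2" if "x \<in> k\<^sub>1" for x
    using ex1_implies_ex[OF span[OF that]] by auto
  obtain a b where 1: "a \<in> k" "b \<in> k" "1 = a * e1 + b * e2"
    using span' k1_closed(2) by blast
  obtain c d where t: "c \<in> k" "d \<in> k" "\<theta> = c * e1 + d * e2"
    using span' \<theta> by blast
  define D where "D = a * d - b * c"
  have e1: "D * e1 = d - b * \<theta>" and e2: "D * e2 = a * \<theta> - c"
  proof -
    have "d * 1 - b * \<theta> = D * e1" "a * \<theta> - c * 1 = D * e2"
      unfolding 1(3) t(3) D_def by (simp_all add: algebra_simps)
    then show "D * e1 = d - b * \<theta>" "D * e2 = a * \<theta> - c" by simp_all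
  qed
  have notin: "u = 0" if "u \<in> k" "u * \<theta> \<in> k" for u
  proof (rule ccontr)
    assume "u \<noteq> 0"
    then have "\<theta> = u * \<theta> / u" by simp
    also have "\<dots> \<in> k" by (rule k_closed(8)[OF that(2,1)])
    finally show False using \<theta> by blast
  qed
  have "D \<noteq> 0"
  proof
    assume "D = 0"
    then have "b * \<theta> = d" "a * \<theta> = c" using e1 e2 by simp_all
    then have "a = 0" "b = 0" using notin[of a] notin[of b] 1 t by auto
    then show False using 1(3) by simp
  qed
  obtain u v where x: "u \<in> k" "v \<in> k" "x = u * e1 + v * e2"
    using span' assms by blast
  have "D * x = (u * d - v * c) + \<theta> * (v * a - u * b)"
  proof -
    have "D * x = u * (D * e1) + v * (D * e2)" by (simp add: x(3) algebra_simps)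
    then show ?thesis unfolding e1 e2 by (simp add: algebra_simps)
  qed
  then have "D * x / D = (u * d - v * c) / D + \<theta> * ((v * a - u * b) / D)"
    by (simp add: add_divide_distrib)
  then have "x = (u * d - v * c) / D + \<theta> * ((v * a - u * b) / D)"
    using \<open>D \<noteq> 0\<close> by simp
  moreover have "(u * d - v * c) / D \<in> k" "(v * a - u * b) / D \<in> k"
    unfolding D_def by (intro k_closed x 1 t)+
  ultimately show thesis by (intro that)
qed

lemma k1_basis_unique:
  assumes "p \<in> k" "q \<in> k" "p' \<in> k" "q' \<in> k" "p + \<theta> * q = p' + \<theta> * q'"
  shows "p = p' \<and> q = q'"
proof (rule ccontr)
  assume "\<not> ?thesis"
  then have "q \<noteq> q'" using assms(5) by auto
  have "\<theta> * (q - q') = p' - p" using assms(5) by (simp add: algebra_simps)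
  then have "\<theta> = (p' - p) / (q - q')" using \<open>q \<noteq> q'\<close> by (simp add: field_simps)
  also have "\<dots> \<in> k" by (intro k_closed assms)
  finally show False using \<theta> by blast
qed

lemma \<sigma>_basis: "p \<in> k \<Longrightarrow> q \<in> k \<Longrightarrow> \<sigma> (p + \<theta> * q) = p + \<sigma> \<theta> * q"
  using \<theta> k_in_k1 k1_closed by (simp add: \<sigma>_add \<sigma>_mult \<sigma>_k)

lemma \<sigma>\<theta>_neq: "\<theta> \<noteq> \<sigma> \<theta>"
proof
  assume *: "\<theta> = \<sigma> \<theta>"
  obtain a where a: "a \<in> k\<^sub>1" "\<sigma> a \<noteq> a" using \<sigma>_nontriv by blast
  from a(1) obtain p q where "p \<in> k" "q \<in> k" "a = p + \<theta> * q" by (rule k1_basis)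
  then have "\<sigma> a = a" using \<sigma>_basis * by simp
  then show False using a(2) by blast
qed

sublocale split_tensor \<sigma> \<theta>
  by unfold_locales (rule \<sigma>\<theta>_neq)

text \<open>Applying \<open>\<sigma>\<close> to the quadratic equation of \<open>\<theta>\<close>
  over \<open>k\<close> and subtracting leaves a multiple of
  \<open>\<theta> - \<sigma> \<theta>\<close>, which can be cancelled. That \<open>\<sigma>\<close>
  is an involution is deduced from this afterwards.\<close>

lemma trace_\<theta>: "\<theta> + \<sigma> \<theta> \<in> k" and norm_\<theta>: "\<theta> * \<sigma> \<theta> \<in> k"
proof -
  have "\<theta> * \<theta> \<in> k\<^sub>1" using \<theta> k1_closed(4) by simp
  then obtain n t where nt: "n \<in> k" "t \<in> k" "\<theta> * \<theta> = n + \<theta> * t" by (rule k1_basis)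
  have "\<sigma> \<theta> * \<sigma> \<theta> = n + \<sigma> \<theta> * t"
    using arg_cong[OF nt(3), of \<sigma>] \<theta> \<sigma>_basis[OF nt(1,2)] by (simp add: \<sigma>_mult)
  then have "\<theta> * \<theta> - \<sigma> \<theta> * \<sigma> \<theta> = (\<theta> - \<sigma> \<theta>) * t"
    using nt(3) by (simp add: algebra_simps)
  then have "(\<theta> - \<sigma> \<theta>) * (\<theta> + \<sigma> \<theta>) = (\<theta> - \<sigma> \<theta>) * t"
    by (simp add: algebra_simps)
  then have t: "\<theta> + \<sigma> \<theta> = t" using \<sigma>\<theta>_neq by simp
  have "\<theta> * \<sigma> \<theta> = \<theta> * (\<theta> + \<sigma> \<theta>) - \<theta> * \<theta>" by (simp add: algebra_simps)
  then have "\<theta> * \<sigma> \<theta> = \<theta> * t - \<theta> * \<theta>" by (simp only: t)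
  then have "\<theta> * \<sigma> \<theta> = - n" using nt(3) by simp
  then show "\<theta> + \<sigma> \<theta> \<in> k" "\<theta> * \<sigma> \<theta> \<in> k" using t nt k_closed(6) by simp_all
qed

lemma \<sigma>_\<sigma>: "x \<in> k\<^sub>1 \<Longrightarrow> \<sigma> (\<sigma> x) = x"
proof -
  assume "x \<in> k\<^sub>1"
  then obtain p q where pq: "p \<in> k" "q \<in> k" "x = p + \<theta> * q" by (rule k1_basis)
  have "\<sigma> (\<theta> + \<sigma> \<theta>) = \<theta> + \<sigma> \<theta>" by (rule \<sigma>_k[OF trace_\<theta>])
  then have "\<sigma> (\<sigma> \<theta>) = \<theta>" using \<theta> \<sigma>_k1 by (simp add: \<sigma>_add)
  then have "\<sigma> (p + \<sigma> \<theta> * q) = p + \<theta> * q"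
    using pq(1,2) \<theta> \<sigma>_k1 k_in_k1 k1_closed by (simp add: \<sigma>_add \<sigma>_mult \<sigma>_k)
  then show ?thesis
    by (simp add: pq \<sigma>_basis)
qed

lemma \<sigma>_fixed: "x \<in> k\<^sub>1 \<Longrightarrow> \<sigma> x = x \<Longrightarrow> x \<in> k"
proof -
  assume x: "x \<in> k\<^sub>1" "\<sigma> x = x"
  from x(1) obtain p q where pq: "p \<in> k" "q \<in> k" "x = p + \<theta> * q" by (rule k1_basis)
  then have "\<sigma> \<theta> * q = \<theta> * q" using x(2) by (simp add: \<sigma>_basis)
  then have "q = 0" using \<sigma>\<theta>_neq by simp
  then show ?thesis using pq by simp
qed

lemma coords_eq: "p \<in> k \<Longrightarrow> q \<in> k \<Longrightarrow> coords k \<theta> (p + \<theta> * q) = (p, q)"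
proof -
  assume pq: "p \<in> k" "q \<in> k"
  have "c = (p, q)" if "c \<in> k \<times> k \<and> p + \<theta> * q = fst c + \<theta> * snd c" for c
    using that k1_basis_unique[OF pq, of "fst c" "snd c"] by (simp add: mem_Times_iff prod_eq_iff)
  then show ?thesis
    unfolding coords_def using pq by (intro the_equality) simp_all
qed

lemma coords:
  assumes "x \<in> k\<^sub>1"
  shows "fst (coords k \<theta> x) + \<theta> * snd (coords k \<theta> x) = x"
    and "fst (coords k \<theta> x) + \<sigma> \<theta> * snd (coords k \<theta> x) = \<sigma> x"
    and "fst (coords k \<theta> x) \<in> k" "snd (coords k \<theta> x) \<in> k"
proof -
  obtain p q where "p \<in> k" "q \<in> k" "x = p + \<theta> * q" using assms by (rule k1_basis)
  then show "fst (coords k \<theta> x) + \<theta> * snd (coords k \<theta> x) = x"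
    "fst (coords k \<theta> x) + \<sigma> \<theta> * snd (coords k \<theta> x) = \<sigma> x"
    "fst (coords k \<theta> x) \<in> k" "snd (coords k \<theta> x) \<in> k"
    by (simp_all add: coords_eq \<sigma>_basis)
qed

lemma coords_0_1: "coords k \<theta> 0 = (0, 0)" "coords k \<theta> 1 = (1, 0)"
  using coords_eq[of 0 0] coords_eq[of 1 0] k_closed by auto

lemma tev_mat_to_sep:
  assumes "A \<in> mats_over k\<^sub>1"
  shows "tev \<theta> (mat_to_sep k \<theta> A) = A" "tev (\<sigma> \<theta>) (mat_to_sep k \<theta> A) = map_matrix \<sigma> A"
proof -
  obtain a b c d where A: "A = m2 a b c d" by (rule m2_cases)
  show "tev \<theta> (mat_to_sep k \<theta> A) = A" "tev (\<sigma> \<theta>) (mat_to_sep k \<theta> A) = map_matrix \<sigma> A"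
    using assms unfolding A tev_def mat_to_sep_def
    by (simp_all add: coords(1,2))
qed

lemma V_to_sep_w_elem: "V_to_sep k \<theta> w_elem = w_sep"
  by (simp add: V_to_sep_def mat_to_sep_def w_elem_m2 coords_0_1 zero_m2)

section \<open>Hermitian forms and the action over the base field\<close>

lemma herm_forms_iff:
  "m2 a b c d \<in> herm_forms k\<^sub>1 \<sigma> \<longleftrightarrow> a \<in> k \<and> b \<in> k\<^sub>1 \<and> c = \<sigma> b \<and> d \<in> k"
  by (auto simp: herm_forms_def \<sigma>_k k_in_k1 \<sigma>_\<sigma> \<sigma>_k1 intro: \<sigma>_fixed)

lemma V_k_iff:
  "(A, B) \<in> V_k k\<^sub>1 \<sigma> \<longleftrightarrow> A \<in> herm_forms k\<^sub>1 \<sigma> \<and> B \<in> herm_forms k\<^sub>1 \<sigma>"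
  by (simp add: V_k_def)

lemma V_k_cases:
  assumes "x \<in> V_k k\<^sub>1 \<sigma>"
  obtains a b c a' b' c' where "x = (m2 a b (\<sigma> b) c, m2 a' b' (\<sigma> b') c')"
    "a \<in> k" "b \<in> k\<^sub>1" "c \<in> k" "a' \<in> k" "b' \<in> k\<^sub>1" "c' \<in> k"
proof -
  obtain a b bb c where A: "fst x = m2 a b bb c" by (rule m2_cases)
  obtain a' b' bb' c' where B: "snd x = m2 a' b' bb' c'" by (rule m2_cases)
  have x: "x = (m2 a b bb c, m2 a' b' bb' c')" using A B by (simp add: prod_eq_iff)
  show thesis
    by (rule that[of a b c a' b' c']) (use assms in \<open>auto simp: x V_k_iff herm_forms_iff\<close>)
qed

lemma tevV_V_to_sep:
  assumes "x \<in> V_k k\<^sub>1 \<sigma>"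
  shows "tevV \<theta> (V_to_sep k \<theta> x) = x"
    and "tevV (\<sigma> \<theta>) (V_to_sep k \<theta> x) = (transpose (fst x), transpose (snd x))"
proof -
  have A: "fst x \<in> mats_over k\<^sub>1" "snd x \<in> mats_over k\<^sub>1"
    using assms by (auto simp: V_k_def herm_forms_def)
  show "tevV \<theta> (V_to_sep k \<theta> x) = x"
    using A by (simp add: tevV_def V_to_sep_def tev_mat_to_sep)
  show "tevV (\<sigma> \<theta>) (V_to_sep k \<theta> x) = (transpose (fst x), transpose (snd x))"
  proof -
    have "transpose (map_matrix \<sigma> (fst x)) = fst x" "transpose (map_matrix \<sigma> (snd x)) = snd x"
      using assms by (auto simp: V_k_def herm_forms_def)
    then have "map_matrix \<sigma> (fst x) = transpose (fst x)" "map_matrix \<sigma> (snd x) = transpose (snd x)"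
      by (metis transpose_transpose)+
    then show ?thesis
      using A by (simp add: tevV_def V_to_sep_def tev_mat_to_sep)
  qed
qed

text \<open>For a Hermitian pair the evaluation at \<open>\<sigma> \<theta>\<close> is the transpose
  of the evaluation at \<open>\<theta>\<close>, so trivializing \<open>x\<close> over the tensor
  product is a single equation between pairs of matrices.\<close>

lemma V_to_sep_eq_act_sep_iff:
  assumes "x \<in> V_k k\<^sub>1 \<sigma>"
  shows "V_to_sep k \<theta> x = act_sep \<sigma> \<theta> g w_sep \<longleftrightarrow>
    x = act2 (tev \<theta> (fst g)) (tev (\<sigma> \<theta>) (fst g)) (snd g) w_elem"
    (is "_ \<longleftrightarrow> x = act2 ?P ?Q ?C _")
proof
  assume "V_to_sep k \<theta> x = act_sep \<sigma> \<theta> g w_sep"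
  from arg_cong[OF this, of "tevV \<theta>"] show "x = act2 ?P ?Q ?C w_elem"
    by (simp only: tevV_act_sep tevV_w_sep tevV_V_to_sep[OF assms])
next
  assume *: "x = act2 ?P ?Q ?C w_elem"
  have **: "(transpose (fst x), transpose (snd x)) = act2 ?Q ?P ?C w_elem"
    using act2_transpose[of ?Q ?P ?C "m2 1 0 0 0" "m2 0 0 0 1"] * by (simp add: w_elem_m2)
  show "V_to_sep k \<theta> x = act_sep \<sigma> \<theta> g w_sep"
  proof (rule tevV_inject[OF \<theta>_moved])
    show "tevV \<theta> (V_to_sep k \<theta> x) = tevV \<theta> (act_sep \<sigma> \<theta> g w_sep)"
      unfolding tevV_act_sep tevV_w_sep tevV_V_to_sep[OF assms] by (rule *)
    show "tevV (\<sigma> \<theta>) (V_to_sep k \<theta> x) = tevV (\<sigma> \<theta>) (act_sep \<sigma> \<theta> g w_sep)"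
      unfolding tevV_act_sep tevV_w_sep tevV_V_to_sep[OF assms] by (rule **)
  qed
qed

lemma map_matrix_\<sigma>_mult:
  "A \<in> mats_over k\<^sub>1 \<Longrightarrow> B \<in> mats_over k\<^sub>1 \<Longrightarrow> map_matrix \<sigma> (A ** B) = map_matrix \<sigma> A ** map_matrix \<sigma> B"
  by (cases A rule: m2_cases; cases B rule: m2_cases) (simp add: \<sigma>_add \<sigma>_mult k1_closed)

lemma det_map_matrix_\<sigma>: "A \<in> mats_over k\<^sub>1 \<Longrightarrow> det (map_matrix \<sigma> A) = \<sigma> (det A)"
  by (cases A rule: m2_cases) (simp add: \<sigma>_diff \<sigma>_mult k1_closed)

lemma det_in_k1: "A \<in> mats_over k\<^sub>1 \<Longrightarrow> det A \<in> k\<^sub>1"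
  by (cases A rule: m2_cases) (simp add: k1_closed)

lemma carrier_G_k:
  "g \<in> carrier (G_k k k\<^sub>1) \<longleftrightarrow> fst g \<in> mats_over k\<^sub>1 \<and> det (fst g) \<noteq> 0 \<and>
    snd g \<in> mats_over k \<and> det (snd g) \<noteq> 0"
  by (cases g) (auto simp: G_k_def GL2_def)

lemma G_k_group: "group (G_k k k\<^sub>1)"
  unfolding G_k_def by (intro DirProd_group GL2_group k k1)

lemma act_k_mult:
  assumes "g \<in> carrier (G_k k k\<^sub>1)" "h \<in> carrier (G_k k k\<^sub>1)"
  shows "act_k \<sigma> (g \<otimes>\<^bsub>G_k k k\<^sub>1\<^esub> h) x = act_k \<sigma> g (act_k \<sigma> h x)"
proof -
  have "g \<otimes>\<^bsub>G_k k k\<^sub>1\<^esub> h = (fst g ** fst h, snd g ** snd h)"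
    by (simp add: G_k_def mult_DirProd' GL2_def)
  then show ?thesis
    using assms by (simp add: act_k_eq_act2 carrier_G_k map_matrix_\<sigma>_mult act2_mult)
qed

lemma act_k_one: "act_k \<sigma> \<one>\<^bsub>G_k k k\<^sub>1\<^esub> x = x"
proof -
  have "map_matrix \<sigma> (mat 1) = (mat 1 :: 'a mat2)" by (simp add: mat_1_m2)
  then show ?thesis by (simp add: act_k_eq_act2 G_k_def GL2_def)
qed

section \<open>Orbits over the base field\<close>

definition equiv_k :: "'a mat2 \<times> 'a mat2 \<Rightarrow> 'a mat2 \<times> 'a mat2 \<Rightarrow> bool" (infix \<open>\<sim>\<close> 50) where
  "x \<sim> y \<longleftrightarrow> (\<exists>g\<in>carrier (G_k k k\<^sub>1). y = act_k \<sigma> g x)"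

lemma equiv_k_refl: "x \<sim> x"
  unfolding equiv_k_def
  by (rule bexI[of _ "\<one>\<^bsub>G_k k k\<^sub>1\<^esub>"])
    (simp_all only: act_k_one monoid.one_closed[OF group.is_monoid[OF G_k_group]])

lemma equiv_k_sym:
  assumes "x \<sim> y"
  shows "y \<sim> x"
proof -
  interpret group "G_k k k\<^sub>1" by (rule G_k_group)
  obtain g where g: "g \<in> carrier (G_k k k\<^sub>1)" "y = act_k \<sigma> g x"
    using assms by (auto simp: equiv_k_def)
  then have "act_k \<sigma> (inv\<^bsub>G_k k k\<^sub>1\<^esub> g) y = x"
    using act_k_mult[of "inv\<^bsub>G_k k k\<^sub>1\<^esub> g" g x] by (simp add: act_k_one)
  then show ?thesis
    unfolding equiv_k_def using g(1) by (intro bexI[of _ "inv\<^bsub>G_k k k\<^sub>1\<^esub> g"]) auto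
qed

lemma equiv_k_trans:
  assumes "x \<sim> y" "y \<sim> z"
  shows "x \<sim> z"
proof -
  interpret group "G_k k k\<^sub>1" by (rule G_k_group)
  obtain g h where "g \<in> carrier (G_k k k\<^sub>1)" "y = act_k \<sigma> g x"
    "h \<in> carrier (G_k k k\<^sub>1)" "z = act_k \<sigma> h y"
    using assms by (auto simp: equiv_k_def)
  then show ?thesis
    unfolding equiv_k_def by (intro bexI[of _ "h \<otimes>\<^bsub>G_k k k\<^sub>1\<^esub> g"]) (simp_all add: act_k_mult)
qed

lemma orbit_eq: "orbit (G_k k k\<^sub>1) (act_k \<sigma>) x = {y. x \<sim> y}"
  by (auto simp: orbit_def equiv_k_def)

lemma orbit_eq_iff:
  "orbit (G_k k k\<^sub>1) (act_k \<sigma>) x = orbit (G_k k k\<^sub>1) (act_k \<sigma>) y \<longleftrightarrow> x \<sim> y"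
  unfolding orbit_eq using equiv_k_refl equiv_k_sym equiv_k_trans by blast

lemma equiv_kI:
  assumes "P \<in> mats_over k\<^sub>1" "det P \<noteq> 0" "C \<in> mats_over k" "det C \<noteq> 0"
    and "act2 P (map_matrix \<sigma> P) C x = y"
  shows "x \<sim> y"
  unfolding equiv_k_def using assms
  by (intro bexI[of _ "(P, C)"]) (auto simp: act_k_eq_act2 carrier_G_k)

lemma equiv_kE:
  assumes "x \<sim> y"
  obtains P C where "P \<in> mats_over k\<^sub>1" "det P \<noteq> 0" "det (map_matrix \<sigma> P) \<noteq> 0"
    "C \<in> mats_over k" "det C \<noteq> 0" "y = act2 P (map_matrix \<sigma> P) C x"
proof -
  obtain g where "g \<in> carrier (G_k k k\<^sub>1)" "y = act_k \<sigma> g x"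
    using assms by (auto simp: equiv_k_def)
  then show thesis
    by (intro that[of "fst g" "snd g"])
      (simp_all add: carrier_G_k act_k_eq_act2 det_map_matrix_\<sigma> \<sigma>_eq_0_iff det_in_k1)
qed

lemma herm_forms_congruence:
  assumes "P \<in> mats_over k\<^sub>1" "A \<in> herm_forms k\<^sub>1 \<sigma>"
  shows "P ** A ** transpose (map_matrix \<sigma> P) \<in> herm_forms k\<^sub>1 \<sigma>"
proof -
  obtain p q r s where P: "P = m2 p q r s" by (rule m2_cases)
  obtain a b c d where A: "A = m2 a b c d" by (rule m2_cases)
  have mem: "p \<in> k\<^sub>1" "q \<in> k\<^sub>1" "r \<in> k\<^sub>1" "s \<in> k\<^sub>1" "a \<in> k\<^sub>1" "b \<in> k\<^sub>1" "d \<in> k\<^sub>1"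
    and c: "c = \<sigma> b" and fix_ad: "\<sigma> a = a" "\<sigma> d = d"
    using assms \<sigma>_k k_in_k1 by (auto simp: P A herm_forms_iff)
  show ?thesis
    unfolding herm_forms_def P A c using mem fix_ad
    by (simp add: \<sigma>_add \<sigma>_mult \<sigma>_\<sigma> \<sigma>_k1 k1_closed, simp add: algebra_simps)
qed

lemma herm_forms_combination:
  assumes "A \<in> herm_forms k\<^sub>1 \<sigma>" "B \<in> herm_forms k\<^sub>1 \<sigma>" "a \<in> k" "b \<in> k"
  shows "smat a A + smat b B \<in> herm_forms k\<^sub>1 \<sigma>"
  using assms by (cases A rule: m2_cases; cases B rule: m2_cases)
    (auto simp: herm_forms_iff \<sigma>_add \<sigma>_mult \<sigma>_k k_in_k1 k_closed k1_closed)

lemma V_k_ss_equiv: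
  assumes "x \<in> V_k_ss k\<^sub>1 \<sigma>" "x \<sim> y"
  shows "y \<in> V_k_ss k\<^sub>1 \<sigma>"
proof -
  obtain P C where PC: "P \<in> mats_over k\<^sub>1" "det P \<noteq> 0" "det (map_matrix \<sigma> P) \<noteq> 0"
    "C \<in> mats_over k" "det C \<noteq> 0" and y: "y = act2 P (map_matrix \<sigma> P) C x"
    using assms(2) by (rule equiv_kE)
  obtain a b c d where C: "C = m2 a b c d" by (rule m2_cases)
  have "bqf_disc (F_form y) \<noteq> 0"
    using assms(1) PC by (simp add: y bqf_disc_F_form_act2 V_k_ss_def)
  moreover have "y \<in> V_k k\<^sub>1 \<sigma>"
    using assms(1) PC unfolding y C
    by (cases x) (auto simp: V_k_ss_def V_k_iff intro!: herm_forms_congruence herm_forms_combination)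
  ultimately show ?thesis by (simp add: V_k_ss_def)
qed

section \<open>The kernel of the cocycle\<close>

text \<open>The equation says that \<open>\<eta>\<close> fixes the point [v1 : v2] of the projective
  line, without normalizing a coordinate.\<close>

definition fixing_zeros :: "('a ^ 2 \<Rightarrow> 'a) \<Rightarrow> ('a \<Rightarrow> 'a) set" where
  "fixing_zeros F = {\<eta> \<in> Gal k UNIV. \<forall>v. F v = 0 \<longrightarrow> v $ 1 * \<eta> (v $ 2) = v $ 2 * \<eta> (v $ 1)}"

lemma Gal_UNIV_hom:
  assumes "\<eta> \<in> Gal k UNIV"
  shows "\<eta> (x + y) = \<eta> x + \<eta> y" "\<eta> (x * y) = \<eta> x * \<eta> y" "x \<in> k \<Longrightarrow> \<eta> x = x"
    "\<eta> 0 = 0" "\<eta> 1 = 1" "\<eta> (- x) = - \<eta> x" "\<eta> (x - y) = \<eta> x - \<eta> y"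
proof -
  show 1: "\<eta> (x + y) = \<eta> x + \<eta> y" "\<eta> (x * y) = \<eta> x * \<eta> y" "x \<in> k \<Longrightarrow> \<eta> x = x" for x y
    using assms by (auto simp: ext_isos_def)
  show 2: "\<eta> 0 = 0" "\<eta> 1 = 1" using 1 k_closed by auto
  show 3: "\<eta> (- x) = - \<eta> x" for x
    using 1(1)[of x "- x"] 2 by (simp add: eq_neg_iff_add_eq_0 add.commute)
  show "\<eta> (x - y) = \<eta> x - \<eta> y"
    using 1(1)[of x "- y"] 3 by simp
qed

text \<open>The substitution \<open>C\<close> has entries in \<open>k\<close>, so it commutes with
  \<open>\<eta>\<close>, and the expression that tests whether a point is fixed is multiplied by
  \<open>det C\<close>.\<close>

lemma fixing_zeros_equiv:
  assumes "x \<sim> y"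
  shows "fixing_zeros (F_form y) = fixing_zeros (F_form x)"
proof -
  obtain P C where PC: "P \<in> mats_over k\<^sub>1" "det P \<noteq> 0" "det (map_matrix \<sigma> P) \<noteq> 0"
    "C \<in> mats_over k" "det C \<noteq> 0" and y: "y = act2 P (map_matrix \<sigma> P) C x"
    using assms by (rule equiv_kE)
  obtain a b c d where C: "C = m2 a b c d" by (rule m2_cases)
  have F: "F_form y v = 0 \<longleftrightarrow> F_form x (v v* C) = 0" for v
    using PC by (simp add: y F_form_act2)
  have surj: "\<exists>v. u = v v* C" for u
  proof -
    obtain B where "B ** C = mat 1" using det_nonzero_inverse[OF PC(5)] by metis
    then have "(u v* B) v* C = u"
      by (metis vector_matrix_mul_assoc vector_matrix_mul_rid)
    then show ?thesis by metis
  qed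
  have "(v v* C) $ 1 * \<eta> ((v v* C) $ 2) = (v v* C) $ 2 * \<eta> ((v v* C) $ 1) \<longleftrightarrow>
      v $ 1 * \<eta> (v $ 2) = v $ 2 * \<eta> (v $ 1)" if "\<eta> \<in> Gal k UNIV" for \<eta> v
  proof -
    have "(v v* C) $ 1 * \<eta> ((v v* C) $ 2) - (v v* C) $ 2 * \<eta> ((v v* C) $ 1) =
      det C * (v $ 1 * \<eta> (v $ 2) - v $ 2 * \<eta> (v $ 1))"
      using PC(4) by (simp add: C vector_matrix_mult_2 Gal_UNIV_hom[OF that]) (simp add: algebra_simps)
    then show ?thesis using PC(5) by (metis mult_eq_0_iff right_minus_eq)
  qed
  then show ?thesis
    unfolding fixing_zeros_def F using surj by (metis (no_types, lifting))
qed

text \<open>The structure constants of the tensor algebra are the trace and norm of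
  \<open>\<theta>\<close>. They lie in \<open>k\<close>, so \<open>\<eta>\<close> respects
  multiplication and adjoint even if it moves the scalar \<open>\<theta>\<close>.\<close>

lemma galois_on_G_act_sep:
  assumes \<eta>: "\<eta> \<in> Gal k UNIV"
  defines "tmap \<equiv> \<lambda>X. (map_matrix \<eta> (fst X), map_matrix \<eta> (snd X))"
  shows "tmult \<sigma> \<theta> (tmap X) (tmap Y) = tmap (tmult \<sigma> \<theta> X Y)"
    and "galois_on_G \<eta> g = (tmap (fst g), map_matrix \<eta> (snd g))"
    and "act_sep \<sigma> \<theta> (galois_on_G \<eta> g) w_sep =
      (tmap (fst (act_sep \<sigma> \<theta> g w_sep)), tmap (snd (act_sep \<sigma> \<theta> g w_sep)))"
proof -
  note hom = Gal_UNIV_hom[OF \<eta>]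
  have tr: "\<eta> \<theta> + \<eta> (\<sigma> \<theta>) = \<theta> + \<sigma> \<theta>" "\<eta> \<theta> * \<eta> (\<sigma> \<theta>) = \<theta> * \<sigma> \<theta>"
    using hom(3)[OF trace_\<theta>] hom(3)[OF norm_\<theta>] by (simp_all add: hom)
  show mult: "tmult \<sigma> \<theta> (tmap X) (tmap Y) = tmap (tmult \<sigma> \<theta> X Y)" for X Y
    by (cases X rule: tmat_cases; cases Y rule: tmat_cases)
      (simp add: tmap_def hom(1,2,6,7) tr)
  have adj: "tadj \<sigma> \<theta> (tmap X) = tmap (tadj \<sigma> \<theta> X)" for X
    by (cases X rule: tmat_cases) (simp add: tmap_def hom(1,2,6,7) tr)
  show gal: "galois_on_G \<eta> g = (tmap (fst g), map_matrix \<eta> (snd g))"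
    by (cases g; cases "fst g") (auto simp: tmap_def)
  have M: "M_form_sep w_sep v = (m2 (v $ 1) 0 0 (v $ 2), 0)" for v
    by (simp add: M_form_sep_def M_form_def zero_m2)
  have "M_form_sep w_sep (v v* map_matrix \<eta> (snd g)) = tmap (M_form_sep w_sep (v v* snd g))"
    if "\<eta> (v $ 1) = v $ 1" "\<eta> (v $ 2) = v $ 2" for v
    unfolding M using that by (simp add: tmap_def vector_matrix_mult_2 hom zero_m2)
  then show "act_sep \<sigma> \<theta> (galois_on_G \<eta> g) w_sep =
      (tmap (fst (act_sep \<sigma> \<theta> g w_sep)), tmap (snd (act_sep \<sigma> \<theta> g w_sep)))"
    unfolding act_sep_def Let_def gal by (simp add: mult adj hom)
qed

text \<open>Evaluation at \<open>\<theta>\<close> need not commute with \<open>\<eta>\<close>, so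
  invertibility is carried over by applying \<open>\<eta>\<close> to an equation g h = 1.\<close>

lemma galois_on_G_closed:
  assumes \<eta>: "\<eta> \<in> Gal k UNIV" and g: "g \<in> carrier (G_sep \<sigma> \<theta>)"
  shows "galois_on_G \<eta> g \<in> carrier (G_sep \<sigma> \<theta>)"
proof -
  interpret group "G_sep \<sigma> \<theta>" by (rule G_sep_group)
  let ?tmap = "\<lambda>X. (map_matrix \<eta> (fst X), map_matrix \<eta> (snd X))"
  note hom = Gal_UNIV_hom[OF \<eta>]
  define h where "h = inv\<^bsub>G_sep \<sigma> \<theta>\<^esub> g"
  have "g \<otimes>\<^bsub>G_sep \<sigma> \<theta>\<^esub> h = \<one>\<^bsub>G_sep \<sigma> \<theta>\<^esub>"
    using g by (simp add: h_def)
  then have gh: "tmult \<sigma> \<theta> (fst g) (fst h) = (mat 1, 0)" "snd g ** snd h = mat 1"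
    by (simp_all add: mult_G_sep one_G_sep)
  have one: "tmult \<sigma> \<theta> (?tmap (fst g)) (?tmap (fst h)) = (mat 1, 0)"
    unfolding galois_on_G_act_sep(1)[OF \<eta>] gh by (simp add: mat_1_m2 zero_m2 hom)
  have "tev s (?tmap (fst g)) ** tev s (?tmap (fst h)) = mat 1" if "s = \<theta> \<or> s = \<sigma> \<theta>" for s
    using arg_cong[OF one, of "tev s"] tev_mult[of s \<theta> \<sigma>] that by (simp only: tev_one)
  then have "det (tev s (?tmap (fst g))) \<noteq> 0" if "s = \<theta> \<or> s = \<sigma> \<theta>" for s
    using that right_inverse_det_nonzero by blast
  moreover have "det (map_matrix \<eta> (snd g)) \<noteq> 0"
  proof -
    have "map_matrix \<eta> (snd g) ** map_matrix \<eta> (snd h) = map_matrix \<eta> (snd g ** snd h)"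
      by (cases "snd g" rule: m2_cases; cases "snd h" rule: m2_cases) (simp add: hom)
    also have "\<dots> = mat 1"
      unfolding gh by (simp add: mat_1_m2 hom)
    finally show ?thesis by (rule right_inverse_det_nonzero)
  qed
  ultimately show ?thesis
    unfolding carrier_G_sep galois_on_G_act_sep(2)[OF \<eta>] by simp
qed

text \<open>The coordinates of \<open>x\<close> lie in \<open>k\<close>, so the conjugate of a
  trivialization of \<open>x\<close> again trivializes \<open>x\<close>.\<close>

lemma galois_on_G_trivializer:
  assumes \<eta>: "\<eta> \<in> Gal k UNIV" and x: "x \<in> V_k k\<^sub>1 \<sigma>" "V_to_sep k \<theta> x = act_sep \<sigma> \<theta> g w_sep"
  shows "act_sep \<sigma> \<theta> (galois_on_G \<eta> g) w_sep = act_sep \<sigma> \<theta> g w_sep"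
proof -
  have *: "(map_matrix \<eta> (fst X), map_matrix \<eta> (snd X)) = X" if "X = mat_to_sep k \<theta> A" "A \<in> mats_over k\<^sub>1" for X A
    using that(2) unfolding that(1)
    by (cases A rule: m2_cases) (simp add: mat_to_sep_def Gal_UNIV_hom(3)[OF \<eta>] coords(3,4))
  have "fst x \<in> mats_over k\<^sub>1" "snd x \<in> mats_over k\<^sub>1"
    using x(1) by (auto simp: V_k_def herm_forms_def)
  then show ?thesis
    unfolding galois_on_G_act_sep(3)[OF \<eta>] x(2)[symmetric] V_to_sep_def fst_conv snd_conv
    using * by blast
qed

lemma infinite_UNIV: "infinite (UNIV :: 'a set)"
  by (rule infinite_super[OF subset_UNIV k_infinite])

text \<open>Up to a nonzero factor, F_x(v) is the product of the two entries of v C with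
  \<open>C = snd g\<close>, so its zeros are the two points annihilated by a column of
  \<open>C\<close>. The cocycle value \<open>s\<close> satisfies C^eta = C \<open>snd s\<close>: the
  points are fixed if \<open>snd s\<close> is diagonal and exchanged if it is antidiagonal.\<close>

lemma rho_kernel_eq:
  assumes x: "x \<in> V_k k\<^sub>1 \<sigma>"
    and ex: "\<exists>g. g \<in> carrier (G_sep \<sigma> \<theta>) \<and> V_to_sep k \<theta> x = act_sep \<sigma> \<theta> g w_sep"
  shows "rho_kernel k \<sigma> \<theta> x = fixing_zeros (F_form x)"
proof -
  interpret group "G_sep \<sigma> \<theta>" by (rule G_sep_group)
  define g where "g = trivializer k \<sigma> \<theta> x"
  have g: "g \<in> carrier (G_sep \<sigma> \<theta>)" and g_x: "V_to_sep k \<theta> x = act_sep \<sigma> \<theta> g w_sep"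
    using someI_ex[OF ex] unfolding g_def trivializer_def V_to_sep_w_elem by blast+
  have x_eq: "x = act2 (tev \<theta> (fst g)) (tev (\<sigma> \<theta>) (fst g)) (snd g) w_elem"
    using g_x V_to_sep_eq_act_sep_iff[OF x] by blast
  obtain a b c d where C: "snd g = m2 a b c d" by (rule m2_cases)
  have nz: "det (tev \<theta> (fst g)) \<noteq> 0" "det (tev (\<sigma> \<theta>) (fst g)) \<noteq> 0" "a * d - b * c \<noteq> 0"
    using g by (auto simp: carrier_G_sep C)
  have "F_form w_elem v = v $ 1 * v $ 2" for v :: "'a ^ 2"
    by (simp add: w_elem_m2 F_form_quadratic)
  then have zero: "F_form x v = 0 \<longleftrightarrow> v $ 1 * a + v $ 2 * c = 0 \<or> v $ 1 * b + v $ 2 * d = 0" for v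
    using nz unfolding x_eq F_form_act2 by (simp add: vector_matrix_mult_2 C)
  have "rho k \<sigma> \<theta> x \<eta> = \<one>\<^bsub>comp_group \<sigma> \<theta> w_sep\<^esub> \<longleftrightarrow>
      (\<forall>v. F_form x v = 0 \<longrightarrow> v $ 1 * \<eta> (v $ 2) = v $ 2 * \<eta> (v $ 1))" if \<eta>: "\<eta> \<in> Gal k UNIV" for \<eta>
  proof -
    note hom = Gal_UNIV_hom[OF \<eta>]
    define h where "h = galois_on_G \<eta> g"
    define s where "s = inv\<^bsub>G_sep \<sigma> \<theta>\<^esub> g \<otimes>\<^bsub>G_sep \<sigma> \<theta>\<^esub> h"
    have h: "h \<in> carrier (G_sep \<sigma> \<theta>)"
      unfolding h_def by (rule galois_on_G_closed[OF \<eta> g])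
    have "act_sep \<sigma> \<theta> s w_sep = w_sep"
      unfolding s_def act_sep_mult h_def galois_on_G_trivializer[OF \<eta> x g_x]
      unfolding act_sep_mult[symmetric] by (simp add: g act_sep_one)
    moreover have s_carrier: "s \<in> carrier (G_sep \<sigma> \<theta>)"
      unfolding s_def by (intro m_closed inv_closed g h)
    ultimately have s: "s \<in> stab_sep \<sigma> \<theta> w_sep"
      by (simp add: stab_sep_def stabilizer_def)
    obtain u v' v u' where D: "snd s = m2 u v' v u'" by (rule m2_cases)
    have "g \<otimes>\<^bsub>G_sep \<sigma> \<theta>\<^esub> s = h"
      unfolding s_def by (simp only: m_assoc[OF g inv_closed[OF g] h, symmetric] r_inv[OF g] l_one[OF h])
    then have "snd g ** snd s = map_matrix \<eta> (snd g)"
      by (auto simp: mult_G_sep h_def galois_on_G_act_sep(2)[OF \<eta>])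
    then have cols: "\<eta> a = a * u + b * v" "\<eta> c = c * u + d * v" "\<eta> b = a * v' + b * u'" "\<eta> d = c * v' + d * u'"
      by (simp_all add: C D)
    have "rho k \<sigma> \<theta> x \<eta> = stab0_sep \<sigma> \<theta> w_sep #>\<^bsub>G_sep \<sigma> \<theta>\<^esub> s"
      by (simp add: rho_def V_to_sep_w_elem s_def h_def flip: g_def)
    moreover have "\<one>\<^bsub>comp_group \<sigma> \<theta> w_sep\<^esub> = stab0_sep \<sigma> \<theta> w_sep"
      by (simp add: comp_group_def FactGroup_def)
    ultimately have "rho k \<sigma> \<theta> x \<eta> = \<one>\<^bsub>comp_group \<sigma> \<theta> w_sep\<^esub> \<longleftrightarrow> s \<in> stab0_sep \<sigma> \<theta> w_sep"
      using coset_join1[OF _ s_carrier] coset_join2[OF s_carrier]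
        stab0_w_sep_subgroup[OF infinite_UNIV] by auto
    also have "\<dots> \<longleftrightarrow> v' = 0"
      using s by (simp add: stab0_w_sep[OF infinite_UNIV] D)
    also have "\<dots> \<longleftrightarrow> (\<forall>v. F_form x v = 0 \<longrightarrow> v $ 1 * \<eta> (v $ 2) = v $ 2 * \<eta> (v $ 1))"
    proof
      assume "v' = 0"
      then have uv: "v = 0" "u \<noteq> 0" "u' \<noteq> 0"
        using stab_w_sep_cases[OF s] by (auto simp: D)
      have proportional: "x1 * y2 = x2 * y1"
        if "x1 * e + x2 * f = 0" "y1 * e + y2 * f = 0" "e \<noteq> 0 \<or> f \<noteq> 0" for x1 x2 y1 y2 e f :: 'a
      proof -
        have "e * (x1 * y2 - x2 * y1) = (x1 * e + x2 * f) * y2 - (y1 * e + y2 * f) * x2"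
          "f * (x1 * y2 - x2 * y1) = (y1 * e + y2 * f) * x1 - (x1 * e + x2 * f) * y1"
          by (simp_all add: algebra_simps)
        then show ?thesis using that by (elim disjE) simp_all
      qed
      have column: "x1 * \<eta> x2 = x2 * \<eta> x1"
        if "x1 * e + x2 * f = 0" "\<eta> e = e * r" "\<eta> f = f * r" "r \<noteq> 0" "e \<noteq> 0 \<or> f \<noteq> 0" for x1 x2 e f r
      proof -
        have "(\<eta> x1 * e + \<eta> x2 * f) * r = \<eta> (x1 * e + x2 * f)"
          by (simp add: hom(1,2) that(2,3) algebra_simps)
        then have "\<eta> x1 * e + \<eta> x2 * f = 0" using that(1,4) hom(4) by simp
        with that(1) show ?thesis using that(5) by (rule proportional)
      qed
      show "\<forall>v. F_form x v = 0 \<longrightarrow> v $ 1 * \<eta> (v $ 2) = v $ 2 * \<eta> (v $ 1)"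
      proof (intro allI impI)
        fix y assume "F_form x y = 0"
        then consider "y $ 1 * a + y $ 2 * c = 0" | "y $ 1 * b + y $ 2 * d = 0"
          by (auto simp: zero)
        then show "y $ 1 * \<eta> (y $ 2) = y $ 2 * \<eta> (y $ 1)"
        proof cases
          case 1
          then show ?thesis
            by (rule column[where r = u]) (use uv cols(1,2) nz(3) in \<open>simp_all, auto\<close>)
        next
          case 2
          then show ?thesis
            by (rule column[where r = u']) (use uv cols(3,4) nz(3) \<open>v' = 0\<close> in \<open>simp_all, auto\<close>)
        qed
      qed
    next
      assume *: "\<forall>v. F_form x v = 0 \<longrightarrow> v $ 1 * \<eta> (v $ 2) = v $ 2 * \<eta> (v $ 1)"
      \<comment> \<open>The zero annihilated by the first column (a, c) of \<open>C\<close>.\<close>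
      define y :: "'a ^ 2" where "y = (\<chi> i. if i = 1 then - c else a)"
      have y: "y $ 1 = - c" "y $ 2 = a" by (simp_all add: y_def)
      have "c * \<eta> a = a * \<eta> c"
        using *[rule_format, of y] by (simp add: zero y hom)
      moreover have "v * (a * d - b * c) = a * \<eta> c - c * \<eta> a"
        unfolding cols by (simp add: algebra_simps)
      ultimately have "v * (a * d - b * c) = 0" by simp
      then have "v = 0" using nz by simp
      then show "v' = 0"
        using stab_w_sep_cases[OF s] by (auto simp: D)
    qed
    finally show ?thesis .
  qed
  then show ?thesis
    unfolding rho_kernel_def fixing_zeros_def V_to_sep_w_elem by blast
qed

section \<open>Normal forms\<close>

definition normal_form :: "'a \<Rightarrow> 'a \<Rightarrow> 'a mat2 \<times> 'a mat2" where
  "normal_form d c = (m2 1 0 0 d, m2 0 1 1 c)"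

lemma F_form_normal_form:
  "F_form (normal_form d c) v = d * (v $ 1)\<^sup>2 + c * v $ 1 * v $ 2 - (v $ 2)\<^sup>2"
  unfolding normal_form_def F_form_quadratic by simp

lemma bqf_disc_normal_form: "bqf_disc (F_form (normal_form d c)) = c\<^sup>2 + 4 * d"
  by (simp add: bqf_disc_def F_form_normal_form Let_def)

lemma normal_form_V_k_ss:
  "c \<in> k \<Longrightarrow> d \<in> k \<Longrightarrow> c\<^sup>2 + 4 * d \<noteq> 0 \<Longrightarrow> normal_form d c \<in> V_k_ss k\<^sub>1 \<sigma>"
  using k_closed(1,2) k1_closed(1,2)
  by (simp add: V_k_ss_def bqf_disc_normal_form) (simp add: normal_form_def V_k_iff herm_forms_iff)

lemma mat_1_over: "mat 1 \<in> mats_over k" "mat 1 \<in> mats_over k\<^sub>1"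
  using k_closed(1,2) k1_closed(1,2) by (simp_all add: mat_1_m2)

lemma equiv_k_left:
  assumes "m2 p q r s \<in> mats_over k\<^sub>1" "p * s - q * r \<noteq> 0"
    and "m2 p q r s ** A ** m2 (\<sigma> p) (\<sigma> r) (\<sigma> q) (\<sigma> s) = A'"
    and "m2 p q r s ** B ** m2 (\<sigma> p) (\<sigma> r) (\<sigma> q) (\<sigma> s) = B'"
  shows "(A, B) \<sim> (A', B')"
proof (rule equiv_kI[of "m2 p q r s" "mat 1"])
  have "act2 (m2 p q r s) (map_matrix \<sigma> (m2 p q r s)) (mat 1) (A, B) =
    (m2 p q r s ** A ** m2 (\<sigma> p) (\<sigma> r) (\<sigma> q) (\<sigma> s), m2 p q r s ** B ** m2 (\<sigma> p) (\<sigma> r) (\<sigma> q) (\<sigma> s))"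
    unfolding mat_1_m2 act2_m2
    by (cases A rule: m2_cases; cases B rule: m2_cases) simp
  then show "act2 (m2 p q r s) (map_matrix \<sigma> (m2 p q r s)) (mat 1) (A, B) = (A', B')"
    using assms(3,4) by simp
qed (use assms(1,2) mat_1_over in simp_all)

lemma equiv_k_right:
  assumes "a \<in> k" "b \<in> k" "c \<in> k" "d \<in> k" "a * d - b * c \<noteq> 0"
    and "smat a A + smat b B = A'" "smat c A + smat d B = B'"
  shows "(A, B) \<sim> (A', B')"
proof (rule equiv_kI[of "mat 1" "m2 a b c d"])
  have "map_matrix \<sigma> (mat 1) = (mat 1 :: 'a mat2)" by (simp add: mat_1_m2)
  then show "act2 (mat 1) (map_matrix \<sigma> (mat 1)) (m2 a b c d) (A, B) = (A', B')"
    using assms(6,7) by simp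
qed (use assms mat_1_over in simp_all)

text \<open>If all diagonal entries vanish, adding \<open>s\<close> times the second basis vector to
  the first creates the corner entries Tr(s \<open>\<sigma>\<close> b) and Tr(s
  \<open>\<sigma>\<close> b'). One of them is nonzero for suitable \<open>s\<close> because the
  trace form is nondegenerate.\<close>

lemma equiv_nonzero_corner:
  assumes "x \<in> V_k_ss k\<^sub>1 \<sigma>"
  shows "\<exists>y. x \<sim> y \<and> (fst y $ 1 $ 1 \<noteq> 0 \<or> snd y $ 1 $ 1 \<noteq> 0)"
proof -
  have "x \<in> V_k k\<^sub>1 \<sigma>" and disc: "bqf_disc (F_form x) \<noteq> 0"
    using assms by (simp_all add: V_k_ss_def)
  from this(1) obtain a b c a' b' c' where x: "x = (m2 a b (\<sigma> b) c, m2 a' b' (\<sigma> b') c')"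
    and mem: "a \<in> k" "b \<in> k\<^sub>1" "c \<in> k" "a' \<in> k" "b' \<in> k\<^sub>1" "c' \<in> k" by (rule V_k_cases)
  consider "a \<noteq> 0 \<or> a' \<noteq> 0" | "c \<noteq> 0 \<or> c' \<noteq> 0" | "a = 0" "a' = 0" "c = 0" "c' = 0" by blast
  then show ?thesis
  proof cases
    case 1
    then show ?thesis using equiv_k_refl[of x] by (intro exI[of _ x]) (simp add: x)
  next
    case 2
    have "x \<sim> (m2 c (\<sigma> b) b a, m2 c' (\<sigma> b') b' a')"
      unfolding x by (rule equiv_k_left[of 0 1 1 0]) (simp_all add: k1_closed(1,2))
    then show ?thesis
      using 2 by (intro exI[of _ "(m2 c (\<sigma> b) b a, m2 c' (\<sigma> b') b' a')"]) simp
  next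
    case 3
    have "b \<noteq> 0 \<or> b' \<noteq> 0"
      using disc by (auto simp: x 3 bqf_disc_def F_form_quadratic)
    \<comment> \<open>Nondegeneracy is tested on the basis: s = 1 gives
      \<open>\<sigma> u = - u\<close>, and then \<open>s = \<theta>\<close> contradicts
      \<open>\<theta> \<noteq> \<sigma> \<theta>\<close>.\<close>
    have "\<exists>s\<in>k\<^sub>1. s * \<sigma> u + \<sigma> s * u \<noteq> 0" if "u \<in> k\<^sub>1" "u \<noteq> 0" for u
    proof (rule ccontr)
      assume "\<not> ?thesis"
      then have *: "s * \<sigma> u + \<sigma> s * u = 0" if "s \<in> k\<^sub>1" for s using that by blast
      have "\<sigma> u = - u" using *[of 1] k1_closed(2) by (simp add: add_eq_0_iff2)
      then have "(\<sigma> \<theta> - \<theta>) * u = 0" using *[of \<theta>] \<theta> by (simp add: algebra_simps)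
      then show False using that \<sigma>\<theta>_neq by simp
    qed
    then obtain s where s: "s \<in> k\<^sub>1" "s * \<sigma> b + \<sigma> s * b \<noteq> 0 \<or> s * \<sigma> b' + \<sigma> s * b' \<noteq> 0"
      using \<open>b \<noteq> 0 \<or> b' \<noteq> 0\<close> mem(2,5) by metis
    have "x \<sim> (m2 (s * \<sigma> b + \<sigma> s * b) b (\<sigma> b) 0, m2 (s * \<sigma> b' + \<sigma> s * b') b' (\<sigma> b') 0)"
      unfolding x 3 by (rule equiv_k_left[of 1 s 0 1]) (simp_all add: k1_closed(1,2) s mult.commute)
    then show ?thesis by (intro exI conjI, assumption) (use s(2) in simp)
  qed
qed

text \<open>The factor GL_2(k) acts transitively on the nonzero pairs of corner entries, so the pair
  can be moved to (1, 0).\<close>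

lemma equiv_unit_corner:
  assumes "x \<in> V_k_ss k\<^sub>1 \<sigma>"
  shows "\<exists>b c e f. b \<in> k\<^sub>1 \<and> c \<in> k \<and> e \<in> k\<^sub>1 \<and> f \<in> k \<and> x \<sim> (m2 1 b (\<sigma> b) c, m2 0 e (\<sigma> e) f)"
proof -
  obtain y where y: "x \<sim> y" "fst y $ 1 $ 1 \<noteq> 0 \<or> snd y $ 1 $ 1 \<noteq> 0"
    using equiv_nonzero_corner[OF assms] by blast
  have "y \<in> V_k k\<^sub>1 \<sigma>"
    using V_k_ss_equiv[OF assms y(1)] by (simp add: V_k_ss_def)
  then obtain a b c a' b' c' where y_eq: "y = (m2 a b (\<sigma> b) c, m2 a' b' (\<sigma> b') c')"
    and mem: "a \<in> k" "b \<in> k\<^sub>1" "c \<in> k" "a' \<in> k" "b' \<in> k\<^sub>1" "c' \<in> k" by (rule V_k_cases)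
  have "\<exists>z. y \<sim> z \<and> fst z $ 1 $ 1 = 1 \<and> snd z $ 1 $ 1 = 0"
  proof (cases "a = 0")
    case False
    have "y \<sim> (smat (1 / a) (fst y) + smat 0 (snd y), smat (- a' / a) (fst y) + smat 1 (snd y))"
      unfolding y_eq fst_conv snd_conv using False mem
      by (intro equiv_k_right[of "1 / a" 0 "- a' / a" 1] refl k_closed) simp_all
    then show ?thesis
      by (intro exI conjI, assumption) (use False in \<open>simp_all add: y_eq\<close>)
  next
    case True
    then have "a' \<noteq> 0" using y(2) by (simp add: y_eq)
    have "y \<sim> (smat 0 (fst y) + smat (1 / a') (snd y), smat 1 (fst y) + smat 0 (snd y))"
      unfolding y_eq fst_conv snd_conv using \<open>a' \<noteq> 0\<close> mem
      by (intro equiv_k_right[of 0 "1 / a'" 1 0] refl k_closed) simp_all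
    then show ?thesis
      by (intro exI conjI, assumption) (use True \<open>a' \<noteq> 0\<close> in \<open>simp_all add: y_eq\<close>)
  qed
  then obtain z where z: "y \<sim> z" "fst z $ 1 $ 1 = 1" "snd z $ 1 $ 1 = 0" by blast
  have xz: "x \<sim> z" by (rule equiv_k_trans[OF y(1) z(1)])
  then have "z \<in> V_k k\<^sub>1 \<sigma>"
    using V_k_ss_equiv[OF assms] by (simp add: V_k_ss_def)
  then obtain a b c a' b' c' where z_eq: "z = (m2 a b (\<sigma> b) c, m2 a' b' (\<sigma> b') c')"
    and mem': "b \<in> k\<^sub>1" "c \<in> k" "b' \<in> k\<^sub>1" "c' \<in> k" by (rule V_k_cases)
  have "a = 1" "a' = 0" using z by (simp_all add: z_eq)
  then show ?thesis
    using xz mem' unfolding z_eq by blast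
qed

lemma equiv_normal_form:
  assumes "x \<in> V_k_ss k\<^sub>1 \<sigma>"
  shows "\<exists>c d. c \<in> k \<and> d \<in> k \<and> c\<^sup>2 + 4 * d \<noteq> 0 \<and> x \<sim> normal_form d c"
proof -
  obtain b c e f where mem: "b \<in> k\<^sub>1" "c \<in> k" "e \<in> k\<^sub>1" "f \<in> k"
    and x1: "x \<sim> (m2 1 b (\<sigma> b) c, m2 0 e (\<sigma> e) f)"
    using equiv_unit_corner[OF assms] by blast
  define d where "d = c - \<sigma> b * b"
  define f' where "f' = f - \<sigma> b * e - \<sigma> e * b"
  have "(m2 1 b (\<sigma> b) c, m2 0 e (\<sigma> e) f) \<sim> (m2 1 0 0 d, m2 0 e (\<sigma> e) f')"
    by (rule equiv_k_left[of 1 0 "- \<sigma> b" 1])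
      (simp_all add: mem k1_closed(1,2,6) \<sigma>_k1 \<sigma>_minus \<sigma>_\<sigma> d_def f'_def algebra_simps)
  with x1 have x2: "x \<sim> (m2 1 0 0 d, m2 0 e (\<sigma> e) f')" by (rule equiv_k_trans)
  then have ss: "(m2 1 0 0 d, m2 0 e (\<sigma> e) f') \<in> V_k_ss k\<^sub>1 \<sigma>" by (rule V_k_ss_equiv[OF assms])
  have df: "d \<in> k" "f' \<in> k"
    using ss by (simp_all add: V_k_ss_def V_k_iff herm_forms_iff)
  have "\<exists>c d. c \<in> k \<and> d \<in> k \<and> x \<sim> normal_form d c"
  proof (cases "e = 0")
    case False
    then have \<sigma>e: "\<sigma> e \<noteq> 0" "\<sigma> e \<in> k\<^sub>1" using mem \<sigma>_eq_0_iff \<sigma>_k1 by auto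
    define s where "s = inverse (\<sigma> e)"
    have s: "s \<in> k\<^sub>1" "s * \<sigma> e = 1" unfolding s_def using \<sigma>e k1_closed(5) by auto
    have s': "\<sigma> s * e = 1" using arg_cong[OF s(2), of \<sigma>] s(1) \<sigma>e mem by (simp add: \<sigma>_mult \<sigma>_\<sigma>)
    have "(m2 1 0 0 d, m2 0 e (\<sigma> e) f') \<sim> (m2 1 0 0 (s * d * \<sigma> s), m2 0 1 1 (s * f' * \<sigma> s))"
      by (rule equiv_k_left[of 1 0 0 s])
        (use s s' in \<open>auto simp: k1_closed(1,2) mult.commute\<close>)
    with x2 have x3: "x \<sim> normal_form (s * d * \<sigma> s) (s * f' * \<sigma> s)"
      unfolding normal_form_def by (rule equiv_k_trans)
    have "normal_form (s * d * \<sigma> s) (s * f' * \<sigma> s) \<in> V_k_ss k\<^sub>1 \<sigma>"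
      using x3 by (rule V_k_ss_equiv[OF assms])
    then have "s * d * \<sigma> s \<in> k" "s * f' * \<sigma> s \<in> k"
      by (simp_all add: V_k_ss_def V_k_iff herm_forms_iff normal_form_def)
    then show ?thesis using x3 by blast
  next
    case True
    have "f' \<noteq> 0"
    proof
      assume "f' = 0"
      then show False
        using ss by (simp add: V_k_ss_def True bqf_disc_def F_form_quadratic)
    qed
    \<comment> \<open>Both forms are diagonal here and cannot be scaled into normal form. They are
      brought to \<open>w\<close> itself; a shear of the basis then creates the off-diagonal
      entries.\<close>
    have "(m2 1 0 0 d, m2 0 e (\<sigma> e) f') \<sim> (m2 1 0 0 0, m2 0 0 0 1)"
      by (rule equiv_k_right[of 1 "- d / f'" 0 "1 / f'"])
        (use df \<open>f' \<noteq> 0\<close> in \<open>simp_all add: k_closed True\<close>)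
    moreover have "(m2 1 0 0 0, m2 0 0 0 1) \<sim> (m2 1 0 0 0, m2 1 1 1 1)"
      by (rule equiv_k_left[of 1 1 0 1]) (simp_all add: k1_closed(1,2))
    moreover have "(m2 1 0 0 0, m2 1 1 1 1) \<sim> normal_form 0 1"
      unfolding normal_form_def by (rule equiv_k_right[of 1 0 "- 1" 1]) (simp_all add: k_closed(1,2,6))
    ultimately have "x \<sim> normal_form 0 1"
      using x2 equiv_k_trans by blast
    then show ?thesis using k_closed(1,2) by blast
  qed
  then obtain c d where cd: "c \<in> k" "d \<in> k" "x \<sim> normal_form d c" by blast
  then have "c\<^sup>2 + 4 * d \<noteq> 0"
    using V_k_ss_equiv[OF assms cd(3)] by (simp add: V_k_ss_def bqf_disc_normal_form)
  then show ?thesis using cd by blast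
qed

text \<open>If \<open>\<alpha>\<close> is a root of \<open>X\<^sup>2 - c X - d\<close>, then \<open>x\<^sub>1 + \<alpha> x\<^sub>2\<close> is the product of the column \<open>(1, \<alpha>)\<close> and
  its transpose; the matrix with rows \<open>(1, 0)\<close>, \<open>(p, q)\<close> sends that column to \<open>(1, p + q \<alpha>)\<close>, and the
  new parameters are those of the minimal polynomial of \<open>p + q \<alpha>\<close>.\<close>

lemma normal_form_affine_change:
  assumes "c \<in> k" "d \<in> k" "p \<in> k" "q \<in> k" "q \<noteq> 0"
  shows "normal_form d c \<sim> normal_form (q\<^sup>2 * d - p\<^sup>2 - p * q * c) (2 * p + q * c)"
proof -
  let ?A = "m2 1 p p (p\<^sup>2 + q\<^sup>2 * d)" and ?B = "m2 0 q q (2 * p * q + q\<^sup>2 * c)"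
  have "normal_form d c \<sim> (?A, ?B)"
    unfolding normal_form_def
    by (rule equiv_k_left[of 1 0 p q])
      (use assms in \<open>simp_all add: k1_closed(1,2) k_in_k1 \<sigma>_k power2_eq_square algebra_simps\<close>)
  moreover have "(?A, ?B) \<sim> normal_form (q\<^sup>2 * d - p\<^sup>2 - p * q * c) (2 * p + q * c)"
    unfolding normal_form_def
  proof (rule equiv_k_right[of 1 "- p / q" 0 "1 / q"])
    have "p / q * (2 * p * q + q\<^sup>2 * c) = 2 * p * p + p * q * c" "1 / q * (2 * p * q + q\<^sup>2 * c) = 2 * p + q * c"
      using assms(5) by (simp_all add: power2_eq_square field_simps)
    then show "smat 1 ?A + smat (- p / q) ?B = m2 1 0 0 (q\<^sup>2 * d - p\<^sup>2 - p * q * c)"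
      "smat 0 ?A + smat (1 / q) ?B = m2 0 1 1 (2 * p + q * c)"
      using assms(5) by (simp_all add: power2_eq_square algebra_simps)
  qed (use assms in \<open>simp_all add: k_closed\<close>)
  ultimately show ?thesis by (rule equiv_k_trans)
qed

section \<open>Fields generated by the roots of a quadratic polynomial\<close>

text \<open>The distinct roots of a quadratic polynomial over \<open>k\<close>, described by its
  coefficients. Roots in \<open>k\<close> are allowed, so the trivial extension is included.\<close>

definition root_pair :: "'a \<Rightarrow> 'a \<Rightarrow> bool" where
  "root_pair \<alpha> \<beta> \<longleftrightarrow> \<alpha> \<noteq> \<beta> \<and> \<alpha> + \<beta> \<in> k \<and> \<alpha> * \<beta> \<in> k"

definition k_adjoin :: "'a \<Rightarrow> 'a set" where
  "k_adjoin \<alpha> = {p + q * \<alpha> | p q. p \<in> k \<and> q \<in> k}"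

lemma k_adjoinI: "p \<in> k \<Longrightarrow> q \<in> k \<Longrightarrow> x = p + q * \<alpha> \<Longrightarrow> x \<in> k_adjoin \<alpha>"
  unfolding k_adjoin_def by blast

lemma k_adjoinE:
  assumes "x \<in> k_adjoin \<alpha>"
  obtains p q where "p \<in> k" "q \<in> k" "x = p + q * \<alpha>"
  using assms unfolding k_adjoin_def by blast

lemma root_pair_sym: "root_pair \<alpha> \<beta> \<Longrightarrow> root_pair \<beta> \<alpha>"
  by (auto simp: root_pair_def add.commute mult.commute)

lemma k_sub_k_adjoin: "k \<subseteq> k_adjoin \<alpha>"
  by (auto intro!: k_adjoinI[of _ 0] k_closed(1))

lemma gen_in_k_adjoin: "\<alpha> \<in> k_adjoin \<alpha>"
  by (rule k_adjoinI[of 0 1]) (simp_all add: k_closed(1,2))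

lemma k_adjoin_eq_k:
  assumes "\<alpha> \<in> k"
  shows "k_adjoin \<alpha> = k"
proof (intro subset_antisym subsetI)
  fix x assume "x \<in> k_adjoin \<alpha>"
  then obtain p q where pq: "p \<in> k" "q \<in> k" "x = p + q * \<alpha>" by (rule k_adjoinE)
  show "x \<in> k" unfolding pq(3) by (intro k_closed pq assms)
qed (use k_sub_k_adjoin in blast)

lemma other_root_in_k_adjoin:
  assumes "root_pair \<alpha> \<beta>"
  shows "\<beta> \<in> k_adjoin \<alpha>"
  by (rule k_adjoinI[of "\<alpha> + \<beta>" "- 1"]) (use assms in \<open>simp_all add: root_pair_def k_closed(2,6)\<close>)

text \<open>The inverse of p + q \<open>\<alpha>\<close> is its conjugate p + q
  \<open>\<beta>\<close> divided by the norm, which lies in \<open>k\<close>.\<close>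

lemma k_adjoin_subfield:
  assumes rp: "root_pair \<alpha> \<beta>"
  shows "is_subfield (k_adjoin \<alpha>)"
proof -
  have t: "\<alpha> + \<beta> \<in> k" and n: "\<alpha> * \<beta> \<in> k" using rp by (simp_all add: root_pair_def)
  have diff: "x - y \<in> k_adjoin \<alpha>" and mult: "x * y \<in> k_adjoin \<alpha>"
    if xy: "x \<in> k_adjoin \<alpha>" "y \<in> k_adjoin \<alpha>" for x y
  proof -
    obtain p q where x: "p \<in> k" "q \<in> k" "x = p + q * \<alpha>" using xy(1) by (rule k_adjoinE)
    obtain r s where y: "r \<in> k" "s \<in> k" "y = r + s * \<alpha>" using xy(2) by (rule k_adjoinE)
    show "x - y \<in> k_adjoin \<alpha>"
      by (rule k_adjoinI[of "p - r" "q - s"]) (simp_all add: x y k_closed(3) algebra_simps)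
    show "x * y \<in> k_adjoin \<alpha>"
    proof (rule k_adjoinI[of "p * r - q * s * (\<alpha> * \<beta>)" "p * s + q * r + q * s * (\<alpha> + \<beta>)"])
      show "p * r - q * s * (\<alpha> * \<beta>) \<in> k" "p * s + q * r + q * s * (\<alpha> + \<beta>) \<in> k"
        by (intro k_closed(3,4,7) x y t n)+
      show "x * y = p * r - q * s * (\<alpha> * \<beta>) + (p * s + q * r + q * s * (\<alpha> + \<beta>)) * \<alpha>"
        by (simp add: x(3) y(3) algebra_simps)
    qed
  qed
  have inv: "inverse x \<in> k_adjoin \<alpha>" if x: "x \<in> k_adjoin \<alpha>" for x
  proof -
    obtain p q where pq: "p \<in> k" "q \<in> k" "x = p + q * \<alpha>" using x by (rule k_adjoinE)
    define y where "y = p + q * \<beta>"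
    have "x * y = p * p + p * q * (\<alpha> + \<beta>) + q * q * (\<alpha> * \<beta>)"
      by (simp add: pq(3) y_def algebra_simps)
    also have "\<dots> \<in> k"
      by (intro k_closed(4,7) pq t n)
    finally have xy: "x * y \<in> k" .
    show ?thesis
    proof (cases "x * y = 0")
      case False
      define z where "z = inverse (x * y)"
      have z: "z \<in> k" unfolding z_def using xy by (rule k_closed(5))
      have "x \<noteq> 0" "y \<noteq> 0" using False by auto
      then have "inverse x = z * y" by (simp add: z_def field_simps)
      then have eq: "inverse x = z * (p + q * (\<alpha> + \<beta>)) + - (z * q) * \<alpha>"
        by (simp add: y_def algebra_simps)
      show ?thesis
        by (rule k_adjoinI[OF _ _ eq]) (intro k_closed(4,6,7) z pq t)+
    next
      \<comment> \<open>The norm of a nonzero element can vanish only if its conjugate does; then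
        \<open>\<beta>\<close>, and with it \<open>\<alpha>\<close>, lies in
        \<open>k\<close>.\<close>
      case True
      show ?thesis
      proof (cases "x = 0")
        case True
        then show ?thesis using x by simp
      next
        case False
        then have "y = 0" using True by simp
        have "q \<noteq> 0" using False \<open>y = 0\<close> by (auto simp: pq(3) y_def)
        have "\<beta> = - p / q" using \<open>y = 0\<close> \<open>q \<noteq> 0\<close> by (simp add: y_def field_simps add_eq_0_iff)
        also have "\<dots> \<in> k" by (intro k_closed(6,8) pq)
        finally have "\<alpha> \<in> k" using k_closed(3)[OF t] by force
        then show ?thesis using x by (simp add: k_adjoin_eq_k k_closed(5))
      qed
    qed
  qed
  show ?thesis
    unfolding is_subfield_def using k_sub_k_adjoin[of \<alpha>] k_closed(1,2) diff mult inv by auto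
qed

lemma hull_eq_k_adjoin:
  assumes rp: "root_pair \<alpha> \<beta>"
  shows "is_subfield hull (k \<union> {\<alpha>, \<beta>}) = k_adjoin \<alpha>"
proof (rule hull_unique)
  show "k \<union> {\<alpha>, \<beta>} \<subseteq> k_adjoin \<alpha>"
    using k_sub_k_adjoin gen_in_k_adjoin other_root_in_k_adjoin[OF rp] by simp
  show "is_subfield (k_adjoin \<alpha>)" by (rule k_adjoin_subfield[OF rp])
next
  fix K assume K: "k \<union> {\<alpha>, \<beta>} \<subseteq> K" "is_subfield K"
  show "k_adjoin \<alpha> \<subseteq> K"
  proof
    fix x assume "x \<in> k_adjoin \<alpha>"
    then obtain p q where pq: "p \<in> k" "q \<in> k" "x = p + q * \<alpha>" by (rule k_adjoinE)
    show "x \<in> K" unfolding pq(3) using K(1) pq by (intro is_subfieldD(4,7)[OF K(2)]) auto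
  qed
qed

section \<open>Isomorphisms and normality of the fields generated by roots\<close>

lemma ext_iso_root:
  assumes rp: "root_pair \<alpha> \<beta>" and f: "f \<in> ext_isos k L L'" and L: "is_subfield L" "k \<subseteq> L" "\<alpha> \<in> L"
  shows "f \<alpha> = \<alpha> \<or> f \<alpha> = \<beta>" and "p \<in> k \<Longrightarrow> q \<in> k \<Longrightarrow> f (p + q * \<alpha>) = p + q * f \<alpha>"
proof -
  have hom: "\<And>x y. x \<in> L \<Longrightarrow> y \<in> L \<Longrightarrow> f (x + y) = f x + f y"
    "\<And>x y. x \<in> L \<Longrightarrow> y \<in> L \<Longrightarrow> f (x * y) = f x * f y" "\<And>x. x \<in> k \<Longrightarrow> f x = x"
    using f by (simp_all add: ext_isos_def)
  have kL: "x \<in> L" if "x \<in> k" for x using that L(2) by blast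
  show lin: "f (p + q * \<alpha>) = p + q * f \<alpha>" if "p \<in> k" "q \<in> k" for p q
    using that L(3) kL by (simp add: hom is_subfieldD(4)[OF L(1)])
  have t: "\<alpha> + \<beta> \<in> k" and n: "- (\<alpha> * \<beta>) \<in> k" using rp k_closed(6) by (simp_all add: root_pair_def)
  have "f \<alpha> * f \<alpha> = f (- (\<alpha> * \<beta>) + (\<alpha> + \<beta>) * \<alpha>)"
    using hom(2)[OF L(3,3)] by (simp add: algebra_simps)
  also have "\<dots> = - (\<alpha> * \<beta>) + (\<alpha> + \<beta>) * f \<alpha>"
    by (rule lin[OF n t])
  finally have "(f \<alpha> - \<alpha>) * (f \<alpha> - \<beta>) = 0"
    by (simp add: algebra_simps)
  then show "f \<alpha> = \<alpha> \<or> f \<alpha> = \<beta>" by auto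
qed

text \<open>Normality: the generator can only go to \<open>\<alpha>\<close> or
  \<open>\<beta>\<close>, both of which lie in the field.\<close>

lemma ext_iso_image_sub:
  assumes rp: "root_pair \<alpha> \<beta>" and f: "f \<in> ext_isos k (k_adjoin \<alpha>) L'"
  shows "L' \<subseteq> k_adjoin \<alpha>"
proof
  fix z assume "z \<in> L'"
  then obtain x where x: "x \<in> k_adjoin \<alpha>" "z = f x"
    using f by (auto simp: ext_isos_def bij_betw_def)
  from x(1) obtain p q where pq: "p \<in> k" "q \<in> k" "x = p + q * \<alpha>" by (rule k_adjoinE)
  note root = ext_iso_root[OF rp f k_adjoin_subfield[OF rp] k_sub_k_adjoin gen_in_k_adjoin]
  have "z = p + q * f \<alpha>" using root(2)[OF pq(1,2)] by (simp add: x(2) pq(3))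
  moreover have "f \<alpha> \<in> k_adjoin \<alpha>"
    using root(1) gen_in_k_adjoin other_root_in_k_adjoin[OF rp] by auto
  ultimately show "z \<in> k_adjoin \<alpha>"
    using is_subfieldD(4,7)[OF k_adjoin_subfield[OF rp]] k_sub_k_adjoin pq(1,2) by (simp add: subset_iff)
qed

text \<open>By normality, isomorphic fields of this kind inside the closure contain each other and
  are therefore equal.\<close>

lemma ext_class_k_adjoin_inj:
  assumes "root_pair \<alpha> \<beta>" "root_pair \<alpha>' \<beta>'" "ext_class k (k_adjoin \<alpha>) = ext_class k (k_adjoin \<alpha>')"
  shows "k_adjoin \<alpha> = k_adjoin \<alpha>'"
proof -
  have self: "k_adjoin \<gamma> \<in> ext_class k (k_adjoin \<gamma>)" if "root_pair \<gamma> \<delta>" for \<gamma> \<delta>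
  proof -
    have "id \<in> ext_isos k (k_adjoin \<gamma>) (k_adjoin \<gamma>)" by (simp add: ext_isos_def)
    then show ?thesis
      using k_adjoin_subfield[OF that] k_sub_k_adjoin unfolding ext_class_def by blast
  qed
  have sub: "k_adjoin \<delta> \<subseteq> k_adjoin \<gamma>"
    if "root_pair \<gamma> \<gamma>'" "k_adjoin \<delta> \<in> ext_class k (k_adjoin \<gamma>)" for \<gamma> \<gamma>' \<delta>
    using that(2) ext_iso_image_sub[OF that(1)] unfolding ext_class_def by blast
  show ?thesis
    using sub[OF assms(1), of \<alpha>'] sub[OF assms(2), of \<alpha>] self[OF assms(1)] self[OF assms(2)] assms(3)
    by auto
qed

text \<open>An element outside \<open>k\<close> is moved by some automorphism of the closure. That
  automorphism sends \<open>\<alpha>\<close> to \<open>\<alpha>\<close> or \<open>\<beta>\<close>,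
  so it restricts to the field.\<close>

lemma galois_ext_k_adjoin:
  assumes rp: "root_pair \<alpha> \<beta>"
  shows "galois_ext k (k_adjoin \<alpha>)"
  unfolding galois_ext_def
proof
  have "\<exists>p. p \<noteq> 0 \<and> poly_over k p \<and> poly p x = 0" for x
    using k_sep separable_poly_nonzero
    unfolding UNIV_is_separable_closure_def separable_ext_def by blast
  then show "algebraic_ext k (k_adjoin \<alpha>)"
    unfolding algebraic_ext_def using k_adjoin_subfield[OF rp] k_sub_k_adjoin by blast
  have "x \<in> k" if x: "x \<in> k_adjoin \<alpha>" "\<forall>f\<in>Gal k (k_adjoin \<alpha>). f x = x" for x
  proof (rule ccontr)
    assume "x \<notin> k"
    then obtain \<eta> where \<eta>: "\<eta> \<in> Gal k UNIV" "\<eta> x \<noteq> x"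
      using ex_automorphism_moving[OF k k_sep] by blast
    note root = ext_iso_root[OF rp \<eta>(1) subfield_UNIV subset_UNIV UNIV_I]
    have lin: "\<eta> ` k_adjoin \<alpha> = k_adjoin (\<eta> \<alpha>)"
    proof (intro subset_antisym subsetI)
      fix z assume "z \<in> \<eta> ` k_adjoin \<alpha>"
      then obtain y where y: "y \<in> k_adjoin \<alpha>" "z = \<eta> y" by blast
      from y(1) obtain p q where pq: "p \<in> k" "q \<in> k" "y = p + q * \<alpha>" by (rule k_adjoinE)
      show "z \<in> k_adjoin (\<eta> \<alpha>)"
        by (rule k_adjoinI[OF pq(1,2)]) (simp only: y(2) pq(3) root(2)[OF pq(1,2)])
    next
      fix z assume "z \<in> k_adjoin (\<eta> \<alpha>)"
      then obtain p q where pq: "p \<in> k" "q \<in> k" "z = p + q * \<eta> \<alpha>" by (rule k_adjoinE)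
      show "z \<in> \<eta> ` k_adjoin \<alpha>"
        by (rule image_eqI[of _ _ "p + q * \<alpha>"])
          (simp_all only: pq(3) root(2)[OF pq(1,2)] k_adjoinI[OF pq(1,2) refl])
    qed
    have "k_adjoin \<beta> = k_adjoin \<alpha>"
      using hull_eq_k_adjoin[OF rp] hull_eq_k_adjoin[OF root_pair_sym[OF rp]] by (simp add: insert_commute)
    then have "\<eta> ` k_adjoin \<alpha> = k_adjoin \<alpha>"
      using lin root(1) by auto
    moreover have "inj_on \<eta> (k_adjoin \<alpha>)"
      using \<eta>(1) by (auto simp: ext_isos_def bij_betw_def intro: inj_on_subset)
    ultimately have "\<eta> \<in> Gal k (k_adjoin \<alpha>)"
      using \<eta>(1) by (simp add: ext_isos_def bij_betw_def)
    then show False using x(2) \<eta>(2) by blast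
  qed
  moreover have "x \<in> {x \<in> k_adjoin \<alpha>. \<forall>f\<in>Gal k (k_adjoin \<alpha>). f x = x}" if "x \<in> k" for x
    using that k_sub_k_adjoin by (auto simp: ext_isos_def)
  ultimately show "{x \<in> k_adjoin \<alpha>. \<forall>f\<in>Gal k (k_adjoin \<alpha>). f x = x} = k" by blast
qed

section \<open>Splitting fields of quadratic polynomials\<close>

lemma rsquarefree_linear_pair:
  fixes \<alpha> \<beta> :: 'a
  assumes "\<alpha> \<noteq> \<beta>"
  shows "rsquarefree ([:- \<alpha>, 1:] * [:- \<beta>, 1:])"
proof -
  have "Polynomial.order a ([:- \<alpha>, 1:] * [:- \<beta>, 1:]) = Polynomial.order a [:- \<alpha>, 1:] + Polynomial.order a [:- \<beta>, 1:]" for a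
    by (intro order_mult) (simp only: mult_eq_0_iff, simp)
  moreover have "Polynomial.order a [:- b, 1:] = (if a = b then 1 else 0)" for a b :: 'a
    using order_power_n_n[of b 1] by (auto simp: order_0I)
  ultimately show ?thesis
    unfolding rsquarefree_def using assms by (simp del: mult_pCons_left mult_pCons_right)
qed

lemma ext_class_k_adjoin_in_Ex2:
  assumes rp: "root_pair \<alpha> \<beta>"
  shows "ext_class k (k_adjoin \<alpha>) \<in> Ex2 k"
proof -
  let ?p = "[:- \<alpha>, 1:] * [:- \<beta>, 1:]"
  have p: "?p = [:\<alpha> * \<beta>, - (\<alpha> + \<beta>), 1:]" by simp
  have "poly_over k ?p"
    unfolding p poly_over_def using rp k_closed(1,2) k_closed(6)[of "\<alpha> + \<beta>"]
    by (auto simp: coeff_pCons root_pair_def split: nat.split)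
  moreover have "degree ?p = 2" by simp
  moreover have "rsquarefree ?p" using rp by (intro rsquarefree_linear_pair) (simp add: root_pair_def)
  moreover have "is_splitting_field k ?p (k_adjoin \<alpha>)"
    unfolding is_splitting_field_def
    using hull_eq_k_adjoin[OF rp] by (intro exI[of _ "[\<alpha>, \<beta>]"]) simp
  ultimately show ?thesis
    unfolding Ex2_def using galois_ext_k_adjoin[OF rp] by blast
qed

lemma Ex2E:
  assumes "X \<in> Ex2 k"
  obtains \<alpha> \<beta> where "root_pair \<alpha> \<beta>" "X = ext_class k (k_adjoin \<alpha>)"
proof -
  obtain L p where X: "X = ext_class k L" and p: "poly_over k p" "degree p = 2" "rsquarefree p"
    and sf: "is_splitting_field k p L"
    using assms unfolding Ex2_def by blast
  obtain as where as: "p = smult (lead_coeff p) (\<Prod>a\<leftarrow>as. [:-a, 1:])" and L: "L = is_subfield hull (k \<union> set as)"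
    using sf unfolding is_splitting_field_def by blast
  have "lead_coeff p \<noteq> 0" using p(3) unfolding rsquarefree_def by simp
  have "degree (\<Prod>a\<leftarrow>bs. [:-a, 1:]) = length bs \<and> (\<Prod>a\<leftarrow>bs. [:-a, 1:]) \<noteq> 0" for bs :: "'a list"
    by (induction bs) (auto simp: degree_mult_eq simp del: mult_pCons_left)
  then have "length as = 2"
    using p(2) as \<open>lead_coeff p \<noteq> 0\<close> by (metis degree_smult_eq)
  then obtain \<alpha> \<beta> where ab: "as = [\<alpha>, \<beta>]"
    by (auto simp: numeral_2_eq_2 length_Suc_conv)
  define r where "r = lead_coeff p"
  have r: "r \<noteq> 0" "r \<in> k" using \<open>lead_coeff p \<noteq> 0\<close> p(1) by (simp_all add: r_def poly_over_def)
  have p_eq: "p = smult r ([:- \<alpha>, 1:] * [:- \<beta>, 1:])"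
    using as by (simp add: ab flip: r_def)
  have "\<alpha> \<noteq> \<beta>"
  proof
    assume eq: "\<alpha> = \<beta>"
    have "Polynomial.order \<alpha> p = Polynomial.order \<alpha> ([:- \<alpha>, 1:] ^ 2)"
      using r(1) unfolding p_eq eq power2_eq_square by (rule order_smult)
    also have "\<dots> = 2" by (rule order_power_n_n)
    finally show False using p(3) unfolding rsquarefree_def by (metis numeral_eq_one_iff semiring_norm(85) zero_neq_numeral)
  qed
  moreover have "\<alpha> * \<beta> \<in> k" "\<alpha> + \<beta> \<in> k"
  proof -
    have "coeff p 0 = r * (\<alpha> * \<beta>)" "coeff p 1 = - (r * (\<alpha> + \<beta>))"
      unfolding p_eq by (simp_all add: algebra_simps)
    then have *: "r * (\<alpha> * \<beta>) \<in> k" "- (r * (\<alpha> + \<beta>)) \<in> k"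
      using p(1) unfolding poly_over_def by metis+
    have "r * (\<alpha> * \<beta>) / r \<in> k" "- (- (r * (\<alpha> + \<beta>))) / r \<in> k"
      by (intro k_closed(8) k_closed(6)[OF *(2)] * r)+
    then show "\<alpha> * \<beta> \<in> k" "\<alpha> + \<beta> \<in> k" using r(1) by simp_all
  qed
  ultimately have rp: "root_pair \<alpha> \<beta>" by (simp add: root_pair_def)
  moreover have "L = k_adjoin \<alpha>" using hull_eq_k_adjoin[OF rp] by (simp add: L ab)
  ultimately show thesis using X that by simp
qed

lemma ex_root_pair:
  assumes "c \<in> k" "d \<in> k" "c\<^sup>2 + 4 * d \<noteq> 0"
  obtains \<alpha> \<beta> where "root_pair \<alpha> \<beta>" "c = \<alpha> + \<beta>" "d = - (\<alpha> * \<beta>)"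
proof -
  let ?p = "[:- d, - c, 1:]"
  have "separable_poly ?p"
    unfolding separable_poly_def
  proof (rule coprimeI)
    fix q assume q: "q dvd ?p" "q dvd pderiv ?p"
    \<comment> \<open>The discriminant is a combination of the polynomial and its derivative in
      every characteristic: (2 X - c)^2 - 4 (X^2 - c X - d) = c^2 + 4 d.\<close>
    have "pderiv ?p = [:- c, 2:]" by (simp add: pderiv_pCons)
    then have "pderiv ?p * pderiv ?p - smult 4 ?p = [:c\<^sup>2 + 4 * d:]"
      by (simp add: power2_eq_square)
    moreover have "q dvd pderiv ?p * pderiv ?p - smult 4 ?p"
      by (intro dvd_diff dvd_mult dvd_smult q)
    ultimately have "q dvd [:c\<^sup>2 + 4 * d:]" by simp
    moreover have "is_unit [:c\<^sup>2 + 4 * d:]" using assms(3) by (simp add: is_unit_const_poly_iff dvd_field_iff)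
    ultimately show "is_unit q" by (rule dvd_trans)
  qed
  moreover have "degree ?p > 0" by simp
  ultimately obtain \<alpha> where "poly ?p \<alpha> = 0"
    using k_sep unfolding UNIV_is_separable_closure_def by blast
  then have root: "d = \<alpha> * \<alpha> - c * \<alpha>" by (simp add: algebra_simps add_eq_0_iff2)
  define \<beta> where "\<beta> = c - \<alpha>"
  have d: "d = - (\<alpha> * \<beta>)" and c: "c = \<alpha> + \<beta>"
    by (simp_all add: root \<beta>_def algebra_simps)
  have "c\<^sup>2 + 4 * d = (\<alpha> - \<beta>)\<^sup>2" unfolding c d by (simp add: power2_eq_square algebra_simps)
  then have "\<alpha> \<noteq> \<beta>" using assms(3) by auto
  then have "root_pair \<alpha> \<beta>"
    using assms(1,2) k_closed(6)[of d] by (simp add: root_pair_def c d)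
  then show thesis using c d by (rule that)
qed

section \<open>The field attached to a point\<close>

text \<open>The normal form becomes \<open>w\<close> over the closure by factoring its two
  degenerate members; the element of \<open>G_k\<close> leading to \<open>x\<close> contributes
  \<open>P\<close> to one evaluation and its conjugate to the other.\<close>

lemma ex_trivializer:
  assumes rp: "root_pair \<alpha> \<beta>" and x: "x \<in> V_k_ss k\<^sub>1 \<sigma>"
    and eqv: "normal_form (- (\<alpha> * \<beta>)) (\<alpha> + \<beta>) \<sim> x"
  shows "\<exists>g. g \<in> carrier (G_sep \<sigma> \<theta>) \<and> V_to_sep k \<theta> x = act_sep \<sigma> \<theta> g w_sep"
proof -
  have "\<alpha> \<noteq> \<beta>" using rp by (simp add: root_pair_def)
  define e where "e = 1 / (\<beta> - \<alpha>)"
  have e: "\<beta> * e - \<alpha> * e = 1" "e \<noteq> 0"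
    using \<open>\<alpha> \<noteq> \<beta>\<close> by (simp_all add: e_def flip: diff_divide_distrib)
  \<comment> \<open>\<open>?R\<close> sends the two matrices of \<open>w\<close> to the rank-one
    matrices \<open>x\<^sub>1 + \<alpha> x\<^sub>2\<close> and
    \<open>x\<^sub>1 + \<beta> x\<^sub>2\<close> of the normal form; \<open>?T\<close> is the
    inverse of the matrix with rows \<open>(1, \<alpha>)\<close> and \<open>(1, \<beta>)\<close> and
    recovers \<open>x\<^sub>1\<close> and \<open>x\<^sub>2\<close>.\<close>
  let ?R = "m2 1 1 \<alpha> \<beta>" and ?T = "m2 (\<beta> * e) (- \<alpha> * e) (- e) e"
  have nf: "act2 ?R ?R ?T w_elem = normal_form (- (\<alpha> * \<beta>)) (\<alpha> + \<beta>)"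
  proof -
    have "\<alpha> * (\<beta> * e) * \<alpha> - \<beta> * (\<alpha> * e) * \<beta> = - (\<alpha> * \<beta>) * (\<beta> * e - \<alpha> * e)"
      "\<beta> * e * \<beta> - \<alpha> * e * \<alpha> = (\<alpha> + \<beta>) * (\<beta> * e - \<alpha> * e)"
      by (simp_all add: algebra_simps)
    then show ?thesis
      unfolding e(1) using e(1) by (simp add: w_elem_m2 normal_form_def algebra_simps)
  qed
  obtain P C where PC: "det P \<noteq> 0" "det (map_matrix \<sigma> P) \<noteq> 0" "det C \<noteq> 0"
    and x_eq: "x = act2 P (map_matrix \<sigma> P) C (normal_form (- (\<alpha> * \<beta>)) (\<alpha> + \<beta>))"
    using eqv by (rule equiv_kE)
  obtain X where X: "tev \<theta> X = P ** ?R" "tev (\<sigma> \<theta>) X = map_matrix \<sigma> P ** ?R"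
    using \<theta>_moved by (rule tev_surj)
  have dets: "det ?R \<noteq> 0" "det ?T \<noteq> 0"
  proof -
    show "det ?R \<noteq> 0" using \<open>\<alpha> \<noteq> \<beta>\<close> by simp
    have "det ?T = (\<beta> * e - \<alpha> * e) * e" by (simp add: algebra_simps)
    then show "det ?T \<noteq> 0" unfolding e(1) using e(2) by simp
  qed
  have "(X, C ** ?T) \<in> carrier (G_sep \<sigma> \<theta>)"
    unfolding carrier_G_sep fst_conv snd_conv X det_mul using PC dets by simp
  moreover have "V_to_sep k \<theta> x = act_sep \<sigma> \<theta> (X, C ** ?T) w_sep"
  proof -
    have "x \<in> V_k k\<^sub>1 \<sigma>" using x by (simp add: V_k_ss_def)
    moreover have "x = act2 (tev \<theta> (fst (X, C ** ?T))) (tev (\<sigma> \<theta>) (fst (X, C ** ?T))) (snd (X, C ** ?T)) w_elem"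
      unfolding fst_conv snd_conv X act2_mult nf by (rule x_eq)
    ultimately show ?thesis
      by (rule V_to_sep_eq_act_sep_iff[THEN iffD2])
  qed
  ultimately show ?thesis by blast
qed

text \<open>The zeros are [1 : \<open>\<alpha>\<close>] and [1 : \<open>\<beta>\<close>]; an
  automorphism over \<open>k\<close> that fixes one of them fixes the other, because the sum of the
  roots lies in \<open>k\<close>.\<close>

lemma fixing_zeros_normal_form:
  assumes rp: "root_pair \<alpha> \<beta>"
  shows "fixing_zeros (F_form (normal_form (- (\<alpha> * \<beta>)) (\<alpha> + \<beta>))) = {\<eta> \<in> Gal k UNIV. \<eta> \<alpha> = \<alpha>}"
proof -
  have "F_form (normal_form (- (\<alpha> * \<beta>)) (\<alpha> + \<beta>)) v = - ((v $ 2 - \<alpha> * v $ 1) * (v $ 2 - \<beta> * v $ 1))" for v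
    unfolding F_form_normal_form by (simp add: power2_eq_square algebra_simps)
  then have zero: "F_form (normal_form (- (\<alpha> * \<beta>)) (\<alpha> + \<beta>)) v = 0 \<longleftrightarrow> v $ 2 = \<alpha> * v $ 1 \<or> v $ 2 = \<beta> * v $ 1" for v
    by simp
  have "(\<forall>v. F_form (normal_form (- (\<alpha> * \<beta>)) (\<alpha> + \<beta>)) v = 0 \<longrightarrow> v $ 1 * \<eta> (v $ 2) = v $ 2 * \<eta> (v $ 1))
    \<longleftrightarrow> \<eta> \<alpha> = \<alpha>" if \<eta>: "\<eta> \<in> Gal k UNIV" for \<eta>
  proof
    assume *: "\<forall>v. F_form (normal_form (- (\<alpha> * \<beta>)) (\<alpha> + \<beta>)) v = 0 \<longrightarrow> v $ 1 * \<eta> (v $ 2) = v $ 2 * \<eta> (v $ 1)"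
    define y :: "'a ^ 2" where "y = (\<chi> i. if i = 1 then 1 else \<alpha>)"
    have y: "y $ 1 = 1" "y $ 2 = \<alpha>" by (simp_all add: y_def)
    show "\<eta> \<alpha> = \<alpha>" using *[rule_format, of y] by (simp add: zero y Gal_UNIV_hom(5)[OF \<eta>])
  next
    assume \<alpha>: "\<eta> \<alpha> = \<alpha>"
    have "\<alpha> + \<eta> \<beta> = \<alpha> + \<beta>"
      using Gal_UNIV_hom(1)[OF \<eta>, of \<alpha> \<beta>] Gal_UNIV_hom(3)[OF \<eta>, of "\<alpha> + \<beta>"] rp
      by (simp add: root_pair_def \<alpha>)
    then have \<beta>: "\<eta> \<beta> = \<beta>" by simp
    show "\<forall>v. F_form (normal_form (- (\<alpha> * \<beta>)) (\<alpha> + \<beta>)) v = 0 \<longrightarrow> v $ 1 * \<eta> (v $ 2) = v $ 2 * \<eta> (v $ 1)"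
      by (auto simp: zero Gal_UNIV_hom(2)[OF \<eta>] \<alpha> \<beta>)
  qed
  then show ?thesis unfolding fixing_zeros_def by blast
qed

text \<open>The kernel is the group of automorphisms over \<open>k_adjoin \<alpha>\<close>, and the
  closure is also a separable closure of that field, so its fixed field is no larger.\<close>

lemma field_of_eq:
  assumes rp: "root_pair \<alpha> \<beta>" and x: "x \<in> V_k_ss k\<^sub>1 \<sigma>"
    and eqv: "normal_form (- (\<alpha> * \<beta>)) (\<alpha> + \<beta>) \<sim> x"
  shows "field_of k \<sigma> \<theta> x = k_adjoin \<alpha>"
proof -
  have "x \<in> V_k k\<^sub>1 \<sigma>" using x by (simp add: V_k_ss_def)
  then have ker: "rho_kernel k \<sigma> \<theta> x = {\<eta> \<in> Gal k UNIV. \<eta> \<alpha> = \<alpha>}"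
    using rho_kernel_eq[OF _ ex_trivializer[OF rp x eqv]] fixing_zeros_equiv[OF eqv]
      fixing_zeros_normal_form[OF rp] by simp
  show ?thesis
  proof (intro subset_antisym subsetI)
    fix a assume a: "a \<in> field_of k \<sigma> \<theta> x"
    show "a \<in> k_adjoin \<alpha>"
    proof (rule ccontr)
      assume "a \<notin> k_adjoin \<alpha>"
      then obtain \<eta> where \<eta>: "\<eta> \<in> Gal (k_adjoin \<alpha>) UNIV" "\<eta> a \<noteq> a"
        using ex_automorphism_moving[OF k_adjoin_subfield[OF rp]
            UNIV_is_separable_closure_mono[OF k_sep k_sub_k_adjoin]] by blast
      have "\<eta> \<in> Gal k UNIV" "\<eta> \<alpha> = \<alpha>"
        using \<eta>(1) k_sub_k_adjoin[of \<alpha>] gen_in_k_adjoin[of \<alpha>] by (auto simp: ext_isos_def)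
      then show False using a \<eta>(2) by (simp add: field_of_def ker)
    qed
  next
    fix a assume "a \<in> k_adjoin \<alpha>"
    then obtain p q where "p \<in> k" "q \<in> k" "a = p + q * \<alpha>" by (rule k_adjoinE)
    then show "a \<in> field_of k \<sigma> \<theta> x"
      by (simp add: field_of_def ker Gal_UNIV_hom(1,2,3))
  qed
qed

lemma V_k_ss_normal_form_roots:
  assumes "x \<in> V_k_ss k\<^sub>1 \<sigma>"
  obtains \<alpha> \<beta> where "root_pair \<alpha> \<beta>" "normal_form (- (\<alpha> * \<beta>)) (\<alpha> + \<beta>) \<sim> x"
proof -
  obtain c d where cd: "c \<in> k" "d \<in> k" "c\<^sup>2 + 4 * d \<noteq> 0" "x \<sim> normal_form d c"
    using equiv_normal_form[OF assms] by blast
  obtain \<alpha> \<beta> where "root_pair \<alpha> \<beta>" "c = \<alpha> + \<beta>" "d = - (\<alpha> * \<beta>)"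
    using cd(1-3) by (rule ex_root_pair)
  then show thesis using that equiv_k_sym[OF cd(4)] by simp
qed

lemma field_of_equiv:
  assumes "x \<in> V_k_ss k\<^sub>1 \<sigma>" "x \<sim> y"
  shows "field_of k \<sigma> \<theta> y = field_of k \<sigma> \<theta> x"
proof -
  obtain \<alpha> \<beta> where ab: "root_pair \<alpha> \<beta>" "normal_form (- (\<alpha> * \<beta>)) (\<alpha> + \<beta>) \<sim> x"
    using assms(1) by (rule V_k_ss_normal_form_roots)
  show ?thesis
    using field_of_eq[OF ab(1) assms(1) ab(2)]
      field_of_eq[OF ab(1) V_k_ss_equiv[OF assms] equiv_k_trans[OF ab(2) assms(2)]] by simp
qed

text \<open>If the roots lie in \<open>k\<close>, an affine map over \<open>k\<close> is
  interpolated through two points. Otherwise \<open>\<alpha>'\<close> is affine in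
  \<open>\<alpha>\<close>, and comparing the traces of the two quadratic equations gives the same
  relation for \<open>\<beta>'\<close>.\<close>

lemma affine_relation_of_roots:
  assumes rp: "root_pair \<alpha> \<beta>" and rp': "root_pair \<alpha>' \<beta>'" and eq: "k_adjoin \<alpha> = k_adjoin \<alpha>'"
  obtains p q where "p \<in> k" "q \<in> k" "q \<noteq> 0" "\<alpha>' = p + q * \<alpha>" "\<beta>' = p + q * \<beta>"
proof (cases "\<alpha> \<in> k")
  case True
  have adj: "k_adjoin \<alpha> = k" using True by (rule k_adjoin_eq_k)
  have mem: "\<alpha>' \<in> k" "\<beta>' \<in> k" "\<beta> \<in> k"
    using gen_in_k_adjoin[of \<alpha>'] other_root_in_k_adjoin[OF rp'] other_root_in_k_adjoin[OF rp]
    unfolding eq[symmetric] adj by simp_all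
  have ne: "\<alpha> \<noteq> \<beta>" "\<alpha>' \<noteq> \<beta>'" using rp rp' by (simp_all add: root_pair_def)
  define q where "q = (\<alpha>' - \<beta>') / (\<alpha> - \<beta>)"
  have q: "q * (\<alpha> - \<beta>) = \<alpha>' - \<beta>'" using ne by (simp add: q_def)
  show thesis
  proof (rule that[of "\<alpha>' - q * \<alpha>" q])
    show qk: "q \<in> k" unfolding q_def by (intro k_closed(3,8) mem True)
    show "\<alpha>' - q * \<alpha> \<in> k" by (intro k_closed(3,4) mem True qk)
    show "q \<noteq> 0" using ne by (simp add: q_def)
    show "\<alpha>' = \<alpha>' - q * \<alpha> + q * \<alpha>" by simp
    show "\<beta>' = \<alpha>' - q * \<alpha> + q * \<beta>" using q by (simp add: algebra_simps)
  qed
next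
  case False
  have "\<alpha>' \<in> k_adjoin \<alpha>" unfolding eq by (rule gen_in_k_adjoin)
  then obtain p q where pq: "p \<in> k" "q \<in> k" "\<alpha>' = p + q * \<alpha>" by (rule k_adjoinE)
  have "q \<noteq> 0"
  proof
    assume "q = 0"
    then have "\<alpha>' \<in> k" using pq by simp
    then show False using False gen_in_k_adjoin[of \<alpha>] eq k_adjoin_eq_k by simp
  qed
  have indep: "s = 0" if "r + s * \<alpha> = 0" "r \<in> k" "s \<in> k" for r s
  proof (rule ccontr)
    assume "s \<noteq> 0"
    then have "\<alpha> = - r / s" using that(1) by (simp add: field_simps add_eq_0_iff2)
    also have "\<dots> \<in> k" by (intro k_closed(6,8) that)
    finally show False using False by blast
  qed
  define t n t' n' where "t = \<alpha> + \<beta>" and "n = \<alpha> * \<beta>" and "t' = \<alpha>' + \<beta>'" and "n' = \<alpha>' * \<beta>'"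
  have mem: "t \<in> k" "n \<in> k" "t' \<in> k" "n' \<in> k"
    using rp rp' by (simp_all add: root_pair_def t_def n_def t'_def n'_def)
  have sq: "\<alpha> * \<alpha> = t * \<alpha> - n" "\<alpha>' * \<alpha>' = t' * \<alpha>' - n'"
    by (simp_all add: t_def n_def t'_def n'_def algebra_simps)
  \<comment> \<open>The equation of \<open>\<alpha>'\<close> with p + q \<open>\<alpha>\<close>
    substituted and the square of \<open>\<alpha>\<close> eliminated. Since 1 and
    \<open>\<alpha>\<close> are independent over \<open>k\<close>, the coefficient of
    \<open>\<alpha>\<close> vanishes, which relates \<open>t'\<close> to \<open>t\<close>.\<close>
  have "(p * p - q * q * n - t' * p + n') + (2 * p * q + q * q * t - t' * q) * \<alpha> =
      (\<alpha>' * \<alpha>' - (t' * \<alpha>' - n')) - q * q * (\<alpha> * \<alpha> - (t * \<alpha> - n))"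
    unfolding pq(3) by (simp add: algebra_simps)
  also have "\<dots> = 0" unfolding sq by simp
  finally have "2 * p * q + q * q * t - t' * q = 0"
  proof (rule indep)
    have "(2 :: 'a) \<in> k" using k_closed(7)[OF k_closed(2,2)] by simp
    then show "p * p - q * q * n - t' * p + n' \<in> k" "2 * p * q + q * q * t - t' * q \<in> k"
      by (intro k_closed(3,4,7) mem pq)+
  qed
  then have "q * (2 * p + q * t - t') = 0" by (simp add: algebra_simps)
  then have "t' = 2 * p + q * t" using \<open>q \<noteq> 0\<close> by simp
  then have "\<beta>' = p + q * \<beta>" unfolding t_def t'_def pq(3) by (simp add: algebra_simps)
  then show thesis by (rule that[OF pq(1,2) \<open>q \<noteq> 0\<close> pq(3)])
qed

lemma equiv_if_ext_class_eq:
  assumes x: "x \<in> V_k_ss k\<^sub>1 \<sigma>" and y: "y \<in> V_k_ss k\<^sub>1 \<sigma>"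
    and eq: "ext_class k (field_of k \<sigma> \<theta> x) = ext_class k (field_of k \<sigma> \<theta> y)"
  shows "x \<sim> y"
proof -
  obtain \<alpha> \<beta> where a: "root_pair \<alpha> \<beta>" "normal_form (- (\<alpha> * \<beta>)) (\<alpha> + \<beta>) \<sim> x"
    using x by (rule V_k_ss_normal_form_roots)
  obtain \<alpha>' \<beta>' where a': "root_pair \<alpha>' \<beta>'" "normal_form (- (\<alpha>' * \<beta>')) (\<alpha>' + \<beta>') \<sim> y"
    using y by (rule V_k_ss_normal_form_roots)
  have "k_adjoin \<alpha> = k_adjoin \<alpha>'"
    using eq unfolding field_of_eq[OF a(1) x a(2)] field_of_eq[OF a'(1) y a'(2)]
    by (rule ext_class_k_adjoin_inj[OF a(1) a'(1)])
  with a(1) a'(1) obtain p q where pq: "p \<in> k" "q \<in> k" "q \<noteq> 0" "\<alpha>' = p + q * \<alpha>" "\<beta>' = p + q * \<beta>"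
    by (rule affine_relation_of_roots)
  have "\<alpha> + \<beta> \<in> k" "- (\<alpha> * \<beta>) \<in> k" using a(1) k_closed(6) by (simp_all add: root_pair_def)
  from normal_form_affine_change[OF this pq(1-3)]
  have change: "normal_form (- (\<alpha> * \<beta>)) (\<alpha> + \<beta>) \<sim>
      normal_form (q\<^sup>2 * - (\<alpha> * \<beta>) - p\<^sup>2 - p * q * (\<alpha> + \<beta>)) (2 * p + q * (\<alpha> + \<beta>))" .
  have "q\<^sup>2 * - (\<alpha> * \<beta>) - p\<^sup>2 - p * q * (\<alpha> + \<beta>) = - (\<alpha>' * \<beta>')" "2 * p + q * (\<alpha> + \<beta>) = \<alpha>' + \<beta>'"
    unfolding pq(4,5) by (simp_all add: power2_eq_square algebra_simps)
  with change have "normal_form (- (\<alpha> * \<beta>)) (\<alpha> + \<beta>) \<sim> normal_form (- (\<alpha>' * \<beta>')) (\<alpha>' + \<beta>')"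
    by (simp only:)
  from equiv_k_sym[OF a(2)] equiv_k_trans[OF this a'(2)] show ?thesis
    by (rule equiv_k_trans)
qed

section \<open>The bijection between orbits and isomorphism classes\<close>

lemma alpha_V_orbit:
  assumes "x \<in> V_k_ss k\<^sub>1 \<sigma>"
  shows "alpha_V k \<sigma> \<theta> (orbit (G_k k k\<^sub>1) (act_k \<sigma>) x) = ext_class k (field_of k \<sigma> \<theta> x)"
proof -
  have "(\<lambda>y. ext_class k (field_of k \<sigma> \<theta> y)) ` {y. x \<sim> y} = (\<lambda>y. ext_class k (field_of k \<sigma> \<theta> x)) ` {y. x \<sim> y}"
    by (intro image_cong refl) (simp add: field_of_equiv[OF assms])
  also have "\<dots> = {ext_class k (field_of k \<sigma> \<theta> x)}"
    by (rule image_constant[of x]) (simp add: equiv_k_refl)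
  finally have "(\<lambda>y. ext_class k (field_of k \<sigma> \<theta> y)) ` {y. x \<sim> y} = {ext_class k (field_of k \<sigma> \<theta> x)}" .
  then show ?thesis unfolding alpha_V_def orbit_eq by simp
qed

lemma bij_betw_alpha_V:
  "bij_betw (alpha_V k \<sigma> \<theta>) (orbits (G_k k k\<^sub>1) (V_k_ss k\<^sub>1 \<sigma>) (act_k \<sigma>)) (Ex2 k)"
  unfolding bij_betw_def
proof
  show "inj_on (alpha_V k \<sigma> \<theta>) (orbits (G_k k k\<^sub>1) (V_k_ss k\<^sub>1 \<sigma>) (act_k \<sigma>))"
  proof (rule inj_onI)
    fix X Y assume "X \<in> orbits (G_k k k\<^sub>1) (V_k_ss k\<^sub>1 \<sigma>) (act_k \<sigma>)" "Y \<in> orbits (G_k k k\<^sub>1) (V_k_ss k\<^sub>1 \<sigma>) (act_k \<sigma>)"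
      and eq: "alpha_V k \<sigma> \<theta> X = alpha_V k \<sigma> \<theta> Y"
    then obtain x y where x: "x \<in> V_k_ss k\<^sub>1 \<sigma>" "X = orbit (G_k k k\<^sub>1) (act_k \<sigma>) x"
      and y: "y \<in> V_k_ss k\<^sub>1 \<sigma>" "Y = orbit (G_k k k\<^sub>1) (act_k \<sigma>) y"
      unfolding orbits_def by blast
    have "x \<sim> y"
      using eq unfolding x(2) y(2) alpha_V_orbit[OF x(1)] alpha_V_orbit[OF y(1)]
      by (rule equiv_if_ext_class_eq[OF x(1) y(1)])
    then show "X = Y" unfolding x(2) y(2) orbit_eq_iff .
  qed
  show "alpha_V k \<sigma> \<theta> ` orbits (G_k k k\<^sub>1) (V_k_ss k\<^sub>1 \<sigma>) (act_k \<sigma>) = Ex2 k"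
  proof (intro subset_antisym subsetI)
    fix X assume "X \<in> alpha_V k \<sigma> \<theta> ` orbits (G_k k k\<^sub>1) (V_k_ss k\<^sub>1 \<sigma>) (act_k \<sigma>)"
    then obtain x where x: "x \<in> V_k_ss k\<^sub>1 \<sigma>" "X = ext_class k (field_of k \<sigma> \<theta> x)"
      unfolding orbits_def using alpha_V_orbit by blast
    obtain \<alpha> \<beta> where ab: "root_pair \<alpha> \<beta>" "normal_form (- (\<alpha> * \<beta>)) (\<alpha> + \<beta>) \<sim> x"
      using x(1) by (rule V_k_ss_normal_form_roots)
    show "X \<in> Ex2 k"
      unfolding x(2) field_of_eq[OF ab(1) x(1) ab(2)] by (rule ext_class_k_adjoin_in_Ex2[OF ab(1)])
  next
    fix X assume "X \<in> Ex2 k"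
    then obtain \<alpha> \<beta> where ab: "root_pair \<alpha> \<beta>" "X = ext_class k (k_adjoin \<alpha>)" by (rule Ex2E)
    let ?w = "normal_form (- (\<alpha> * \<beta>)) (\<alpha> + \<beta>)"
    have "(\<alpha> + \<beta>)\<^sup>2 + 4 * - (\<alpha> * \<beta>) = (\<alpha> - \<beta>)\<^sup>2"
      by (simp add: power2_eq_square algebra_simps)
    then have w: "?w \<in> V_k_ss k\<^sub>1 \<sigma>"
      using ab(1) by (intro normal_form_V_k_ss) (simp_all add: root_pair_def k_closed(6))
    have "X = alpha_V k \<sigma> \<theta> (orbit (G_k k k\<^sub>1) (act_k \<sigma>) ?w)"
      unfolding alpha_V_orbit[OF w] field_of_eq[OF ab(1) w equiv_k_refl] by (rule ab(2))
    then show "X \<in> alpha_V k \<sigma> \<theta> ` orbits (G_k k k\<^sub>1) (V_k_ss k\<^sub>1 \<sigma>) (act_k \<sigma>)"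
      using w unfolding orbits_def by blast
  qed
qed

end

theorem theorem2p11:
  fixes k k\<^sub>1 :: "'a::field set" and \<sigma> :: "'a \<Rightarrow> 'a" and \<theta> :: 'a
  assumes "is_subfield k" and "infinite k"
    and "UNIV_is_separable_closure k"
    and "separable_quadratic_ext k k\<^sub>1"
    and "\<sigma> \<in> Gal k k\<^sub>1" and "\<exists>a\<in>k\<^sub>1. \<sigma> a \<noteq> a"
    and "\<theta> \<in> k\<^sub>1 - k"
  shows "(\<forall>x\<in>V_k_ss k\<^sub>1 \<sigma>. alpha_V k \<sigma> \<theta> (orbit (G_k k k\<^sub>1) (act_k \<sigma>) x)
            = ext_class k (field_of k \<sigma> \<theta> x))
       \<and> bij_betw (alpha_V k \<sigma> \<theta>)
           (orbits (G_k k k\<^sub>1) (V_k_ss k\<^sub>1 \<sigma>) (act_k \<sigma>)) (Ex2 k)"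
proof -
  interpret hermitian_pairs k k\<^sub>1 \<sigma> \<theta>
    using assms by unfold_locales
  show ?thesis
    using alpha_V_orbit bij_betw_alpha_V by blast
qed

end
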